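(* There is a constant $c>0$ such that the number of pairwise non-isomorphic $n$-vertex graphs that are determined by their signless Laplacian spectrum is at least $e^{cn}$.
   Context: All graphs are finite and simple. For a graph $G$ with vertices $v_1,\dots,v_n$, let $\mathrm{D}(G)$ be the diagonal matrix of degrees and $\mathrm{A}(G)$ the adjacency matrix. The signless Laplacian is $|\mathrm{L}(G)|=\mathrm{D}(G)+\mathrm{A}(G)$, and its spectrum (multiset of eigenvalues) is the signless Laplacian spectrum of $G$. A graph $G$ is determined by its signless Laplacian spectrum if every graph with the same signless Laplacian spectrum as $G$ is isomorphic to $G$.
   Formalization: The bound is stated for all n ≥ 2, because for n = 1 there is only one graph and 1 < e^c for every c > 0. *)

theory Defs
  imports "Jordan_Normal_Form.Char_Poly" Complex_Main
begin

text \<open>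
  A finite simple graph with vertices \<open>v\<^sub>1, \<dots>, v\<^sub>n\<close> is represented by its number \<open>n\<close> of vertices
  and its set \<open>E\<close> of edges; the vertices are the numbers \<open>0, \<dots>, n - 1\<close>, and an edge is the
  set of its two ends. Every finite simple graph is isomorphic to one of these.
\<close>

definition simple_graphs :: "nat \<Rightarrow> nat set set set" where
  "simple_graphs n = {E. E \<subseteq> {{u, v} |u v. u < n \<and> v < n \<and> u \<noteq> v}}"

definition vertex_degree :: "nat set set \<Rightarrow> nat \<Rightarrow> nat" where
  "vertex_degree E v = card {e \<in> E. v \<in> e}"

definition degree_matrix :: "nat \<Rightarrow> nat set set \<Rightarrow> complex mat" where
  "degree_matrix n E = mat n n (\<lambda>(i, j). if i = j then of_nat (vertex_degree E i) else 0)"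

definition adjacency_matrix :: "nat \<Rightarrow> nat set set \<Rightarrow> complex mat" where
  "adjacency_matrix n E = mat n n (\<lambda>(i, j). if {i, j} \<in> E then 1 else 0)"

definition signless_laplacian :: "nat \<Rightarrow> nat set set \<Rightarrow> complex mat" where
  "signless_laplacian n E = degree_matrix n E + adjacency_matrix n E"

text \<open>
  The eigenvalues are counted with algebraic multiplicity. The matrix is real symmetric, so
  these are the geometric multiplicities too, and all the eigenvalues are real; complex entries
  only ensure that the characteristic polynomial splits without an appeal to the spectral theorem.
\<close>

definition signless_laplacian_spectrum :: "nat \<Rightarrow> nat set set \<Rightarrow> complex multiset" where
  "signless_laplacian_spectrum n E = proots (char_poly (signless_laplacian n E))"

definition graph_isomorphic :: "nat \<Rightarrow> nat set set \<Rightarrow> nat \<Rightarrow> nat set set \<Rightarrow> bool" where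
  "graph_isomorphic n E m F \<longleftrightarrow>
     (\<exists>f. bij_betw f {..<n} {..<m} \<and> (\<forall>u<n. \<forall>v<n. {u, v} \<in> E \<longleftrightarrow> {f u, f v} \<in> F))"

definition determined_by_signless_laplacian_spectrum :: "nat \<Rightarrow> nat set set \<Rightarrow> bool" where
  "determined_by_signless_laplacian_spectrum n E \<longleftrightarrow>
     (\<forall>m. \<forall>F \<in> simple_graphs m.
        signless_laplacian_spectrum m F = signless_laplacian_spectrum n E \<longrightarrow>
        graph_isomorphic m F n E)"

definition isomorphism_relation :: "nat \<Rightarrow> (nat set set \<times> nat set set) set" where
  "isomorphism_relation n =
     {(E, F). E \<in> simple_graphs n \<and> F \<in> simple_graphs n \<and> graph_isomorphic n E n F}"

lemma finite_simple_graphs: "finite (simple_graphs n)"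
proof -
  have "{{u, v} |u v. u < n \<and> v < n \<and> u \<noteq> v} \<subseteq> Pow {..<n}" by auto
  then have "finite {{u, v} |u v. u < n \<and> v < n \<and> u \<noteq> v}"
    by (rule finite_subset) simp
  then show ?thesis unfolding simple_graphs_def by (simp add: finite_Collect_subsets)
qed

lemma equiv_isomorphism_relation: "equiv (simple_graphs n) (isomorphism_relation n)"
proof (rule equivI)
  show "isomorphism_relation n \<subseteq> simple_graphs n \<times> simple_graphs n"
    by (auto simp: isomorphism_relation_def)
  show "refl_on (simple_graphs n) (isomorphism_relation n)"
    unfolding refl_on_def isomorphism_relation_def graph_isomorphic_def
    by (auto intro!: exI[of _ id])
  show "sym (isomorphism_relation n)"
  proof (rule symI, unfold isomorphism_relation_def, clarsimp)
    fix E F assume "graph_isomorphic n E n F"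
    then obtain f where f: "bij_betw f {..<n} {..<n}"
      and e: "\<And>u v. u < n \<Longrightarrow> v < n \<Longrightarrow> {u, v} \<in> E \<longleftrightarrow> {f u, f v} \<in> F"
      by (auto simp: graph_isomorphic_def)
    let ?g = "inv_into {..<n} f"
    have g: "bij_betw ?g {..<n} {..<n}" by (rule bij_betw_inv_into[OF f])
    have l: "?g u < n" "f (?g u) = u" if "u < n" for u
      using that bij_betwE[OF g] bij_betw_inv_into_right[OF f] by auto
    show "graph_isomorphic n F n E"
      unfolding graph_isomorphic_def by (rule exI[of _ ?g]) (use g e l in simp)
  qed
  show "trans (isomorphism_relation n)"
  proof (rule transI, unfold isomorphism_relation_def, clarsimp)
    fix E F H assume "graph_isomorphic n E n F" "graph_isomorphic n F n H"
    then obtain f g where f: "bij_betw f {..<n} {..<n}" and g: "bij_betw g {..<n} {..<n}"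
      and e: "\<And>u v. u < n \<Longrightarrow> v < n \<Longrightarrow> {u, v} \<in> E \<longleftrightarrow> {f u, f v} \<in> F"
      and e': "\<And>u v. u < n \<Longrightarrow> v < n \<Longrightarrow> {u, v} \<in> F \<longleftrightarrow> {g u, g v} \<in> H"
      by (auto simp: graph_isomorphic_def)
    have l: "f u < n" if "u < n" for u using that bij_betwE[OF f] by auto
    show "graph_isomorphic n E n H"
      unfolding graph_isomorphic_def
      by (rule exI[of _ "g \<circ> f"]) (use bij_betw_trans[OF f g] e e' l in simp)
  qed
qed

end

theory Submission
  imports Defs "Jordan_Normal_Form.Schur_Decomposition"
begin

text \<open>
  A sun is a cycle with a pendant vertex (leaf) attached to some of its vertices. Consider suns with
  no two consecutive branching vertices, described by the cyclic word \<open>L1, L2, w\<close> of distances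
  between successive branching vertices, where \<open>w\<close> is a word over \<open>{4, 5}\<close> and \<open>L1\<close>, \<open>L2\<close> are long.
  
  Let \<open>F\<close> have the same characteristic polynomial \<open>P\<close> as such a sun. The traces of the first four
  powers, together with \<open>P(0) \<noteq> 0\<close> and \<open>P(1) \<noteq> 0\<close>, force all degrees of \<open>F\<close> to be 1, 2 or 3, the two
  degrees along any edge to sum to 4 or 5, and no two leaves to have a common neighbour. Hence the
  vertices of degree at least 2 induce a 2-regular graph, and \<open>F\<close> is a disjoint union of suns. An odd
  cycle contributes a factor of modulus 4 to \<open>P(0)\<close> and the rest of the graph an even integer, so
  \<open>|P(0)| = 4\<close> leaves a single sun.
  
  Substituting \<open>x = (1 + z)^2 / z\<close> turns \<open>P\<close>, up to known terms, into the trace of a product of 2x2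
  matrices over the polynomials in \<open>z\<close>, one for each distance. Its low-order coefficients count the
  distances 4 and 5. The distances \<open>L1\<close> and \<open>L2\<close> are so long that the four terms of the trace, split at
  these distances, occupy separate ranges of exponents; comparing them recovers \<open>w\<close> up to reversal.
  Exponentially many \<open>w\<close> give suns with the same number of vertices.
\<close>

section \<open>Transfer matrices\<close>

text \<open>The low-order coefficients of the trace tell how often a distance occurs but not in
  which order; the two long distances are there to recover the order. Each separated range of
  exponents still yields only the product of an entry of one chain with an entry of the other, and
  the determinants, which are known from lengths and sums alone, serve to take these products apart.
  The long distances can be kept linear in the length of \<open>w\<close>, because a letter raises
  degrees by at most 13; hence the number of words remains exponential in the number of vertices.

  Two arithmetic conditions shape the suns. An even cycle would give \<open>P(0) = 0\<close>, so the
  cycle length is odd. A distance divisible by 3 would give \<open>P(1) = 0\<close>, so all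
  distances are prime to 3. Finally, if all distances are at least \<open>m\<close>, only the counts
  of distances below \<open>2 * m\<close> are visible; with \<open>m = 4\<close> the two letters 4
  and 5 lie in this window and are prime to 3.\<close>

datatype 'a m2 = M2 (e11: 'a) (e12: 'a) (e21: 'a) (e22: 'a)

instantiation m2 :: (comm_ring_1) monoid_mult
begin
definition "1 = M2 1 0 0 1"
definition "A * B = M2 (e11 A * e11 B + e12 A * e21 B) (e11 A * e12 B + e12 A * e22 B)
  (e21 A * e11 B + e22 A * e21 B) (e21 A * e12 B + e22 A * e22 B)"
instance by standard (auto simp: one_m2_def times_m2_def algebra_simps)
end

lemma m2_mult [simp]:
  "e11 (A * B) = e11 A * e11 B + e12 A * e21 B" "e12 (A * B) = e11 A * e12 B + e12 A * e22 B"
  "e21 (A * B) = e21 A * e11 B + e22 A * e21 B" "e22 (A * B) = e21 A * e12 B + e22 A * e22 B"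
  by (simp_all add: times_m2_def)

lemma m2_one [simp]: "e11 1 = 1" "e12 1 = 0" "e21 1 = 0" "e22 1 = 1"
  by (simp_all add: one_m2_def)

definition m2_tr :: "'a::comm_ring_1 m2 \<Rightarrow> 'a" where "m2_tr A = e11 A + e22 A"
definition m2_det :: "'a::comm_ring_1 m2 \<Rightarrow> 'a" where "m2_det A = e11 A * e22 A - e12 A * e21 A"

lemma m2_tr_commute: "m2_tr (A * B) = m2_tr (B * A)"
  by (simp add: m2_tr_def algebra_simps)

lemma m2_det_mult: "m2_det (A * B) = m2_det A * m2_det B"
  by (simp add: m2_det_def algebra_simps)

text \<open>The transpose conjugated by diag(1, -1). It reverses products and fixes both
  \<open>defect\<close> and \<open>shift\<close>, so on chains it acts as reversal of the
  word.\<close>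

definition m2_rev :: "'a::comm_ring_1 m2 \<Rightarrow> 'a m2" where
  "m2_rev A = M2 (e11 A) (- e21 A) (- e12 A) (e22 A)"

lemma m2_rev_mult: "m2_rev (A * B) = m2_rev B * m2_rev A"
  by (simp add: m2_rev_def m2.expand algebra_simps)

text \<open>
  For \<open>x = (1 + z)^2 / z\<close> the transfer matrix of a cycle vertex without leaf has the eigenvalues \<open>z\<close> and
  \<open>1 / z\<close>. In an eigenbasis and scaled by \<open>z\<close> it becomes \<open>shift z 1\<close>; that of a branching vertex, scaled
  by \<open>z * rden z\<close>, becomes \<open>shift z 1 * defect z\<close>. See \<open>transfer_sun_step\<close>.
\<close>

definition rden :: "'a::comm_ring_1 \<Rightarrow> 'a" where "rden z = 1 - z ^ 3"
definition rnum :: "'a::comm_ring_1 \<Rightarrow> 'a" where "rnum z = z + z ^ 2"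
definition defect :: "'a::comm_ring_1 \<Rightarrow> 'a m2" where
  "defect z = M2 (rden z - rnum z) (- rnum z) (rnum z) (rden z + rnum z)"
definition shift :: "'a::comm_ring_1 \<Rightarrow> nat \<Rightarrow> 'a m2" where
  "shift z d = M2 1 0 0 (z ^ (2 * d))"

definition ring_prod :: "'a::comm_ring_1 \<Rightarrow> nat list \<Rightarrow> 'a m2" where
  "ring_prod z ds = prod_list (map (\<lambda>d. defect z * shift z d) ds)"
text \<open>The closing \<open>defect\<close> has no \<open>shift\<close> after it: this is the
  piece of a cyclic product strictly between two gaps, and \<open>m2_rev\<close> maps such pieces to
  such pieces.\<close>

definition chain :: "'a::comm_ring_1 \<Rightarrow> nat list \<Rightarrow> 'a m2" where
  "chain z us = ring_prod z us * defect z"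

lemma defect_sel [simp]: "e11 (defect z) = rden z - rnum z" "e12 (defect z) = - rnum z"
  "e21 (defect z) = rnum z" "e22 (defect z) = rden z + rnum z" by (simp_all add: defect_def)
lemma shift_sel [simp]: "e11 (shift z d) = 1" "e12 (shift z d) = 0" "e21 (shift z d) = 0"
  "e22 (shift z d) = z ^ (2 * d)" by (simp_all add: shift_def)

lemma ring_prod_Nil [simp]: "ring_prod z [] = 1"
  and ring_prod_Cons [simp]: "ring_prod z (d # ds) = defect z * shift z d * ring_prod z ds"
  and ring_prod_append: "ring_prod z (ds @ es) = ring_prod z ds * ring_prod z es"
  by (simp_all add: ring_prod_def)

lemma chain_Nil: "chain z [] = defect z"
  and chain_Cons: "chain z (d # us) = defect z * shift z d * chain z us"
  by (simp_all add: chain_def mult.assoc)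

lemma m2_tr_ring_prod_rotate: "m2_tr (ring_prod z (rotate i ds)) = m2_tr (ring_prod z ds)"
proof -
  have "m2_tr (ring_prod z (ys @ xs)) = m2_tr (ring_prod z (xs @ ys))" for xs ys
    by (simp add: ring_prod_append m2_tr_commute)
  then show ?thesis by (metis append_take_drop_id rotate_drop_take)
qed

lemma m2_det_defect: "m2_det (defect z) = rden z ^ 2"
  by (simp add: m2_det_def algebra_simps power2_eq_square)

lemma m2_det_shift: "m2_det (shift z d) = z ^ (2 * d)"
  by (simp add: m2_det_def)

lemma m2_det_chain: "m2_det (chain z us) = z ^ (2 * sum_list us) * rden z ^ (2 * length us + 2)"
  by (induction us)
     (simp_all add: chain_Nil chain_Cons m2_det_mult m2_det_defect m2_det_shift power_add
        power2_eq_square algebra_simps)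

lemma m2_rev_defect: "m2_rev (defect z) = defect z"
  and m2_rev_shift: "m2_rev (shift z d) = shift z d"
  by (simp_all add: m2_rev_def m2.expand)

lemma m2_rev_chain: "m2_rev (chain z us) = chain z (rev us)"
proof (induction us)
  case (Cons d us)
  have snoc: "chain z (vs @ [d]) = chain z vs * shift z d * defect z" for vs
    by (simp add: chain_def ring_prod_append mult.assoc)
  show ?case
    by (simp add: chain_Cons m2_rev_mult m2_rev_defect m2_rev_shift Cons.IH snoc mult.assoc)
qed (simp add: chain_Nil m2_rev_defect)

definition Z :: "complex poly" where "Z = [:0, 1:]"

lemma coeff_Z_power_mult: "coeff (Z ^ m * p) i = (if i < m then 0 else coeff p (i - m))"
  using coeff_monom_mult[of 1 m p i] by (simp add: monom_altdef Z_def)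

lemmas ring_normal = algebra_simps power2_eq_square power3_eq_cube power4_eq_xxxx

lemma sum_list_map_butlast:
  "xs \<noteq> [] \<Longrightarrow> (\<Sum>x\<leftarrow>xs. f x) = (\<Sum>x\<leftarrow>butlast xs. f x) + (f (last xs) :: 'a::comm_monoid_add)"
  by (induction xs rule: rev_induct) auto

section \<open>Recovering a word from its trace\<close>

text \<open>Read the product as a sum over paths between the states 1 and 2. Being in state 2 behind
  a distance \<open>d\<close> costs \<open>Z ^ (2*d)\<close>, and each change of state costs a
  factor \<open>k\<close>, divisible by \<open>Z\<close>. A path from 1 to 1 with one visit to 2
  gives the sum, without the last distance because the path must end in 1; a second visit brings at
  least \<open>Z ^ (4*m)\<close>. In the last entry the path that never leaves state 2 is kept
  apart, because it carries no factor \<open>k\<close>.\<close>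

lemma ring_prod_expansion:
  fixes m :: nat and ds :: "nat list"
  assumes "length ds \<ge> 2" "\<forall>d\<in>set ds. d \<ge> m" "m \<ge> 1"
  defines "a \<equiv> rden Z - rnum Z" and "k \<equiv> rnum Z" and "c \<equiv> rden Z" and "b \<equiv> length ds"
  shows "\<exists>w1 w2 w3 w4.
     e11 (ring_prod Z ds) = a ^ b - k^2 * a ^ (b - 2) * (\<Sum>d\<leftarrow>butlast ds. Z ^ (2*d)) + Z ^ (4*m+2) * w1 \<and>
     e12 (ring_prod Z ds) = - k * a ^ (b - 1) * Z ^ (2 * last ds) + Z ^ (4*m+1) * w2 \<and>
     e21 (ring_prod Z ds) = k * a ^ (b - 1) + Z ^ (2*m+1) * w3 \<and>
     e22 (ring_prod Z ds) = - (k^2) * a ^ (b - 2) * Z ^ (2 * last ds) + Z ^ (4*m+2) * w4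
        + (c + k) ^ b * Z ^ (2 * sum_list ds)" using assms(1,2) unfolding b_def
proof (induction ds rule: rev_induct)
  case (snoc d ds)
  define k1 where "k1 = 1 + Z"
  have k: "k = Z * k1" by (simp add: k_def rnum_def k1_def algebra_simps power2_eq_square)
  have d: "Z ^ (2*d) = Z ^ (2*m) * Z ^ (2*(d-m))"
    using snoc.prems by (simp add: power_add[symmetric] algebra_simps)
  define y where "y = Z ^ (2*(d-m))"
  have DE: "e11 (defect Z * shift Z d) = a" "e12 (defect Z * shift Z d) = - k * Z ^ (2*d)"
    "e21 (defect Z * shift Z d) = k" "e22 (defect Z * shift Z d) = (c + k) * Z ^ (2*d)"
    by (simp_all add: a_def k_def c_def)
  have P: "ring_prod Z (ds @ [d]) = ring_prod Z ds * (defect Z * shift Z d)"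
    by (simp add: ring_prod_append)
  have SL: "Z ^ (2 * sum_list (ds @ [d])) = Z ^ (2 * sum_list ds) * Z ^ (2 * d)"
    by (simp add: power_add algebra_simps)
  show ?case
  proof (cases "length ds \<ge> 2")
    case True
    then obtain b where b: "length ds = Suc (Suc b)" by (metis Suc_le_D add_2_eq_Suc le_Suc_ex)
    have ne: "ds \<noteq> []" using True by auto
    have dl: "Z ^ (2 * last ds) = Z ^ (2*m) * Z ^ (2*(last ds - m))"
      using snoc.prems ne by (simp add: power_add[symmetric] algebra_simps)
    have "m \<le> last ds" using snoc.prems ne by simp
    also have "last ds \<le> sum_list ds" by (rule member_le_sum_list) (use ne in auto)
    finally have "m \<le> sum_list ds" .
    then have ds: "Z ^ (2 * sum_list ds) = Z ^ (2*m) * Z ^ (2*(sum_list ds - m))"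
      by (simp add: power_add[symmetric] algebra_simps)
    define yl where "yl = Z ^ (2*(last ds - m))"
    define ys where "ys = Z ^ (2*(sum_list ds - m))"
    define S where "S = (\<Sum>d\<leftarrow>butlast ds. Z ^ (2*d))"
    define M where "M = Z ^ m"
    have M2: "Z ^ (2*m) = M^2" and M4: "Z ^ (4*m) = M^4"
      by (simp_all add: M_def power_mult[symmetric] mult.commute)
    define S1 where "S1 = (\<Sum>d\<leftarrow>butlast ds. Z ^ (2*(d-m)))"
    have "\<forall>d\<in>set (butlast ds). m \<le> d"
      using snoc.prems by (auto dest: in_set_butlastD)
    then have S1: "S = M\<^sup>2 * S1"
      unfolding S_def S1_def M2[symmetric] sum_list_const_mult[symmetric]
      by (intro arg_cong[where f = sum_list] map_cong) (auto simp: power_add[symmetric] algebra_simps)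
    from snoc.IH True snoc.prems obtain w1 w2 w3 w4 where
     IH: "e11 (ring_prod Z ds) = a ^ Suc (Suc b) - k^2 * a ^ b * S + Z ^ (4*m+2) * w1"
     "e12 (ring_prod Z ds) = - k * a ^ (Suc b) * Z ^ (2 * last ds) + Z ^ (4*m+1) * w2"
     "e21 (ring_prod Z ds) = k * a ^ (Suc b) + Z ^ (2*m+1) * w3"
     "e22 (ring_prod Z ds) = - (k^2) * a ^ b * Z ^ (2 * last ds) + Z ^ (4*m+2) * w4
        + (c + k) ^ Suc (Suc b) * Z ^ (2 * sum_list ds)" unfolding b S_def by auto
    have S': "(\<Sum>d\<leftarrow>butlast (ds @ [d]). Z ^ (2*d)) = S + Z ^ (2 * last ds)"
      unfolding S_def using sum_list_map_butlast[OF ne] by simp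
    \<comment> \<open>The remainders are what each entry of the product leaves beyond its main
      terms, divided by the stated power of \<open>Z\<close>.\<close>
    define v1 where "v1 = w1 * a + w2 * k1"
    define v2 where "v2 = k1^3 * a^b * S1 * Z^2 * y - M^2 * Z^2 * w1 * k1 * y
       - k1 * a^Suc b * yl * (c+k) * y + M^2 * y * w2 * (c+k)"
    define v3 where "v3 = w3 * a - Z^2 * k1^3 * a^b * yl + Z^2 * M^2 * w4 * k1
        + k1 * (c + k) ^ Suc (Suc b) * ys"
    define v4 where "v4 = - k1 * w3 * y - k1^2 * a^b * yl * (c+k) * y + w4 * (c+k) * M^2 * y"
    have g1: "e11 (ring_prod Z (ds @ [d])) = a ^ Suc (Suc (Suc b))
        - k^2 * a ^ Suc b * (S + Z ^ (2 * last ds)) + Z ^ (4*m+2) * v1"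
      unfolding P m2_mult[of "ring_prod Z ds"] DE IH v1_def by (simp add: k algebra_simps power2_eq_square)
    have g2: "e12 (ring_prod Z (ds @ [d])) = - k * a ^ (Suc (Suc b)) * Z ^ (2 * d) + Z ^ (4*m+1) * v2"
      unfolding P m2_mult[of "ring_prod Z ds"] DE IH v2_def S1 d dl y_def[symmetric] yl_def[symmetric] power_add M2 M4
      by (simp add: k ring_normal)
    have g3: "e21 (ring_prod Z (ds @ [d])) = k * a ^ (Suc (Suc b)) + Z ^ (2*m+1) * v3"
      unfolding P m2_mult[of "ring_prod Z ds"] DE IH v3_def d dl ds y_def[symmetric] yl_def[symmetric] ys_def[symmetric] power_add M2 M4
      by (simp add: k ring_normal)
    have g4: "e22 (ring_prod Z (ds @ [d])) = - (k^2) * a ^ Suc b * Z ^ (2 * d) + Z ^ (4*m+2) * v4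
        + (c + k) ^ Suc (Suc (Suc b)) * Z ^ (2 * sum_list (ds @ [d]))"
      unfolding P m2_mult[of "ring_prod Z ds"] DE IH v4_def SL d dl ds
        y_def[symmetric] yl_def[symmetric] ys_def[symmetric] power_add M2 M4
      by (simp add: k ring_normal)
    show ?thesis using g1 g2 g3 g4 unfolding S' by (simp add: b)
  next
    case False
    with snoc.prems obtain d' where ds: "ds = [d']" by (cases ds; cases "tl ds") auto
    have d': "Z ^ (2*d') = Z ^ (2*m) * Z ^ (2*(d'-m))"
      using snoc.prems ds by (simp add: power_add[symmetric] algebra_simps)
    define M where "M = Z ^ m"
    have M2: "Z ^ (2*m) = M^2" and M4: "Z ^ (4*m) = M^4"
      by (simp_all add: M_def power_mult[symmetric] mult.commute)
    define y' where "y' = Z ^ (2*(d'-m))"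
    have R: "e11 (ring_prod Z ds) = a" "e12 (ring_prod Z ds) = - k * Z ^ (2*d')"
      "e21 (ring_prod Z ds) = k" "e22 (ring_prod Z ds) = (c + k) * Z ^ (2*d')"
      by (simp_all add: ds a_def k_def c_def)
    have SL': "Z ^ (2 * sum_list (ds @ [d])) = Z ^ (2 * d') * Z ^ (2 * d)"
      using SL by (simp add: ds)
    have g1: "e11 (ring_prod Z (ds @ [d])) = a ^ 2 - k^2 * Z ^ (2 * d') + Z ^ (4*m+2) * 0"
      unfolding P m2_mult[of "ring_prod Z ds"] DE R by (simp add: algebra_simps power2_eq_square)
    have g2: "e12 (ring_prod Z (ds @ [d])) = - k * a * Z ^ (2 * d) + Z ^ (4*m+1) * (- k1 * (c+k) * y * y')"
      unfolding P m2_mult[of "ring_prod Z ds"] DE R SL'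
       d d' y_def[symmetric] y'_def[symmetric] power_add M2 M4 by (simp add: k ring_normal)
    have g3: "e21 (ring_prod Z (ds @ [d])) = k * a + Z ^ (2*m+1) * ((c+k) * k1 * y')"
      unfolding P m2_mult[of "ring_prod Z ds"] DE R SL'
       d d' y_def[symmetric] y'_def[symmetric] power_add M2 M4 by (simp add: k ring_normal)
    have g4: "e22 (ring_prod Z (ds @ [d])) = - (k^2) * Z ^ (2 * d) + Z ^ (4*m+2) * 0
        + (c + k) ^ 2 * Z ^ (2 * sum_list (ds @ [d]))"
      unfolding P m2_mult[of "ring_prod Z ds"] DE R SL'
      by (simp add: k algebra_simps power2_eq_square)
    show ?thesis unfolding g1 g2 g3 g4
      by (rule exI[of _ 0], rule exI[of _ "- k1 * (c+k) * y * y'"], rule exI[of _ "(c+k) * k1 * y'"],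
          rule exI[of _ 0]) (simp add: ds power2_eq_square)
  qed
qed simp

lemma Z_nonzero [simp]: "Z \<noteq> 0" by (simp add: Z_def)

lemma coeff_Z_power: "coeff (Z ^ m) i = (if i = m then 1 else 0)"
  using coeff_Z_power_mult[of m 1 i] by (auto simp: coeff_1)

lemma coeff_sum_Z_power: "coeff (\<Sum>d\<leftarrow>ds. Z ^ (2 * d)) (2 * e) = of_nat (count_list ds e)"
  by (induction ds) (auto simp: coeff_Z_power)

text \<open>The distance missing from the sum in \<open>e11\<close> is supplied by
  \<open>e22\<close>. The path that stays in state 2 has order \<open>2 * sum_list ds\<close>; three
  distances of at least \<open>m\<close> make this at least \<open>6 * m\<close>, so it goes into
  the remainder.\<close>

lemma m2_tr_ring_prod_expansion:
  assumes "length ds \<ge> 3" "\<forall>d\<in>set ds. d \<ge> m" "m \<ge> 1"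
  shows "\<exists>w. m2_tr (ring_prod Z ds) = (rden Z - rnum Z) ^ length ds
    - rnum Z ^ 2 * (rden Z - rnum Z) ^ (length ds - 2) * (\<Sum>d\<leftarrow>ds. Z ^ (2 * d)) + Z ^ (4 * m + 2) * w"
proof -
  obtain w1 w2 w3 w4 where
     e1: "e11 (ring_prod Z ds) = (rden Z - rnum Z) ^ length ds
       - rnum Z^2 * (rden Z - rnum Z) ^ (length ds - 2) * (\<Sum>d\<leftarrow>butlast ds. Z ^ (2*d)) + Z ^ (4*m+2) * w1"
   and e4: "e22 (ring_prod Z ds) = - (rnum Z^2) * (rden Z - rnum Z) ^ (length ds - 2) * Z ^ (2 * last ds)
        + Z ^ (4*m+2) * w4 + (rden Z + rnum Z) ^ length ds * Z ^ (2 * sum_list ds)"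
    using ring_prod_expansion[of ds m] assms by auto
  have ne: "ds \<noteq> []" using assms by auto
  have "sum_list ds \<ge> m * length ds" using assms(2) by (induction ds) auto
  moreover have "m * length ds \<ge> m * 3" using assms(1) by (intro mult_left_mono) auto
  ultimately have "2 * sum_list ds \<ge> 4 * m + 2" using assms(3) by linarith
  then obtain r where r: "2 * sum_list ds = 4 * m + 2 + r" using le_Suc_ex by blast
  have r: "Z ^ (2 * sum_list ds) = Z ^ (4 * m + 2) * Z ^ r" unfolding r power_add ..
  show ?thesis unfolding m2_tr_def e1 e4 r
    by (rule exI[of _ "w1 + w4 + (rden Z + rnum Z) ^ length ds * Z ^ r"])
       (simp add: sum_list_map_butlast[OF ne] power_add algebra_simps)
qed

lemma poly_rden_rnum_0: "poly (rden Z) 0 = 1" "poly (rnum Z) 0 = 0"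
  by (simp_all add: rden_def rnum_def Z_def)

lemma Z_dvd_iff: "Z dvd p \<longleftrightarrow> poly p 0 = 0"
  by (simp add: Z_def poly_eq_0_iff_dvd)

lemma Z_power_dvd_cancel: "poly p 0 \<noteq> 0 \<Longrightarrow> Z ^ n dvd p * q \<Longrightarrow> Z ^ n dvd q"
proof (induction n arbitrary: q)
  case (Suc n)
  then have "Z dvd p * q" by (metis dvd_mult_left power_Suc)
  then obtain r where r: "q = Z * r"
    using Suc.prems by (metis Z_dvd_iff dvdE mult_eq_0_iff poly_mult)
  have "Z * Z ^ n dvd Z * (p * r)" using Suc.prems by (simp add: r algebra_simps)
  then have "Z ^ n dvd r" using Suc by (metis Z_nonzero dvd_times_left_cancel_iff)
  then show ?case by (simp add: r)
qed simp

text \<open>Equal lengths make the powers \<open>a ^ b\<close> cancel in the difference of the two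
  expansions. What remains is \<open>Sd - Se\<close> times \<open>Z ^ 2\<close> and factors with
  nonzero constant term, so \<open>Sd\<close> and \<open>Se\<close> agree modulo
  \<open>Z ^ (4 * m)\<close>. The count of \<open>d\<close> sits at exponent \<open>2 * d\<close>,
  whence the bound \<open>2 * m\<close>.\<close>

lemma count_list_ring_prod:
  assumes tr: "m2_tr (ring_prod Z ds) = m2_tr (ring_prod Z es)"
    and len: "length ds = length es" "length ds \<ge> 3"
    and ge: "\<forall>d\<in>set ds. d \<ge> m" "\<forall>d\<in>set es. d \<ge> m" "m \<ge> 1" and d: "d < 2 * m"
  shows "count_list ds d = count_list es d"
proof -
  define b where "b = length ds"
  define Sd where "Sd = (\<Sum>d\<leftarrow>ds. Z ^ (2 * d))"
  define Se where "Se = (\<Sum>d\<leftarrow>es. Z ^ (2 * d))"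
  define a where "a = rden Z - rnum Z"
  obtain v w where v: "m2_tr (ring_prod Z ds) = a ^ b - rnum Z ^ 2 * a ^ (b - 2) * Sd + Z ^ (4 * m + 2) * v"
    and w: "m2_tr (ring_prod Z es) = a ^ b - rnum Z ^ 2 * a ^ (b - 2) * Se + Z ^ (4 * m + 2) * w"
    using m2_tr_ring_prod_expansion[of ds m] m2_tr_ring_prod_expansion[of es m] len ge
    unfolding b_def Sd_def Se_def a_def by metis
  have rnum: "rnum Z ^ 2 = Z ^ 2 * (1 + Z) ^ 2"
    by (simp add: rnum_def power2_eq_square algebra_simps)
  have "Z ^ 2 * (Z ^ (4 * m) * (v - w)) = Z ^ 2 * ((1 + Z) ^ 2 * (a ^ (b - 2) * (Sd - Se)))"
    using v w tr unfolding rnum by (simp add: algebra_simps power_add power2_eq_square)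
  then have "Z ^ (4 * m) * (v - w) = (1 + Z) ^ 2 * (a ^ (b - 2) * (Sd - Se))" by simp
  then have "Z ^ (4 * m) dvd (1 + Z) ^ 2 * (a ^ (b - 2) * (Sd - Se))" by (metis dvd_triv_left)
  then have "Z ^ (4 * m) dvd a ^ (b - 2) * (Sd - Se)"
    by (rule Z_power_dvd_cancel[rotated]) (simp add: Z_def)
  then have "Z ^ (4 * m) dvd Sd - Se"
    by (rule Z_power_dvd_cancel[rotated]) (simp add: a_def poly_rden_rnum_0)
  then obtain q where q: "Sd - Se = Z ^ (4 * m) * q" by auto
  have "coeff (Sd - Se) (2 * d) = 0" unfolding q coeff_Z_power_mult using d by auto
  then have "coeff Sd (2 * d) = coeff Se (2 * d)" by simp
  then show ?thesis unfolding Sd_def Se_def coeff_sum_Z_power by simp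
qed

section \<open>Chains: vanishing orders, degrees and injectivity\<close>

abbreviation "c11 u \<equiv> e11 (chain Z u)"
abbreviation "c12 u \<equiv> e12 (chain Z u)"
abbreviation "c21 u \<equiv> e21 (chain Z u)"
abbreviation "c22 u \<equiv> e22 (chain Z u)"

text \<open>State 2 behind a distance of at least 2 costs \<open>Z ^ 4\<close>, so the lowest terms
  come from paths that stay in state 1 as long as possible. For \<open>c22\<close> this means two
  changes of state and order 2; only the empty chain, a single \<open>defect\<close>, has a nonzero
  constant term there. This jump is what detects an empty chain later.\<close>

lemma chain_low:
  assumes "\<forall>d\<in>set us. d \<ge> 2"
  shows "\<exists>p q r. c11 us = 1 + Z * p \<and> c12 us = - Z + Z^2 * q \<and> c21 us = Z + Z^2 * r
     \<and> (us \<noteq> [] \<longrightarrow> (\<exists>t. c22 us = - (Z^2) + Z^3 * t))" using assms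
proof (induction us)
  case Nil
  have "c11 [] = 1 + Z * (- 1 - Z - Z^2)" "c12 [] = - Z + Z^2 * (-1)"
     "c21 [] = Z + Z^2 * 1" by (simp_all add: chain_Nil rden_def rnum_def ring_normal)
  then show ?case by blast
next
  case (Cons d us)
  then obtain p q r where IH: "c11 us = 1 + Z * p" "c12 us = - Z + Z^2 * q"
     "c21 us = Z + Z^2 * r" by auto
  have "\<exists>s. c22 us = 1 + Z * s"
    if "us = []" using that by (intro exI[of _ "1 + Z - Z^2"])
      (simp add: chain_Nil rden_def rnum_def ring_normal)
  moreover have "\<exists>s. c22 us = Z * s" if ne: "us \<noteq> []"
  proof -
    obtain t where "c22 us = - (Z^2) + Z^3 * t" using Cons ne by auto
    then have "c22 us = Z * (- Z + Z^2 * t)" by (simp add: ring_normal)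
    then show ?thesis by blast
  qed
  ultimately obtain s where s: "c22 us = s" by auto
  obtain y where y: "Z ^ (2 * d) = Z ^ 4 * y"
    using Cons.prems by (metis le_imp_power_dvd dvdE list.set_intros(1) mult_2 add_mono numeral_Bit0)
  have y': "Z ^ (d * 2) = Z ^ 4 * y" using y by (simp add: mult.commute)
  have M: "chain Z (d # us) = defect Z * (shift Z d * chain Z us)" by (simp add: chain_Cons mult.assoc)
  have "c11 (d # us) = 1 + Z * (p - Z^2 * (1 + Z*p) - (1 + Z) * (1 + Z * p) - Z * Z^4 * (1 + Z) * y * (1 + Z * r))"
    unfolding M by (simp add: IH y y' rden_def rnum_def ring_normal)
  moreover have "c12 (d # us) = - Z + Z^2 * (q - (1 + Z + Z^2) * (-1 + Z * q) - Z^3 * (1+Z) * y * s)"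
    unfolding M by (simp add: IH s y y' rden_def rnum_def ring_normal)
  moreover have "c21 (d # us) = Z + Z^2 * (1 + p * (1 + Z) + Z^3 * y * (rden Z + rnum Z) * (1 + Z * r))"
    unfolding M by (simp add: IH y y' rden_def rnum_def ring_normal)
  moreover have "c22 (d # us) = - (Z^2) + Z^3 * (- 1 + q * (1 + Z) + Z * y * (rden Z + rnum Z) * s)"
    unfolding M by (simp add: IH s y y' rden_def rnum_def ring_normal)
  ultimately show ?case by blast
qed

lemma chain_coeffs:
  assumes "\<forall>d\<in>set us. d \<ge> 2"
  shows "coeff (c11 us) 0 = 1" "coeff (c12 us) 0 = 0" "coeff (c12 us) 1 = -1"
    "coeff (c21 us) 0 = 0" "coeff (c21 us) 1 = 1"
proof -
  obtain p q r where IH: "c11 us = 1 + Z * p" "c12 us = - Z + Z^2 * q"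
     "c21 us = Z + Z^2 * r" using chain_low[OF assms] by auto
  show "coeff (c11 us) 0 = 1" unfolding IH by (simp add: Z_def)
  show "coeff (c12 us) 0 = 0" "coeff (c12 us) 1 = -1"
    unfolding IH coeff_add coeff_Z_power_mult by (simp_all add: Z_def)
  show "coeff (c21 us) 0 = 0" "coeff (c21 us) 1 = 1"
    unfolding IH coeff_add coeff_Z_power_mult by (simp_all add: Z_def)
qed

lemma degree_defect: "degree (rden Z - rnum Z) \<le> 3" "degree (rnum Z) \<le> 3" "degree (rden Z + rnum Z) \<le> 3"
proof -
  have c: "degree (rden Z) \<le> 3" unfolding rden_def
    by (intro degree_diff_le) (auto simp: Z_def degree_power_eq)
  show k: "degree (rnum Z) \<le> 3" unfolding rnum_def
    by (intro degree_add_le) (auto simp: Z_def degree_power_eq)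
  show "degree (rden Z - rnum Z) \<le> 3" "degree (rden Z + rnum Z) \<le> 3"
    using c k by (auto intro: degree_diff_le degree_add_le)
qed

text \<open>A letter adds at most 3 through \<open>defect\<close> and 10 through
  \<open>shift\<close>, as \<open>d \<le> 5\<close>; the closing \<open>defect\<close> adds
  3.\<close>

lemma degree_chain:
  assumes "\<forall>d\<in>set us. d \<le> 5"
  shows "degree (c11 us) \<le> 13 * length us + 3 \<and> degree (c12 us) \<le> 13 * length us + 3 \<and>
    degree (c21 us) \<le> 13 * length us + 3 \<and> degree (c22 us) \<le> 13 * length us + 3"
  using assms
proof (induction us)
  case Nil
  then show ?case using degree_defect by (simp add: chain_Nil)
next
  case (Cons d us)
  let ?n = "13 * length us + 3"
  have IH: "degree (c11 us) \<le> ?n" "degree (c12 us) \<le> ?n"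
    "degree (c21 us) \<le> ?n" "degree (c22 us) \<le> ?n" using Cons by auto
  have d: "degree (Z ^ (2 * d)) \<le> 10" using Cons.prems by (simp add: Z_def degree_power_eq)
  have mul: "degree (p * q) \<le> i + j" if "degree p \<le> i" "degree q \<le> j" for p q :: "complex poly" and i j
    using degree_mult_le[of p q] that by linarith
  have M: "chain Z (d # us) = defect Z * (shift Z d * chain Z us)" by (simp add: chain_Cons mult.assoc)
  have b: "degree (u * x + v * (Z ^ (2 * d) * y)) \<le> 13 * length (d # us) + 3"
    if "degree u \<le> 3" "degree v \<le> 3" "degree x \<le> ?n" "degree y \<le> ?n" for u v x y
  proof (rule degree_add_le)
    show "degree (u * x) \<le> 13 * length (d # us) + 3" using mul[OF that(1,3)] by simp
    show "degree (v * (Z ^ (2 * d) * y)) \<le> 13 * length (d # us) + 3"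
      using mul[OF that(2) mul[OF d that(4)]] by simp
  qed
  have mk: "degree (- rnum Z) \<le> 3" using degree_defect by simp
  show ?case unfolding M m2_mult defect_sel shift_sel mult_1 mult_zero_left add_0_left add_0_right
    by (intro conjI b degree_defect mk IH)
qed

lemma chain_eq_Nil:
  assumes v: "\<forall>d\<in>set vs. d \<ge> 2" and eq: "chain Z [] = chain Z vs"
  shows "vs = []"
proof (rule ccontr)
  assume "vs \<noteq> []"
  then obtain t where t: "c22 vs = - (Z^2) + Z^3 * t" using chain_low[OF v] by auto
  have "poly (c22 []) 0 = 0" unfolding eq t by (simp add: Z_def)
  then show False by (simp add: chain_Nil poly_rden_rnum_0)
qed

text \<open>Once the first \<open>defect\<close> is cancelled, the lower left entry is
  \<open>Z ^ (2*d)\<close> times a \<open>c21\<close>, which has order exactly 1. Its order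
  therefore reveals the first letter, and induction does the rest.\<close>

lemma chain_inject:
  assumes "\<forall>d\<in>set us. d \<ge> 2" "\<forall>d\<in>set vs. d \<ge> 2" "chain Z us = chain Z vs"
  shows "us = vs"
  using assms
proof (induction us arbitrary: vs)
  case Nil
  then show ?case using chain_eq_Nil by blast
next
  case (Cons d us)
  then obtain e ws where vs: "vs = e # ws" using chain_eq_Nil[of "d # us"] by (cases vs) auto
  \<comment> \<open>The adjugate of \<open>defect Z\<close>: it replaces the inverse and leaves only
    the determinant \<open>rden Z ^ 2\<close> to cancel.\<close>
  define adj where "adj = M2 (rden Z + rnum Z) (rnum Z) (- rnum Z) (rden Z - rnum Z)"
  have adj: "adj * (defect Z * A) = M2 (rden Z^2 * e11 A) (rden Z^2 * e12 A) (rden Z^2 * e21 A) (rden Z^2 * e22 A)" for A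
    by (simp add: adj_def m2.expand algebra_simps power2_eq_square)
  have c0: "rden Z ^ 2 \<noteq> 0"
    using poly_rden_rnum_0(1) by (metis power_not_zero poly_0 zero_neq_one)
  have "adj * (defect Z * (shift Z d * chain Z us)) = adj * (defect Z * (shift Z e * chain Z ws))"
    using Cons.prems(3) by (simp add: vs chain_Cons mult.assoc)
  then have eq: "shift Z d * chain Z us = shift Z e * chain Z ws"
    unfolding adj using c0 by (simp add: m2.expand)
  have E: "c11 us = c11 ws" "c12 us = c12 ws"
    "Z^(2*d) * c21 us = Z^(2*e) * c21 ws"
    "Z^(2*d) * c22 us = Z^(2*e) * c22 ws"
    using arg_cong[OF eq, of e11] arg_cong[OF eq, of e12] arg_cong[OF eq, of e21]
      arg_cong[OF eq, of e22] by simp_all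
  note cu = chain_coeffs[of us] and cw = chain_coeffs[of ws]
  have "coeff (Z^(2*d) * c21 us) (2*d+1) = coeff (Z^(2*e) * c21 ws) (2*d+1)"
    "coeff (Z^(2*d) * c21 us) (2*e+1) = coeff (Z^(2*e) * c21 ws) (2*e+1)" using E(3) by simp_all
  then have "e = d" using cu cw Cons.prems(1,2) unfolding vs by (cases e d rule: linorder_cases)
       (auto simp: coeff_Z_power_mult split: if_splits)
  then have "chain Z us = chain Z ws" using E by (simp add: m2.expand)
  then have "us = ws" using Cons.IH[of ws] Cons.prems(1,2) by (simp add: vs)
  then show ?case by (simp add: vs \<open>e = d\<close>)
qed

section \<open>Splitting the trace at two long gaps\<close>

lemma Z_block_unique:
  assumes "p + Z ^ n * q = p' + Z ^ n * q'" "degree p < n" "degree p' < n"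
  shows "p = p' \<and> q = q'"
proof
  show pp: "p = p'"
  proof (rule poly_eqI)
    fix i
    have "coeff (p + Z ^ n * q) i = coeff (p' + Z ^ n * q') i" using assms by simp
    then show "coeff p i = coeff p' i"
      using assms(2,3) by (cases "i < n") (auto simp: coeff_Z_power_mult coeff_eq_0)
  qed
  show "q = q'" using assms(1) by (simp add: pp)
qed

text \<open>By cyclicity the leading \<open>defect\<close> closes the chain of \<open>v\<close>. The
  four terms belong to the states 1 or 2 in the two gaps, a gap in state 2 contributing its power of
  \<open>Z\<close>.\<close>

lemma m2_tr_two_gaps:
  "m2_tr (ring_prod Z (e # u @ e' # v)) =
    c11 u * c11 v + Z ^ (2 * e') * (c12 u * c21 v)
    + Z ^ (2 * e) * (c21 u * c12 v)
    + Z ^ (2 * (e + e')) * (c22 u * c22 v)"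
proof -
  have "ring_prod Z (e # u @ e' # v) = defect Z * (shift Z e * chain Z u * shift Z e' * ring_prod Z v)"
    by (simp add: ring_prod_append chain_def mult.assoc)
  then have "m2_tr (ring_prod Z (e # u @ e' # v))
      = m2_tr (shift Z e * chain Z u * shift Z e' * chain Z v)"
    by (simp add: m2_tr_commute[of "defect Z"] chain_def mult.assoc)
  then show ?thesis by (simp add: m2_tr_def power_add algebra_simps)
qed

lemma length_sum_filter_45:
  fixes xs :: "nat list"
  shows "length xs = count_list xs 4 + count_list xs 5 + length (filter (\<lambda>d. d \<notin> {4, 5}) xs)"
    "sum_list xs = 4 * count_list xs 4 + 5 * count_list xs 5 + sum_list (filter (\<lambda>d. d \<notin> {4, 5}) xs)"
  by (induction xs) auto

text \<open>The rotation starts at the longer of the two exceptional distances; this gives the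
  normalisation \<open>e' \<le> e\<close> used by \<open>second_gap_unique\<close>.\<close>

lemma rotate_two_gaps:
  fixes ds :: "nat list"
  assumes "length (filter (\<lambda>d. d \<notin> {4, 5}) ds) = 2"
  obtains i e e' u v where "rotate i ds = e # u @ e' # v" "e' \<le> e" "set u \<union> set v \<subseteq> {4, 5}"
    "e \<notin> {4, 5}" "e' \<notin> {4, 5}"
proof -
  let ?P = "\<lambda>d. d \<notin> {4, 5::nat}"
  obtain e e' where f: "filter ?P ds = [e, e']"
    using assms by (cases "filter ?P ds"; cases "tl (filter ?P ds)") auto
  then obtain xs r where r: "ds = xs @ e # r" "\<forall>x\<in>set xs. \<not> ?P x" "filter ?P r = [e']"
    by (auto dest!: filter_eq_ConsD)
  then obtain ys zs where y: "r = ys @ e' # zs" "\<forall>x\<in>set ys. \<not> ?P x" "filter ?P zs = []"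
    by (auto dest!: filter_eq_ConsD)
  have z: "\<forall>x\<in>set zs. \<not> ?P x" using y(3) by (simp add: filter_empty_conv)
  have ee: "?P e" "?P e'" using arg_cong[OF f, of set] by auto
  show thesis
  proof (cases "e' \<le> e")
    case True
    have "rotate (length xs) ds = e # ys @ e' # (zs @ xs)" by (simp add: r y rotate_append)
    with True show thesis using r y z ee by (intro that[of "length xs" e ys e' "zs @ xs"]) auto
  next
    case False
    have "ds = (xs @ e # ys) @ (e' # zs)" by (simp add: r y)
    then have "rotate (length (xs @ e # ys)) ds = e' # (zs @ xs) @ e # ys"
      by (simp only: rotate_append) simp
    with False show thesis using r y z ee
      by (intro that[of "length (xs @ e # ys)" e' "zs @ xs" e ys]) auto
  qed
qed

lemma poly_Z: "poly Z x = x" by (simp add: Z_def)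

lemma mset_rotate: "mset (rotate n xs) = mset xs"
  by (metis append_take_drop_id rotate_drop_take mset_append add.commute)

text \<open>Compare orders of vanishing. If \<open>u\<close> were nonempty, \<open>c22 u\<close>
  would have order 2 and the left side order \<open>2 * sum_list v + 2\<close>. The right side has
  order \<open>2 * sum_list w\<close>, which is larger because \<open>sum_list u\<close> is at least
  2.\<close>

lemma single_chain:
  assumes eq: "m2_det (chain Z v) * (c11 u * c22 u)
      = m2_det (chain Z w) * (c11 [] * c22 [])"
    and u: "\<forall>d\<in>set u. d \<ge> 2" and s: "sum_list u + sum_list v = sum_list w"
  shows "u = []"
proof (rule ccontr)
  assume ne: "u \<noteq> []"
  obtain p t where p: "c11 u = 1 + Z * p" and t: "c22 u = - (Z^2) + Z^3 * t"
    using chain_low[OF u] ne by auto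
  have "sum_list u \<ge> 2" using ne u by (cases u) auto
  then obtain r where r: "sum_list u = 2 + r" using le_Suc_ex by blast
  have sw: "Z ^ (2 * sum_list w) = Z ^ (2 * sum_list v) * (Z ^ 2 * (Z * (Z * Z ^ (2 * r))))"
  proof -
    have e: "2 * sum_list w = 2 * sum_list v + (2 + (1 + (1 + 2 * r)))" using s r by simp
    show ?thesis by (simp only: e power_add power_one_right)
  qed
  have "Z ^ (2 * sum_list v) * (Z ^ 2 * (rden Z ^ (2 * length v + 2) * ((1 + Z * p) * (- 1 + Z * t))))
    = Z ^ (2 * sum_list v) * (Z ^ 2 * (Z * (Z * Z ^ (2 * r) * rden Z ^ (2 * length w + 2)
        * (c11 [] * c22 []))))" using eq unfolding m2_det_chain p t sw by (simp add: ring_normal)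
  then have "rden Z ^ (2 * length v + 2) * ((1 + Z * p) * (- 1 + Z * t))
      = Z * (Z * Z ^ (2 * r) * rden Z ^ (2 * length w + 2) * (c11 [] * c22 []))" by simp
  from arg_cong[OF this, of "\<lambda>p. poly p 0"] show False
    by (simp add: poly_rden_rnum_0 poly_Z)
qed

text \<open>The two closing factors \<open>defect\<close> add 3 each to the 13 per letter, so 7 is
  the first strict bound. The product of the two \<open>c22\<close> is absent because it fills the
  last block, with nothing above it.\<close>

lemma chain_degree_bounds:
  assumes "set u \<union> set v \<subseteq> {4, 5}" "13 * (length u + length v) + 7 = K"
  shows "degree (c11 u * c11 v) < K"
    "degree (c12 u * c21 v) < K"
    "degree (c21 u * c12 v) < K"
proof -
  have mul: "degree (p * q) < K"
    if "degree p \<le> 13 * length u + 3" "degree q \<le> 13 * length v + 3" for p q :: "complex poly"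
  proof -
    have "degree (p * q) \<le> (13 * length u + 3) + (13 * length v + 3)"
      using degree_mult_le[of p q] that by (meson add_mono le_trans)
    also have "\<dots> < K" using assms(2) by simp
    finally show ?thesis .
  qed
  have "\<forall>d\<in>set u. d \<le> 5" "\<forall>d\<in>set v. d \<le> 5" using assms(1) by auto
  then show "degree (c11 u * c11 v) < K"
    "degree (c12 u * c21 v) < K"
    "degree (c21 u * c12 v) < K" using degree_chain by (auto intro!: mul)
qed

text \<open>Both middle blocks open with \<open>- (Z^2)\<close>; this nonzero term makes their
  positions visible in the trace.\<close>

lemma chain_cross_coeffs:
  assumes "\<forall>d\<in>set u. d \<ge> 2" "\<forall>d\<in>set v. d \<ge> 2"
  shows "coeff (c12 u * c21 v) 0 = 0" "coeff (c12 u * c21 v) (Suc 0) = 0"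
    "coeff (c12 u * c21 v) 2 = -1"
    "coeff (c21 u * c12 v) 0 = 0" "coeff (c21 u * c12 v) (Suc 0) = 0"
    "coeff (c21 u * c12 v) 2 = -1" using chain_coeffs[OF assms(1)] chain_coeffs[OF assms(2)]
  by (simp_all add: coeff_mult numeral_2_eq_2)

text \<open>With \<open>K = 13 * length w + 7\<close>, every block of \<open>m2_tr_two_gaps\<close>
  but the last has degree below \<open>K\<close>. For the gaps \<open>L1\<close> and
  \<open>L2\<close> the blocks start at 0, \<open>2 * L2\<close>, \<open>2 * L1\<close> and
  \<open>2 * (L1 + L2)\<close>, and the two inequalities keep consecutive starts at least
  \<open>K\<close> apart.\<close>

definition separated :: "nat \<Rightarrow> nat \<Rightarrow> nat list \<Rightarrow> bool" where
  "separated L1 L2 w \<longleftrightarrow> set w \<subseteq> {4, 5} \<and> w \<noteq> [] \<and> L2 \<ge> 13 * length w + 7 \<and> L1 \<ge> L2 + 13 * length w + 7"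

text \<open>The block at \<open>2 * e'\<close> opens with coefficient -1 at exponent
  \<open>2 * e' + 2\<close>, the one at \<open>2 * L2\<close> likewise. If \<open>e'\<close>
  differed from \<open>L2\<close>, one side would show this coefficient at an exponent where the
  other side vanishes.\<close>

lemma second_gap_unique:
  assumes G: "separated L1 L2 w" and uv: "set u \<union> set v \<subseteq> {4, 5}" "length u + length v = length w"
    and e: "e' \<le> e" "e + e' = L1 + L2"
    and tr: "m2_tr (ring_prod Z (e # u @ e' # v)) = m2_tr (ring_prod Z (L1 # [] @ L2 # w))"
  shows "e' = L2"
proof -
  define K where "K = 13 * length w + 7"
  have L: "L2 \<ge> K" "L1 \<ge> L2 + K" and w: "set w \<subseteq> {4, 5}" using G by (auto simp: separated_def K_def)
  have K: "K > 2" by (simp add: K_def)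
  have u2: "\<forall>d\<in>set u. d \<ge> 2" "\<forall>d\<in>set v. d \<ge> 2" "\<forall>d\<in>set w. d \<ge> 2" "\<forall>d\<in>set []. d \<ge> (2::nat)"
    using uv w by auto
  note cF = chain_cross_coeffs[OF u2(1,2)] and cG = chain_cross_coeffs[OF u2(4,3)]
  have dF: "coeff (c11 u * c11 v) j = 0"
    "coeff (c12 u * c21 v) j = 0" if "j \<ge> K" for j
    using chain_degree_bounds[of u v K] uv that by (auto simp: K_def intro!: coeff_eq_0)
  have dG: "coeff (c11 [] * c11 w) j = 0" if "j \<ge> K" for j
    using chain_degree_bounds[of "[]" w K] w that by (auto simp: K_def intro!: coeff_eq_0)
  have eq: "coeff (m2_tr (ring_prod Z (e # u @ e' # v))) j = coeff (m2_tr (ring_prod Z (L1 # [] @ L2 # w))) j" for j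
    using tr by simp
  note eq = eq[unfolded m2_tr_two_gaps coeff_add coeff_Z_power_mult]
  consider "e' = L2" | "e' > L2" | "e' < L2" "2 * e' + 2 \<ge> K" | "e' < L2" "2 * e' + 2 < K" by linarith
  then show ?thesis
  proof cases
    case 2
    \<comment> \<open>By truncated subtraction both middle blocks on the left are read at index 0 or
      not at all, and their constant terms vanish.\<close>
    then have "2 * L2 + 2 - 2 * e' = 0" "2 * L2 + 2 - 2 * e = 0" using e by auto
    then show ?thesis
      using eq[of "2 * L2 + 2"] 2 L e K dF(1)[of "2 * L2 + 2"] dG[of "2 * L2 + 2"] cF cG
      by (auto split: if_splits)
  next
    case 3
    then have "2 * e' + 2 - 2 * L2 = 0" by auto
    then show ?thesis
      using eq[of "2 * e' + 2"] 3 L e K dF(1)[of "2 * e' + 2"] dG[of "2 * e' + 2"] cF cG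
      by (auto split: if_splits)
  next
    \<comment> \<open>Now \<open>2 * e' + 2\<close> lies in the range of the first blocks, whose
      coefficients are unknown. The comparison moves to \<open>2 * L2 + 2\<close>, where the block
      at \<open>2 * e'\<close> has already ended.\<close>
    case 4
    then have "2 * L2 + 2 - 2 * e' \<ge> K" using L by linarith
    then show ?thesis
      using eq[of "2 * L2 + 2"] 4 L e K dF(1)[of "2 * L2 + 2"] dF(2)[of "2 * L2 + 2 - 2 * e'"] dG[of "2 * L2 + 2"] cF cG
      by (auto split: if_splits)
  qed
qed

text \<open>
  Comparing the four separated blocks of the trace yields the sum and the product of the polynomials
  \<open>q * X\<close> and \<open>p * Y\<close> below, so these are the roots of the corresponding quadratic for \<open>[]\<close> and \<open>w\<close>. In
  either case the order of vanishing at 0 shows that one of \<open>u\<close> and \<open>v\<close> is empty.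
\<close>

lemma chains_unique:
  assumes G: "separated L1 L2 w" and uv: "set u \<union> set v \<subseteq> {4, 5}" "length u + length v = length w"
    and s: "sum_list u + sum_list v = sum_list w"
    and tr: "m2_tr (ring_prod Z (L1 # u @ L2 # v)) = m2_tr (ring_prod Z (L1 # [] @ L2 # w))"
  shows "u = [] \<and> v = w \<or> v = [] \<and> u = rev w"
proof -
  define K where "K = 13 * length w + 7"
  have L: "L2 \<ge> K" "L1 \<ge> L2 + K" and w: "set w \<subseteq> {4, 5}" using G by (auto simp: separated_def K_def)
  have u2: "\<forall>d\<in>set u. d \<ge> 2" "\<forall>d\<in>set v. d \<ge> 2" "\<forall>d\<in>set w. d \<ge> 2"
    using uv w by auto
  let ?U = "chain Z u" and ?V = "chain Z v" and ?D = "chain Z []" and ?W = "chain Z w"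
  note dF = chain_degree_bounds[of u v K] and dG = chain_degree_bounds[of "[]" w K]
  define r where "r = 2 * (L1 - L2)"
  have r: "2 * L1 = 2 * L2 + r" "2 * (L1 + L2) = 2 * L2 + r + 2 * L2" "r \<ge> K"
    using L by (auto simp: r_def)
  have "e11 ?U * e11 ?V + Z ^ (2 * L2) * (e12 ?U * e21 ?V + Z ^ r * (e21 ?U * e12 ?V + Z ^ (2 * L2) * (e22 ?U * e22 ?V)))
    = e11 ?D * e11 ?W + Z ^ (2 * L2) * (e12 ?D * e21 ?W + Z ^ r * (e21 ?D * e12 ?W + Z ^ (2 * L2) * (e22 ?D * e22 ?W)))"
    using tr unfolding m2_tr_two_gaps r power_add by (simp add: algebra_simps)
  from Z_block_unique[OF this] dF dG uv w L
  have b0: "e11 ?U * e11 ?V = e11 ?D * e11 ?W"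
    and "e12 ?U * e21 ?V + Z ^ r * (e21 ?U * e12 ?V + Z ^ (2 * L2) * (e22 ?U * e22 ?V))
      = e12 ?D * e21 ?W + Z ^ r * (e21 ?D * e12 ?W + Z ^ (2 * L2) * (e22 ?D * e22 ?W))"
    by (auto simp: K_def)
  from Z_block_unique[OF this(2)] dF dG uv w r
  have b1: "e12 ?U * e21 ?V = e12 ?D * e21 ?W"
    and "e21 ?U * e12 ?V + Z ^ (2 * L2) * (e22 ?U * e22 ?V) = e21 ?D * e12 ?W + Z ^ (2 * L2) * (e22 ?D * e22 ?W)"
    by (auto simp: K_def)
  from Z_block_unique[OF this(2)] dF dG uv w L
  have b2: "e21 ?U * e12 ?V = e21 ?D * e12 ?W" and b3: "e22 ?U * e22 ?V = e22 ?D * e22 ?W"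
    by (auto simp: K_def)
  define X where "X = e11 ?U * e22 ?U" define Y where "Y = e11 ?V * e22 ?V"
  define X' where "X' = e11 ?D * e22 ?D" define Y' where "Y' = e11 ?W * e22 ?W"
  define p where "p = m2_det ?U" define q where "q = m2_det ?V"
  define p' where "p' = m2_det ?D" define q' where "q' = m2_det ?W"
  have "X * Y = (e11 ?U * e11 ?V) * (e22 ?U * e22 ?V)" by (simp add: X_def Y_def ac_simps)
  also have "\<dots> = X' * Y'" unfolding b0 b3 by (simp add: X'_def Y'_def ac_simps)
  finally have XY: "X * Y = X' * Y'" .
  have x1: "2 * sum_list w = 2 * sum_list u + 2 * sum_list v"
    and x2: "2 * length w + 2 = 2 * length u + 2 + 2 * length v"
    using uv(2) s by auto
  have pq: "p * q = p' * q'"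
    unfolding p_def q_def p'_def q'_def m2_det_chain x1 x2 power_add by (simp add: ac_simps)
  \<comment> \<open>\<open>X - p\<close> and \<open>Y - q\<close> are the products of the
    off-diagonal entries of the two chains, so the two middle blocks supply this second
    relation.\<close>
  have "(X - p) * (Y - q) = (e12 ?U * e21 ?V) * (e21 ?U * e12 ?V)"
    by (simp add: X_def Y_def p_def q_def m2_det_def)
  also have "\<dots> = (X' - p') * (Y' - q')"
    unfolding b1 b2 by (simp add: X'_def Y'_def p'_def q'_def m2_det_def)
  finally have XpYq: "(X - p) * (Y - q) = (X' - p') * (Y' - q')" .
  have sum: "q * X + p * Y = q' * X' + p' * Y'"
  proof -
    have "q * X + p * Y = X * Y + p * q - (X - p) * (Y - q)" by (simp add: algebra_simps)
    also have "\<dots> = X' * Y' + p' * q' - (X' - p') * (Y' - q')" unfolding XY pq XpYq ..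
    also have "\<dots> = q' * X' + p' * Y'" by (simp add: algebra_simps)
    finally show ?thesis .
  qed
  have prod: "(q * X) * (p * Y) = (q' * X') * (p' * Y')"
  proof -
    have "(q * X) * (p * Y) = (p * q) * (X * Y)" by (simp add: ac_simps)
    also have "\<dots> = (q' * X') * (p' * Y')" unfolding pq XY by (simp add: ac_simps)
    finally show ?thesis .
  qed
  have "(q * X - q' * X') * (q * X - p' * Y') = (q * X) * (q * X) - (q * X) * (q' * X' + p' * Y') + (q' * X') * (p' * Y')"
    by (simp add: algebra_simps)
  also have "\<dots> = 0" unfolding sum[symmetric] prod[symmetric] by (simp add: algebra_simps)
  finally have "q * X = q' * X' \<or> q * X = p' * Y'" by simp
  then consider "q * X = q' * X'" | "p * Y = q' * X'"
    using sum by (metis add.commute add_left_cancel)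
  moreover have nz: "rden Z - rnum Z \<noteq> 0" "rden Z + rnum Z \<noteq> 0" "rnum Z \<noteq> 0"
  proof -
    show "rden Z - rnum Z \<noteq> 0" "rden Z + rnum Z \<noteq> 0"
      using poly_rden_rnum_0 by (metis add_0_right diff_0_right poly_0 poly_add poly_diff zero_neq_one)+
    have "poly (rnum Z) 1 = 2" by (simp add: rnum_def Z_def)
    then show "rnum Z \<noteq> 0" by auto
  qed
  ultimately show ?thesis
  proof cases
    case 1
    then have u: "u = []"
      using single_chain[of v u w] u2(1) s by (simp add: q_def X_def q'_def X'_def)
    have "e11 ?V = e11 ?W" "e12 ?V = e12 ?W" "e21 ?V = e21 ?W" "e22 ?V = e22 ?W"
      using b0 b1 b2 b3 nz unfolding u by (auto simp: chain_Nil)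
    then have "?V = ?W" by (simp add: m2.expand)
    then show ?thesis using chain_inject u2 u by blast
  next
    case 2
    then have v: "v = []"
      using single_chain[of u v w] u2(2) s by (simp add: p_def Y_def q'_def X'_def add.commute)
    \<comment> \<open>With \<open>v\<close> empty, cancelling the entries of \<open>defect\<close>
      leaves those of \<open>m2_rev (chain Z w)\<close>, hence the reversed word.\<close>
    have "e11 ?U = e11 ?W" "e12 ?U = - e21 ?W" "e21 ?U = - e12 ?W" "e22 ?U = e22 ?W"
    proof -
      show "e11 ?U = e11 ?W" "e22 ?U = e22 ?W" using b0 b3 nz unfolding v by (auto simp: chain_Nil)
      have "rnum Z * e12 ?U = e12 ?U * e21 ?V" by (simp add: v chain_Nil mult.commute)
      also have "\<dots> = rnum Z * (- e21 ?W)" unfolding b1 by (simp add: chain_Nil)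
      finally have c1: "rnum Z * e12 ?U = rnum Z * (- e21 ?W)" .
      have "rnum Z * e21 ?U = - (e21 ?U * e12 ?V)" by (simp add: v chain_Nil mult.commute)
      also have "\<dots> = rnum Z * (- e12 ?W)" unfolding b2 by (simp add: chain_Nil)
      finally have c2: "rnum Z * e21 ?U = rnum Z * (- e12 ?W)" .
      show "e12 ?U = - e21 ?W" "e21 ?U = - e12 ?W" using c1 c2 nz(3) mult_left_cancel by blast+
    qed
    then have "?U = chain Z (rev w)"
      unfolding m2_rev_chain[symmetric] by (simp add: m2.expand m2_rev_def)
    moreover have "\<forall>d\<in>set (rev w). d \<ge> 2" using u2 by auto
    ultimately show ?thesis using chain_inject u2 v by blast
  qed
qed

theorem ring_prod_determines_word:
  assumes G: "separated L1 L2 w"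
    and ds: "length ds = length w + 2" "\<forall>d\<in>set ds. d \<ge> 1" "sum_list ds = L1 + L2 + sum_list w"
    and tr: "m2_tr (ring_prod Z ds) = m2_tr (ring_prod Z (L1 # L2 # w))"
  obtains i where "rotate i ds = L1 # L2 # w" | i where "rotate i ds = L1 # rev w @ [L2]"
proof -
  let ?es = "L1 # L2 # w"
  have w: "set w \<subseteq> {4, 5}" and L: "L1 > 5" "L2 > 5" and wn: "length w \<ge> 1"
    using G by (auto simp: separated_def Suc_le_eq)
  have es: "\<forall>d\<in>set ?es. d \<ge> 4" using w L by auto
  have len: "length ds = length ?es" "length ds \<ge> 3" using ds(1) wn by auto
  note cnt = count_list_ring_prod[OF tr len]
  have nin: "count_list ?es d = 0" if "d < 4" for d
    using es that by (auto simp: count_list_0_iff simp del: count_list.simps)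
  have es': "\<forall>d\<in>set ?es. d \<ge> m" if "m \<le> 4" for m using es that by (meson le_trans)
  \<comment> \<open>Counts below \<open>2 * m\<close> are readable once all distances are at least
    \<open>m\<close>. So \<open>m\<close> is raised from 1 to 2 to 4, each time because the smaller
    distances turn out not to occur; at 4 the counts of 4 and 5 become available.\<close>
  have "count_list ds 1 = 0" using cnt[OF ds(2) es', of 1] nin[of 1] by simp
  then have "\<forall>d\<in>set ds. d \<ge> 2"
    using ds(2) by (auto simp: count_list_0_iff) (metis One_nat_def Suc_leI le_neq_implies_less numeral_2_eq_2)
  moreover from this have "count_list ds 2 = 0" "count_list ds 3 = 0"
    using cnt[OF _ es', of 2 2] cnt[OF _ es', of 2 3] nin[of 2] nin[of 3] by simp_all
  ultimately have ge4: "\<forall>d\<in>set ds. d \<ge> 4" unfolding count_list_0_iff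
    by (auto simp: numeral_eq_Suc) (metis Suc_leI le_neq_implies_less)
  have c45: "count_list ds 4 = count_list ?es 4" "count_list ds 5 = count_list ?es 5"
    using cnt[OF ge4 es', of 4] cnt[OF ge4 es', of 5] by simp_all
  let ?f = "filter (\<lambda>d. d \<notin> {4, 5::nat})"
  have fw: "?f w = []" using w by (auto simp: filter_empty_conv)
  have "length (?f ds) = 2"
    using length_sum_filter_45(1)[of ds] length_sum_filter_45(1)[of ?es] c45 len L fw by auto
  then obtain i e e' u v where r: "rotate i ds = e # u @ e' # v" "e' \<le> e" "set u \<union> set v \<subseteq> {4, 5}"
     "e \<notin> {4, 5}" "e' \<notin> {4, 5}" by (rule rotate_two_gaps)
  have lenr: "length u + length v = length w" using arg_cong[OF r(1), of length] ds(1) by simp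
  have mr: "mset (e # u @ e' # v) = mset ds" using r(1) by (metis mset_rotate)
  have sumr: "sum_list (e # u @ e' # v) = sum_list ds" using mr by (metis sum_mset_sum_list)
  have cr: "count_list (e # u @ e' # v) d = count_list ds d" for d using mr by (metis count_mset)
  have f: "?f u = []" "?f v = []" using r(3) by (auto simp: filter_empty_conv)
  have cu: "count_list u 4 + count_list v 4 = count_list w 4" "count_list u 5 + count_list v 5 = count_list w 5"
    using cr[of 4] cr[of 5] c45 r(4,5) L by auto
  have s: "sum_list u + sum_list v = sum_list w"
    unfolding length_sum_filter_45(2)[of u] length_sum_filter_45(2)[of v] length_sum_filter_45(2)[of w] f fw
    using cu by simp
  have e: "e + e' = L1 + L2" using sumr ds(3) s by simp
  have trr: "m2_tr (ring_prod Z (e # u @ e' # v)) = m2_tr (ring_prod Z (L1 # [] @ L2 # w))"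
    using tr m2_tr_ring_prod_rotate[of Z i ds] r(1) by simp
  have e': "e' = L2" by (rule second_gap_unique[OF G r(3) lenr r(2) e trr])
  then have "e = L1" using e by simp
  then have "u = [] \<and> v = w \<or> v = [] \<and> u = rev w"
    using chains_unique[OF G r(3) lenr s] trr e' by simp
  then show thesis using r(1) that e' \<open>e = L1\<close> by auto
qed

section \<open>Determinants\<close>

lemma det_relabel:
  fixes A :: "nat \<Rightarrow> nat \<Rightarrow> 'a::comm_ring_1"
  assumes f: "bij_betw f {..<n} {..<n}"
  shows "det (mat n n (\<lambda>(i, j). A (f i) (f j))) = det (mat n n (\<lambda>(i, j). A i j))"
proof -
  define p where "p = (\<lambda>i. if i < n then f i else i)"
  have "bij_betw p {0..<n} {0..<n}"
    using f bij_betw_cong[of "{..<n}" p f "{..<n}"] by (simp add: p_def atLeast0LessThan)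
  then have p: "p permutes {0..<n}" by (rule bij_imp_permutes) (auto simp: p_def)
  have pn: "p i < n" if "i < n" for i using permutes_in_image[OF p, of i] that by simp
  have fn: "f i < n" if "i < n" for i using bij_betwE[OF f] that by auto
  have pf: "p i = f i" if "i < n" for i using that by (simp add: p_def)
  let ?A = "mat n n (\<lambda>(i, j). A i j)"
  define B where "B = mat n n (\<lambda>(i, j). ?A $$ (p i, j))"
  have B: "B \<in> carrier_mat n n" "B\<^sup>T \<in> carrier_mat n n" by (auto simp: B_def)
  have d1: "det B = signof p * det ?A" unfolding B_def by (rule det_permute_rows[OF _ p]) auto
  have d2: "det (mat n n (\<lambda>(i, j). B\<^sup>T $$ (p i, j))) = signof p * det (B\<^sup>T)"
    by (rule det_permute_rows[OF B(2) p])
  have "mat n n (\<lambda>(i, j). A (f i) (f j)) = (mat n n (\<lambda>(i, j). B\<^sup>T $$ (p i, j)))\<^sup>T"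
    by (rule eq_matI) (auto simp: B_def fn pf)
  then have "det (mat n n (\<lambda>(i, j). A (f i) (f j))) = det (mat n n (\<lambda>(i, j). B\<^sup>T $$ (p i, j)))"
    by (metis det_transpose mat_carrier)
  also have "\<dots> = signof p * signof p * det ?A" unfolding d2 det_transpose[OF B(1)] d1 by simp
  also have "signof p * signof p = (1 :: 'a)" by (simp add: sign_def)
  finally show ?thesis by simp
qed

text \<open>The Schur complement with respect to the scalar corner: a unipotent column operation
  clears \<open>C\<close>.\<close>

lemma det_scalar_corner:
  fixes A :: "complex mat"
  assumes A: "A \<in> carrier_mat n n" and B: "B \<in> carrier_mat n m" and C: "C \<in> carrier_mat m n"
    and d: "d \<noteq> 0"
  shows "det (four_block_mat A B C (d \<cdot>\<^sub>m 1\<^sub>m m)) = d ^ m * det (A - (1 / d) \<cdot>\<^sub>m (B * C))"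
proof -
  let ?M = "four_block_mat A B C (d \<cdot>\<^sub>m 1\<^sub>m m)"
  let ?N = "four_block_mat (1\<^sub>m n) (0\<^sub>m n m) (- (1 / d) \<cdot>\<^sub>m C) (1\<^sub>m m)"
  have N: "det ?N = 1" using C by (subst det_four_block_mat_upper_right_zero[of _ n _ m]) auto
  have "?M * ?N = four_block_mat (A * 1\<^sub>m n + B * (- (1 / d) \<cdot>\<^sub>m C)) (A * 0\<^sub>m n m + B * 1\<^sub>m m)
      (C * 1\<^sub>m n + d \<cdot>\<^sub>m 1\<^sub>m m * (- (1 / d) \<cdot>\<^sub>m C)) (C * 0\<^sub>m n m + d \<cdot>\<^sub>m 1\<^sub>m m * 1\<^sub>m m)"
    using A B C by (intro mult_four_block_mat) auto
  also have "A * 1\<^sub>m n + B * (- (1 / d) \<cdot>\<^sub>m C) = A - (1 / d) \<cdot>\<^sub>m (B * C)"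
    using A B C by (subst mult_smult_distrib[of B n m C n]) (auto intro!: eq_matI)
  also have "A * 0\<^sub>m n m + B * 1\<^sub>m m = B" using A B by auto
  also have "C * 1\<^sub>m n + d \<cdot>\<^sub>m 1\<^sub>m m * (- (1 / d) \<cdot>\<^sub>m C) = 0\<^sub>m m n"
    using C d by (subst mult_smult_assoc_mat[of "1\<^sub>m m" m m _ n]) (auto intro!: eq_matI)
  also have "C * 0\<^sub>m n m + d \<cdot>\<^sub>m 1\<^sub>m m * 1\<^sub>m m = d \<cdot>\<^sub>m 1\<^sub>m m" using C by auto
  finally have MN: "?M * ?N = four_block_mat (A - (1 / d) \<cdot>\<^sub>m (B * C)) B (0\<^sub>m m n) (d \<cdot>\<^sub>m 1\<^sub>m m)" .
  have AB: "A - (1 / d) \<cdot>\<^sub>m (B * C) \<in> carrier_mat n n" using A B C by auto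
  have "det ?M = det (?M * ?N)" using A B C N by (subst det_mult[of _ "n + m"]) auto
  also have "\<dots> = det (A - (1 / d) \<cdot>\<^sub>m (B * C)) * det (d \<cdot>\<^sub>m 1\<^sub>m m :: complex mat)"
    unfolding MN by (rule det_four_block_mat_lower_left_zero[OF AB B refl]) auto
  also have "det (d \<cdot>\<^sub>m 1\<^sub>m m :: complex mat) = d ^ m" by simp
  finally show ?thesis by simp
qed

lemma det_2x2:
  fixes A :: "'a::idom mat"
  assumes "A \<in> carrier_mat 2 2"
  shows "det A = A $$ (0,0) * A $$ (1,1) - A $$ (0,1) * A $$ (1,0)"
proof -
  let ?c = "\<lambda>i j. mat 1 1 (\<lambda>_. A $$ (i, j))"
  have "A = four_block_mat (?c 0 0) (?c 0 1) (?c 1 0) (?c 1 1)"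
    using assms by (intro eq_matI) (auto simp: less_Suc_eq numeral_2_eq_2)
  then have "det A = det (four_block_mat (?c 0 0) (?c 0 1) (?c 1 0) (?c 1 1))" by simp
  also have "\<dots> = det (?c 0 0 * ?c 1 1 - ?c 0 1 * ?c 1 0)"
    by (rule det_four_block_mat) (auto intro!: eq_matI simp: scalar_prod_def)
  also have "\<dots> = A $$ (0,0) * A $$ (1,1) - A $$ (0,1) * A $$ (1,0)"
    by (subst det_single) (auto simp: scalar_prod_def)
  finally show ?thesis .
qed

section \<open>Determinants of periodic tridiagonal matrices\<close>

definition transfer :: "complex \<Rightarrow> complex m2" where "transfer e = M2 e (-1) 1 0"

lemma transfer_sel [simp]: "e11 (transfer e) = e" "e12 (transfer e) = -1" "e21 (transfer e) = 1" "e22 (transfer e) = 0"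
  by (simp_all add: transfer_def)

lemma m2_det_transfers: "m2_det (prod_list (map transfer es)) = 1"
  by (induction es) (auto simp: m2_det_mult, simp_all add: m2_det_def)

definition cyclic_mat :: "complex list \<Rightarrow> complex mat" where
  "cyclic_mat es = (let l = length es in mat l l (\<lambda>(i, j).
     if i = j then es ! i else if j = Suc i mod l \<or> i = Suc j mod l then - 1 else 0))"

text \<open>
  The value is in fact always 1, but it suffices that it is a sign depending on the length alone.
\<close>

definition cyclic_sign :: "nat \<Rightarrow> complex" where
  "cyclic_sign l = - (signof (\<lambda>i. if i < l then Suc i mod l else i) * (- 1) ^ (l - 2))"

lemma cyclic_sign: "cyclic_sign l = 1 \<or> cyclic_sign l = - 1"
  using minus_one_power_iff[of "l - 2", where ?'a = complex] by (auto simp: cyclic_sign_def sign_def)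

lemma Suc_mod_neq: "i < l \<Longrightarrow> 3 \<le> l \<Longrightarrow> Suc i mod l \<noteq> i"
  by (auto simp: mod_Suc)

lemma Suc_mod_not_sym: "i < l \<Longrightarrow> 3 \<le> l \<Longrightarrow> Suc (Suc i mod l) mod l \<noteq> i"
  by (auto simp: mod_Suc split: if_splits)

text \<open>\<open>transfer e\<close> takes the values of a sequence at \<open>i\<close> and
  \<open>i + 1\<close> to those at \<open>i - 1\<close> and \<open>i\<close>, for the recurrence
  given by a row with diagonal entry \<open>e\<close> and neighbours -1. A kernel vector is a
  solution that closes up around the cycle, that is, a fixed vector of the product \<open>T\<close>
  of these matrices; as \<open>T\<close> has determinant 1, the determinant of \<open>T - 1\<close>
  is \<open>2 - m2_tr T\<close>.\<close>

lemma det_cyclic_mat: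
  assumes len: "length es \<ge> 3"
  shows "det (cyclic_mat es) = cyclic_sign (length es) * (m2_tr (prod_list (map transfer es)) - 2)"
proof -
  define l where "l = length es"
  define r where "r = l - 3"
  have l: "l = Suc (Suc (Suc r))" using len by (simp add: l_def r_def)
  define A where "A = cyclic_mat es"
  have A: "A \<in> carrier_mat l l" by (simp add: A_def cyclic_mat_def Let_def l_def)
  have Aij: "A $$ (i, j) = (if i = j then es ! i else if j = Suc i mod l \<or> i = Suc j mod l then - 1 else 0)"
    if "i < l" "j < l" for i j using that by (simp add: A_def cyclic_mat_def Let_def l_def)
  define p where "p = (\<lambda>i. if i < l then Suc i mod l else i)"
  have p: "p permutes {0..<l}"
  proof (rule bij_imp_permutes)
    have "inj_on p {0..<l}" by (auto simp: inj_on_def p_def l mod_Suc split: if_splits)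
    moreover have "0 < l" by (simp add: l)
    then have "p ` {0..<l} \<subseteq> {0..<l}" by (auto simp: p_def)
    ultimately show "bij_betw p {0..<l} {0..<l}" by (simp add: bij_betw_def endo_inj_surj)
  qed (auto simp: p_def)
  define H where "H = mat l l (\<lambda>(i, j). A $$ (p i, j))"
  have detH: "det H = signof p * det A" unfolding H_def by (rule det_permute_rows[OF A p])
  have H: "H \<in> carrier_mat l l" by (simp add: H_def)
  \<comment> \<open>Chosen so that at the indices \<open>Suc r\<close> and
    \<open>Suc (Suc r)\<close> the sequence \<open>y\<close> takes the values 1, 0 and
    \<open>z\<close> the values 0, 1; this gives \<open>Y\<close> below a unit diagonal.\<close>
  define M0 where "M0 = M2 0 1 (-1) (last es)"
  define S where "S i = prod_list (map transfer (drop i es)) * M0" for i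
  have S: "S i = transfer (es ! i) * S (Suc i)" if "i < l" for i
    using that by (simp add: S_def l_def Cons_nth_drop_Suc[symmetric] mult.assoc)
  have Sl: "S l = M0" by (simp add: S_def l_def)
  have lst: "last es = es ! (Suc (Suc r))" using last_conv_nth[of es] l unfolding l_def by fastforce
  define y where "y i = e21 (S i)" for i
  define z where "z i = e22 (S i)" for i
  have yz: "e11 (S i) = es ! i * y i - y (Suc i)" "y i = e11 (S (Suc i))"
     "e12 (S i) = es ! i * z i - z (Suc i)" "z i = e12 (S (Suc i))" if "i < l" for i
    unfolding y_def z_def using S[OF that] by auto
  have rec: "y i = es ! Suc i * y (Suc i) - y (Suc (Suc i))" "z i = es ! Suc i * z (Suc i) - z (Suc (Suc i))"
    if "Suc i < l" for i using yz(1)[OF that] yz(2)[of i] yz(3)[OF that] yz(4)[of i] that by auto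
  have yl: "y l = -1" "z l = last es" by (auto simp: y_def z_def Sl M0_def)
  have yl1: "y (Suc (Suc r)) = 0" "z (Suc (Suc r)) = 1"
    using yz(2,4)[of "Suc (Suc r)"] by (auto simp: l[symmetric] Sl M0_def) (simp_all add: l)
  have yl2: "y (Suc r) = 1" "z (Suc r) = 0" using rec[of "Suc r"] yl1 yl by (auto simp: l lst)
  \<comment> \<open>After the cyclic shift \<open>p\<close> of the rows, \<open>H\<close> is upper triangular outside its last two rows. The
    solutions \<open>y\<close>, \<open>z\<close> of the three-term recurrence, as last two columns of \<open>Y\<close>, clear the upper right
    block.\<close>
  define Y where "Y = mat l l (\<lambda>(i, j). if j = Suc r then y i else if j = Suc (Suc r) then z i
     else if i = j then 1 else 0)"
  have Y: "Y \<in> carrier_mat l l" by (simp add: Y_def)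
  have detY: "det Y = 1"
  proof -
    have "upper_triangular Y" using yl1 by (auto simp: Y_def upper_triangular_def l less_Suc_eq)
    moreover have "diag_mat Y = map (\<lambda>_. 1) [0..<l]"
      using yl1 yl2 by (auto simp: diag_mat_def Y_def l)
    ultimately show ?thesis using det_upper_triangular[OF _ Y] by (simp add: map_replicate_const)
  qed
  have pm: "p i = Suc i mod l" "p i < l" if "i < l" for i using that by (auto simp: p_def)
  have row: "(\<Sum>k<l. A $$ (p i, k) * g k) = es ! p i * g (p i) - g i - g (p (p i))"
    if i: "i < l" for i and g :: "nat \<Rightarrow> complex"
  proof -
    have l3: "3 \<le> l" by (simp add: l)
    have d: "p i \<noteq> i" "p (p i) \<noteq> p i" "p (p i) \<noteq> i"
      using Suc_mod_neq[OF i l3] Suc_mod_neq[OF pm(2)[OF i] l3] Suc_mod_not_sym[OF i l3] i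
      by (auto simp: pm)
    have inj: "p k = p i \<longleftrightarrow> k = i" for k using permutes_inj[OF p] by (auto simp: inj_def)
    have ent: "A $$ (p i, k) = (if k = p i then es ! p i else if k = p (p i) \<or> k = i then - 1 else 0)"
      if "k < l" for k using that i inj[of k] by (auto simp: Aij pm(2) pm(1)[symmetric])
    have "(\<Sum>k<l. A $$ (p i, k) * g k) = (\<Sum>k\<in>{i, p i, p (p i)}. A $$ (p i, k) * g k)"
      using i pm(2) by (intro sum.mono_neutral_right) (auto simp: ent)
    also have "\<dots> = es ! p i * g (p i) - g i - g (p (p i))" using d i pm(2) by (auto simp: ent)
    finally show ?thesis .
  qed
  have HY: "(H * Y) $$ (i, j) = es ! p i * Y $$ (p i, j) - Y $$ (i, j) - Y $$ (p (p i), j)" if "i < l" "j < l" for i j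
    using that H Y row[of i "\<lambda>k. Y $$ (k, j)"] by (simp add: scalar_prod_def H_def atLeast0LessThan)
  have pr: "p i = Suc i" if "i < Suc (Suc r)" for i using that by (simp add: p_def l)
  have pl: "p (Suc (Suc r)) = 0" by (simp add: p_def l)
  have HY1: "(H * Y) $$ (i, j) = - Y $$ (i, j) + es ! Suc i * Y $$ (Suc i, j) - Y $$ (Suc (Suc i), j)"
    if "i < Suc r" "j < l" for i j using HY[of i j] that by (simp add: pr l)
  define U where "U = mat (Suc r) (Suc r) (\<lambda>(i, j). (H * Y) $$ (i, j))"
  define C where "C = mat 2 (Suc r) (\<lambda>(i, j). (H * Y) $$ (i + Suc r, j))"
  define W where "W = mat 2 2 (\<lambda>(i, j). (H * Y) $$ (i + Suc r, j + Suc r))"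
  have blk: "H * Y = four_block_mat U (0\<^sub>m (Suc r) 2) C W"
  proof (rule eq_matI)
    fix i j assume "i < dim_row (four_block_mat U (0\<^sub>m (Suc r) 2) C W)" "j < dim_col (four_block_mat U (0\<^sub>m (Suc r) 2) C W)"
    then have ij: "i < l" "j < l" by (auto simp: U_def W_def l)
    show "(H * Y) $$ (i, j) = four_block_mat U (0\<^sub>m (Suc r) 2) C W $$ (i, j)"
    proof (cases "i < Suc r \<and> j \<ge> Suc r")
      case True
      have "(H * Y) $$ (i, j) = 0" using True rec[of i] ij HY1[of i j]
        by (cases "j = Suc r") (auto simp: Y_def l)
      then show ?thesis using True ij by (simp add: U_def W_def C_def l)
    next
      case False
      then show ?thesis using ij by (auto simp: U_def W_def C_def l)
    qed
  qed (use H Y in \<open>auto simp: U_def W_def l\<close>)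
  have "det (H * Y) = det U * det W"
    unfolding blk by (rule det_four_block_mat_upper_right_zero) (auto simp: U_def W_def C_def)
  moreover have "det U = (- 1) ^ Suc r"
  proof -
    have Uij: "U $$ (i, j) = (if i = j then - 1 else if j < i then 0 else U $$ (i, j))" if "i < Suc r" "j < Suc r" for i j
    proof -
      have "U $$ (i, j) = - Y $$ (i, j) + es ! Suc i * Y $$ (Suc i, j) - Y $$ (Suc (Suc i), j)"
        using that HY1[of i j] by (simp add: U_def l)
      then show ?thesis using that by (auto simp: Y_def l)
    qed
    have "upper_triangular U" using Uij by (auto simp: upper_triangular_def U_def)
    moreover have "diag_mat U = map (\<lambda>_. - 1) [0..<Suc r]"
      unfolding diag_mat_def using Uij by (auto simp: U_def simp del: upt_Suc)
    moreover have "U \<in> carrier_mat (Suc r) (Suc r)" by (simp add: U_def)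
    ultimately have "det U = prod_list (replicate (Suc r) (-1))"
      using det_upper_triangular[of U "Suc r"] by (simp only: map_replicate_const length_upt diff_zero)
    then show ?thesis by (simp only: prod_list_replicate)
  qed
  moreover have "det W = 2 - m2_tr (prod_list (map transfer es))"
  proof -
    define T where "T = prod_list (map transfer es)"
    have S0: "S 0 = T * M0" by (simp add: S_def T_def)
    have W: "W $$ (0, 0) = y l - y 0" "W $$ (0, 1) = z l - z 0"
      "W $$ (1, 0) = e11 (S 0) - y (Suc (Suc r))" "W $$ (1, 1) = e12 (S 0) - z (Suc (Suc r))"
    proof -
      have i: "0 < l" "1 < l" "Suc r < l" "Suc (Suc r) < l" by (auto simp: l)
      have Yy: "Y $$ (i, Suc r) = y i" "Y $$ (i, Suc (Suc r)) = z i" if "i < l" for i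
        using that i by (auto simp: Y_def)
      have Wij: "W $$ (0, 0) = (H * Y) $$ (Suc r, Suc r)" "W $$ (0, 1) = (H * Y) $$ (Suc r, Suc (Suc r))"
        "W $$ (1, 0) = (H * Y) $$ (Suc (Suc r), Suc r)" "W $$ (1, 1) = (H * Y) $$ (Suc (Suc r), Suc (Suc r))"
        by (simp_all add: W_def)
      have p: "p (Suc r) = Suc (Suc r)" "p (Suc (Suc r)) = 0" "p 0 = 1" by (simp_all add: p_def l)
      note simps = Wij HY[OF i(3,3)] HY[OF i(3,4)] HY[OF i(4,3)] HY[OF i(4,4)] p Yy[OF i(1)] Yy[OF i(2)] Yy[OF i(3)] Yy[OF i(4)]
      show "W $$ (0, 0) = y l - y 0" "W $$ (0, 1) = z l - z 0"
        unfolding simps by (simp_all add: yl1 yl2 yl lst)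
      show "W $$ (1, 0) = e11 (S 0) - y (Suc (Suc r))" "W $$ (1, 1) = e12 (S 0) - z (Suc (Suc r))"
        unfolding simps using yz(1,3)[OF i(1)] by simp_all
    qed
    have "det W = (y l - y 0) * (e12 (S 0) - z (Suc (Suc r))) - (z l - z 0) * (e11 (S 0) - y (Suc (Suc r)))"
      using det_2x2[of W] unfolding W by (simp add: W_def)
    also have "\<dots> = m2_det T - m2_tr T + 1"
      unfolding yl yl1 unfolding y_def z_def S0 by (simp add: M0_def m2_det_def m2_tr_def algebra_simps)
    finally show ?thesis unfolding T_def m2_det_transfers by simp
  qed
  moreover have "det (H * Y) = signof p * det A" using det_mult[OF H Y] detY detH by simp
  ultimately have "signof p * det A = (- 1) ^ Suc r * (2 - m2_tr (prod_list (map transfer es)))" by simp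
  then have "signof p * (signof p * det A) = signof p * ((- 1) ^ Suc r * (2 - m2_tr (prod_list (map transfer es))))"
    by simp
  moreover have "signof p * (signof p * det A) = det A" by (simp add: sign_def)
  ultimately have dA: "det A = signof p * ((- 1) ^ Suc r * (2 - m2_tr (prod_list (map transfer es))))" by simp
  have cs: "cyclic_sign l = - (signof p * (- 1) ^ Suc r)"
  proof -
    have "l - 2 = Suc r" by (simp add: l)
    then show ?thesis unfolding cyclic_sign_def p_def by simp
  qed
  show ?thesis unfolding A_def[symmetric] l_def[symmetric] dA cs by (simp add: algebra_simps)
qed

section \<open>The characteristic polynomial of a sun\<close>

text \<open>
  The diagonal entry of a cycle vertex after the Schur complement with respect to the leaves; \<open>t\<close> tells
  whether the vertex carries a leaf. At the pole \<open>x = 1\<close> the division yields 0.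
\<close>

definition pole :: "bool \<Rightarrow> complex \<Rightarrow> complex" where
  "pole t x = x - 2 - (if t then 1 + 1 / (x - 1) else 0)"

abbreviation ones :: "bool list \<Rightarrow> nat" where "ones s \<equiv> count_list s True"

definition sun_step :: "'a::comm_ring_1 \<Rightarrow> bool \<Rightarrow> 'a m2" where
  "sun_step z t = shift z 1 * (if t then defect z else 1)"
definition sun_prod :: "'a::comm_ring_1 \<Rightarrow> bool list \<Rightarrow> 'a m2" where
  "sun_prod z s = prod_list (map (sun_step z) s)"

definition word_of :: "nat list \<Rightarrow> bool list" where
  "word_of ds = concat (map (\<lambda>d. replicate (d - 1) False @ [True]) ds)"

lemma sun_prod_append: "sun_prod z (s @ t) = sun_prod z s * sun_prod z t"
  by (simp add: sun_prod_def)

lemma shift_add: "shift z a * shift z b = shift z (a + b)"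
  by (simp add: shift_def times_m2_def power_add algebra_simps)

lemma sun_prod_replicate: "sun_prod z (replicate n False) = shift z n"
proof (induction n)
  case 0
  then show ?case by (simp add: sun_prod_def shift_def one_m2_def)
next
  case (Suc n)
  then show ?case using shift_add[of z 1 n] by (simp add: sun_prod_def sun_step_def)
qed

lemma defect_sun_prod_word_of:
  "\<forall>d\<in>set ds. d \<ge> 1 \<Longrightarrow> defect z * sun_prod z (word_of ds) = ring_prod z ds * defect z"
proof (induction ds)
  case Nil
  then show ?case by (simp add: word_of_def sun_prod_def)
next
  case (Cons d ds)
  have "sun_prod z (word_of (d # ds)) = shift z (d - 1) * (shift z 1 * defect z) * sun_prod z (word_of ds)"
    by (simp add: word_of_def sun_prod_append sun_prod_replicate)
       (simp add: sun_prod_def sun_step_def mult.assoc)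
  also have "\<dots> = shift z d * (defect z * sun_prod z (word_of ds))"
    using Cons.prems shift_add[of z "d - 1" 1] by (simp add: mult.assoc[symmetric])
  finally show ?case using Cons by (simp add: mult.assoc)
qed

lemma m2_tr_sun_prod_word_of:
  fixes z :: "'a::comm_ring_1"
  assumes "\<forall>d\<in>set ds. d \<ge> 1"
  shows "m2_tr (sun_prod z (word_of ds)) = m2_tr (ring_prod z ds)"
proof (cases ds)
  case Nil
  then show ?thesis by (simp add: word_of_def sun_prod_def)
next
  case (Cons d ds')
  have "word_of ds = replicate (d - 1) False @ [True] @ word_of ds'" by (simp add: Cons word_of_def)
  then have "sun_prod z (word_of ds) = shift z (d - 1) * (shift z 1 * defect z) * sun_prod z (word_of ds')"
    by (simp only: sun_prod_append sun_prod_replicate)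
       (simp add: sun_prod_def sun_step_def mult.assoc)
  also have "\<dots> = shift z d * (defect z * sun_prod z (word_of ds'))"
    using assms Cons shift_add[of z "d - 1" 1] by (simp add: mult.assoc[symmetric])
  also have "\<dots> = shift z d * ring_prod z ds' * defect z"
    using assms Cons by (simp add: defect_sun_prod_word_of mult.assoc)
  finally have "m2_tr (sun_prod z (word_of ds)) = m2_tr (defect z * (shift z d * ring_prod z ds'))"
    by (simp add: m2_tr_commute)
  then show ?thesis by (simp add: Cons mult.assoc)
qed

text \<open>The columns of \<open>W\<close> are eigenvectors of \<open>transfer (x - 2)\<close> for
  \<open>1 / z\<close> and \<open>z\<close>, since \<open>x - 2 = z + 1 / z\<close>; scaling by
  \<open>z\<close> turns the eigenvalues into 1 and \<open>z ^ 2\<close>. A leaf lowers the diagonal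
  entry by \<open>x / (x - 1) = (1 + z)^2 / (1 + z + z^2)\<close>, whose denominator divides
  \<open>rden z = (1 - z) * (1 + z + z^2)\<close>.\<close>

lemma transfer_sun_step:
  fixes z :: complex
  assumes z: "z \<noteq> 0" "z ^ 2 \<noteq> 1" "1 + z + z ^ 2 \<noteq> 0"
  defines "x \<equiv> (1 + z) ^ 2 / z" and "W \<equiv> M2 1 1 z (1 / z)"
  shows "M2 (z * rden z ^ of_bool t) 0 0 (z * rden z ^ of_bool t) * (transfer (pole t x) * W) = W * sun_step z t"
proof -
  have x1: "x - 1 = (1 + z + z ^ 2) / z" using z by (simp add: x_def field_simps power2_eq_square)
  have c: "rden z = (1 - z) * (1 + z + z ^ 2)" by (simp add: rden_def ring_normal)
  have xz: "z * x = (1 + z)^2" using z by (simp add: x_def)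
  have pt: "z * rden z * (x - 2 - (1 + 1 / (x - 1))) = (1 - z) * ((1 + z^2) * (1 + z + z^2) - z * (1 + z)^2)"
  proof -
    have q: "rden z * (1 + 1 / (x - 1)) = (1 - z) * (1 + z)^2"
      unfolding x1 c using z by (simp add: field_simps power2_eq_square)
    have "z * rden z * (x - 2 - (1 + 1 / (x - 1))) = rden z * (z * x - 2 * z) - z * (rden z * (1 + 1 / (x - 1)))"
      by (simp add: algebra_simps)
    also have "\<dots> = (1 - z) * ((1 + z^2) * (1 + z + z^2) - z * (1 + z)^2)"
      unfolding q xz unfolding c by (simp add: algebra_simps power2_eq_square)
    finally show ?thesis .
  qed
  show ?thesis
  proof (cases t)
    case True
    have e1: "z * rden z * (pole True x - z) = rden z - rnum z + z^2 * rnum z"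
      using pt unfolding pole_def right_diff_distrib
      by (simp add: c rnum_def algebra_simps power2_eq_square)
    have "z * rden z * pole True x = (1 - z) * ((1 + z^2) * (1 + z + z^2) - z * (1 + z)^2)"
      using pt by (simp add: pole_def)
    then have e2: "z * rden z * (pole True x - 1 / z) = - rnum z + z^2 * (rden z + rnum z)"
      using z(1) unfolding right_diff_distrib
      by (simp add: c rnum_def algebra_simps power2_eq_square)
    have e3: "z * rden z = z * (rden z - rnum z) + 1 / z * (z^2 * rnum z)"
      using z(1) by (simp add: field_simps power2_eq_square)
    have e4: "z * rden z = z * (- rnum z) + 1 / z * (z^2 * (rden z + rnum z))"
      using z(1) by (simp add: field_simps power2_eq_square)
    have L: "M2 (z * rden z ^ of_bool t) 0 0 (z * rden z ^ of_bool t) * (transfer (pole t x) * W)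
      = M2 (z * rden z * (pole True x - z)) (z * rden z * (pole True x - 1 / z)) (z * rden z) (z * rden z)"
      by (simp add: m2.expand W_def True)
    have R: "W * sun_step z t = M2 (rden z - rnum z + z^2 * rnum z) (- rnum z + z^2 * (rden z + rnum z))
        (z * (rden z - rnum z) + 1 / z * (z^2 * rnum z)) (z * (- rnum z) + 1 / z * (z^2 * (rden z + rnum z)))"
      by (simp add: m2.expand W_def sun_step_def True)
    show ?thesis unfolding L R m2.inject using e1 e2 e3 e4 by blast
  next
    case False
    have "z * pole False x = 1 + z^2"
      using xz by (simp add: pole_def algebra_simps power2_eq_square)
    then show ?thesis
      using False z(1) by (simp add: m2.expand W_def sun_step_def algebra_simps power2_eq_square)
  qed
qed

lemma m2_scalar_commute: "M2 a 0 0 a * B = B * M2 a 0 0 a"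
  by (simp add: m2.expand mult.commute)

lemma m2_tr_transfers:
  fixes z :: complex
  assumes z: "z \<noteq> 0" "z ^ 2 \<noteq> 1" "1 + z + z ^ 2 \<noteq> 0"
  defines "x \<equiv> (1 + z) ^ 2 / z"
  shows "z ^ length s * rden z ^ ones s * m2_tr (prod_list (map (\<lambda>t. transfer (pole t x)) s))
    = m2_tr (sun_prod z s)"
proof -
  define W where "W = M2 1 1 z (1 / z)"
  define a where "a = z ^ length s * rden z ^ ones s"
  let ?T = "prod_list (map (\<lambda>t. transfer (pole t x)) s)"
  have conj: "M2 a 0 0 a * (?T * W) = W * sun_prod z s" unfolding a_def
  proof (induction s)
    case Nil
    then show ?case by (simp add: sun_prod_def m2.expand)
  next
    case (Cons t s)
    define b where "b = z ^ length s * rden z ^ ones s"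
    define c where "c = z * rden z ^ of_bool t"
    let ?P = "prod_list (map (\<lambda>t. transfer (pole t x)) s)"
    have bc: "M2 (z ^ length (t # s) * rden z ^ count_list (t # s) True) 0 0 (z ^ length (t # s) * rden z ^ count_list (t # s) True)
        = M2 c 0 0 c * M2 b 0 0 b" by (auto simp: b_def c_def m2.expand)
    have "M2 c 0 0 c * M2 b 0 0 b * (transfer (pole t x) * ?P * W)
        = M2 c 0 0 c * transfer (pole t x) * (M2 b 0 0 b * (?P * W))"
    proof -
      have "M2 c 0 0 c * M2 b 0 0 b * (transfer (pole t x) * ?P * W)
          = M2 c 0 0 c * (M2 b 0 0 b * transfer (pole t x)) * (?P * W)" by (simp only: mult.assoc)
      also have "M2 b 0 0 b * transfer (pole t x) = transfer (pole t x) * M2 b 0 0 b"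
        by (rule m2_scalar_commute)
      finally show ?thesis by (simp only: mult.assoc)
    qed
    also have "\<dots> = M2 c 0 0 c * (transfer (pole t x) * W) * sun_prod z s"
      using Cons.IH by (simp add: b_def mult.assoc)
    also have "M2 c 0 0 c * (transfer (pole t x) * W) = W * sun_step z t"
      unfolding c_def W_def x_def by (rule transfer_sun_step[OF z])
    finally show ?case unfolding bc by (simp add: sun_prod_def mult.assoc)
  qed
  \<comment> \<open>The adjugate of \<open>W\<close>, with determinant \<open>d\<close>; it undoes
    the change of basis under the trace.\<close>
  define V where "V = M2 (1 / z) (- 1) (- z) 1"
  define d where "d = 1 / z - z"
  have d: "d \<noteq> 0" using z by (simp add: d_def field_simps power2_eq_square)
  have WV: "W * V = M2 d 0 0 d" "V * W = M2 d 0 0 d"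
    using z(1) by (auto simp: W_def V_def d_def m2.expand)
  have "m2_tr (M2 a 0 0 a * (?T * W) * V) = a * d * m2_tr ?T"
    by (simp add: mult.assoc WV) (simp add: m2_tr_def algebra_simps)
  moreover have "m2_tr (M2 a 0 0 a * (?T * W) * V) = m2_tr (V * W * sun_prod z s)"
    unfolding conj using m2_tr_commute[of "W * sun_prod z s" V] by (simp add: mult.assoc)
  moreover have "m2_tr (V * W * sun_prod z s) = d * m2_tr (sun_prod z s)"
    unfolding WV by (simp add: m2_tr_def algebra_simps)
  ultimately have "d * (a * m2_tr ?T) = d * m2_tr (sun_prod z s)" by (metis mult.assoc mult.commute)
  then show ?thesis using d unfolding a_def[symmetric] by (metis mult_left_cancel)
qed

text \<open>At \<open>x = 0\<close> leaves are invisible, because \<open>1 + 1 / (x - 1)\<close>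
  vanishes. Every factor is \<open>transfer (- 2)\<close>, the negative of a unipotent matrix, whose
  powers have linear entries.\<close>

lemma m2_tr_transfers_0: "m2_tr (prod_list (map (\<lambda>t. transfer (pole t 0)) s)) = 2 * (- 1) ^ length s"
proof -
  have "prod_list (map (\<lambda>t. transfer (pole t 0)) s) =
     M2 ((-1) ^ length s * (of_nat (length s) + 1)) ((-1) ^ length s * of_nat (length s))
        (- ((-1) ^ length s * of_nat (length s))) ((-1) ^ length s * (1 - of_nat (length s)))"
    by (induction s) (auto simp: m2.expand pole_def algebra_simps)
  then show ?thesis by (simp add: m2_tr_def algebra_simps)
qed

lemma poly_sun_prod:
  "poly (e11 (sun_prod Z s)) z = e11 (sun_prod z s)" "poly (e12 (sun_prod Z s)) z = e12 (sun_prod z s)"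
  "poly (e21 (sun_prod Z s)) z = e21 (sun_prod z s)" "poly (e22 (sun_prod Z s)) z = e22 (sun_prod z s)"
proof (induction s)
  case Nil
  case 1 show ?case by (simp add: sun_prod_def)
  case 2 show ?case by (simp add: sun_prod_def)
  case 3 show ?case by (simp add: sun_prod_def)
  case 4 show ?case by (simp add: sun_prod_def)
next
  case (Cons t s)
  have c: "sun_prod y (t # s) = sun_step y t * sun_prod y s" for y :: "'b::comm_ring_1"
    by (simp add: sun_prod_def)
  case 1 show ?case unfolding c using Cons by (simp add: sun_step_def poly_Z rden_def rnum_def)
  case 2 show ?case unfolding c using Cons by (simp add: sun_step_def poly_Z rden_def rnum_def)
  case 3 show ?case unfolding c using Cons by (simp add: sun_step_def poly_Z rden_def rnum_def)
  case 4 show ?case unfolding c using Cons by (simp add: sun_step_def poly_Z rden_def rnum_def)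
qed

lemma poly_m2_tr_sun_prod: "poly (m2_tr (sun_prod Z s)) z = m2_tr (sun_prod z s)"
  by (simp add: m2_tr_def poly_sun_prod)

text \<open>The entries of \<open>x\<close> times the identity minus the signless Laplacian, over
  any ring: the parity argument of \<open>det_closed_part_even\<close> takes them over the
  integers.\<close>

definition lap_entry :: "nat set set \<Rightarrow> 'a::comm_ring_1 \<Rightarrow> nat \<Rightarrow> nat \<Rightarrow> 'a" where
  "lap_entry E x u v = (if u = v then x - of_nat (vertex_degree E u) else if {u, v} \<in> E then - 1 else 0)"

lemma simple_graphs_doubleton:
  assumes "E \<in> simple_graphs n" "{u, v} \<in> E"
  shows "u < n" "v < n" "u \<noteq> v"
  using assms unfolding simple_graphs_def by (auto simp: doubleton_eq_iff)

lemma simple_graphs_edge: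
  assumes "E \<in> simple_graphs n" "e \<in> E"
  obtains u v where "e = {u, v}" "u < n" "v < n" "u \<noteq> v"
  using assms unfolding simple_graphs_def by blast

lemma vertex_degree_neighbours:
  assumes "E \<in> simple_graphs n"
  shows "vertex_degree E v = card {u. u < n \<and> {v, u} \<in> E}"
proof -
  have "{e \<in> E. v \<in> e} = (\<lambda>u. {v, u}) ` {u. u < n \<and> {v, u} \<in> E}"
  proof
    show "{e \<in> E. v \<in> e} \<subseteq> (\<lambda>u. {v, u}) ` {u. u < n \<and> {v, u} \<in> E}"
    proof
      fix e assume e: "e \<in> {e \<in> E. v \<in> e}"
      then obtain a b where "e = {a, b}" "a < n" "b < n" using simple_graphs_edge[OF assms] by blast
      then have "\<exists>u<n. e = {v, u}" using e by (auto simp: insert_commute)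
      then show "e \<in> (\<lambda>u. {v, u}) ` {u. u < n \<and> {v, u} \<in> E}" using e by auto
    qed
  qed auto
  moreover have "inj_on (\<lambda>u. {v, u}) A" for A by (auto simp: inj_on_def doubleton_eq_iff)
  ultimately show ?thesis unfolding vertex_degree_def by (simp add: card_image)
qed

lemma signless_laplacian_carrier [simp]: "signless_laplacian n E \<in> carrier_mat n n"
  by (simp add: signless_laplacian_def degree_matrix_def adjacency_matrix_def)

abbreviation cpoly :: "nat \<Rightarrow> nat set set \<Rightarrow> complex poly" where
  "cpoly n E \<equiv> char_poly (signless_laplacian n E)"

lemma poly_char_poly_signless_laplacian:
  assumes "E \<in> simple_graphs n"
  shows "poly (cpoly n E) x = det (mat n n (\<lambda>(i, j). lap_entry E x i j))"
proof -
  have "- char_matrix (signless_laplacian n E) x = mat n n (\<lambda>(i, j). lap_entry E x i j)"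
    using simple_graphs_doubleton[OF assms]
    by (intro eq_matI) (auto simp: char_matrix_def signless_laplacian_def degree_matrix_def
        adjacency_matrix_def lap_entry_def)
  then show ?thesis by (simp add: char_poly_matrix[OF signless_laplacian_carrier])
qed

text \<open>
  \<open>(False, i)\<close> is the \<open>i\<close>-th vertex of the cycle and \<open>(True, i)\<close> the leaf attached to it.
\<close>

definition sun_verts :: "bool list \<Rightarrow> (bool \<times> nat) set" where
  "sun_verts s = {(False, i) |i. i < length s} \<union> {(True, i) |i. i < length s \<and> s ! i}"

definition sun_edges :: "bool list \<Rightarrow> (bool \<times> nat) set set" where
  "sun_edges s = {{(False, i), (False, Suc i mod length s)} |i. i < length s}
     \<union> {{(False, i), (True, i)} |i. i < length s \<and> s ! i}"

text \<open>The edge condition says two things at once: on the image the graph is exactly the sun,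
  and no edge leaves the image.\<close>

definition sun_component :: "nat set set \<Rightarrow> bool list \<Rightarrow> (bool \<times> nat \<Rightarrow> nat) \<Rightarrow> bool" where
  "sun_component E s h \<longleftrightarrow> 3 \<le> length s \<and> inj_on h (sun_verts s) \<and>
     {e \<in> E. e \<inter> h ` sun_verts s \<noteq> {}} = (`) h ` sun_edges s"

lemma sun_edges_subset: "e \<in> sun_edges s \<Longrightarrow> e \<subseteq> sun_verts s"
proof -
  assume "e \<in> sun_edges s"
  then consider i where "i < length s" "e = {(False, i), (False, Suc i mod length s)}"
    | i where "i < length s" "s ! i" "e = {(False, i), (True, i)}" by (auto simp: sun_edges_def)
  then show "e \<subseteq> sun_verts s"
  proof cases
    case (1 i)
    have "Suc i mod length s < length s" using 1 by (intro mod_less_divisor) auto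
    then show ?thesis using 1 by (simp add: sun_verts_def)
  qed (auto simp: sun_verts_def)
qed

lemma sun_component_edge:
  assumes "sun_component E s h" "a \<in> sun_verts s" "b \<in> sun_verts s"
  shows "{h a, h b} \<in> E \<longleftrightarrow> {a, b} \<in> sun_edges s"
proof -
  have inj: "inj_on h (sun_verts s)" using assms by (simp add: sun_component_def)
  have "{h a, h b} \<in> E \<longleftrightarrow> h ` {a, b} \<in> {e \<in> E. e \<inter> h ` sun_verts s \<noteq> {}}"
    using assms by auto
  also have "\<dots> \<longleftrightarrow> h ` {a, b} \<in> (`) h ` sun_edges s" using assms by (simp add: sun_component_def)
  also have "\<dots> \<longleftrightarrow> {a, b} \<in> sun_edges s"
    using inj_on_image_eq_iff[OF inj, of "{a, b}"] assms sun_edges_subset by (auto simp: image_iff)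
  finally show ?thesis .
qed

lemma sun_component_outside:
  assumes "sun_component E s h" "a \<in> sun_verts s" "{h a, u} \<in> E"
  shows "u \<in> h ` sun_verts s"
proof -
  have eq: "{e \<in> E. e \<inter> h ` sun_verts s \<noteq> {}} = (`) h ` sun_edges s"
    using assms(1) by (simp add: sun_component_def)
  have "{h a, u} \<in> {e \<in> E. e \<inter> h ` sun_verts s \<noteq> {}}" using assms by auto
  then have "{h a, u} \<in> (`) h ` sun_edges s" unfolding eq .
  then show ?thesis using sun_edges_subset by blast
qed

lemma sun_edges_iff:
  assumes "3 \<le> length s" "i < length s" "j < length s"
  shows "{(False, i), (False, j)} \<in> sun_edges s \<longleftrightarrow> j = Suc i mod length s \<or> i = Suc j mod length s"
    "{(False, i), (True, j)} \<in> sun_edges s \<longleftrightarrow> i = j \<and> s ! i"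
    "{(True, i), (False, j)} \<in> sun_edges s \<longleftrightarrow> i = j \<and> s ! i"
    "{(True, i), (True, j)} \<notin> sun_edges s"
  using assms by (auto simp: sun_edges_def doubleton_eq_iff)

lemma sun_component_degree:
  assumes "sun_component E s h" "a \<in> sun_verts s"
  shows "vertex_degree E (h a) = (if fst a then 1 else 2 + of_bool (s ! snd a))"
proof -
  have l: "3 \<le> length s" and inj: "inj_on h (sun_verts s)" using assms by (auto simp: sun_component_def)
  define l where "l = length s"
  have "{e \<in> E. h a \<in> e} = {e \<in> {e \<in> E. e \<inter> h ` sun_verts s \<noteq> {}}. h a \<in> e}"
    using assms(2) by blast
  also have "\<dots> = {e \<in> (`) h ` sun_edges s. h a \<in> e}"
    using assms(1) by (simp add: sun_component_def)
  also have "\<dots> = (`) h ` {e \<in> sun_edges s. a \<in> e}"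
    using inj_on_image_mem_iff[OF inj assms(2) sun_edges_subset] by blast
  finally have "vertex_degree E (h a) = card ((`) h ` {e \<in> sun_edges s. a \<in> e})"
    by (simp add: vertex_degree_def)
  also have "\<dots> = card {e \<in> sun_edges s. a \<in> e}"
    by (rule card_image, rule inj_on_subset[OF inj_on_image_Pow[OF inj]]) (use sun_edges_subset in auto)
  also have "\<dots> = (if fst a then 1 else 2 + of_bool (s ! snd a))"
  proof (cases a)
    case (Pair t i)
    have i: "i < l" and ti: "t \<Longrightarrow> s ! i" using assms(2) by (auto simp: Pair sun_verts_def l_def)
    show ?thesis
    proof (cases t)
      case True
      have "{e \<in> sun_edges s. a \<in> e} = {{(False, i), (True, i)}}"
        using i ti by (auto simp: Pair True sun_edges_def l_def)
      then show ?thesis by (simp add: Pair True)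
    next
      case False
      define j where "j = (if i = 0 then l - 1 else i - 1)"
      have j: "j < l" "Suc j mod l = i" using i by (auto simp: j_def)
      have ju: "k = j" if "k < l" "Suc k mod l = i" for k
        using that i by (auto simp: j_def mod_Suc split: if_splits)
      have ne: "{(False, i), (False, Suc i mod l)} \<noteq> {(False, j), (False, i)}"
        using Suc_mod_neq[of i l] Suc_mod_not_sym[of j l] i j l by (auto simp: doubleton_eq_iff l_def)
      have "{e \<in> sun_edges s. a \<in> e} =
        {{(False, i), (False, Suc i mod l)}, {(False, j), (False, i)}} \<union> (if s ! i then {{(False, i), (True, i)}} else {})"
        (is "?L = ?R")
      proof
        show "?L \<subseteq> ?R"
        proof
          fix e assume e: "e \<in> ?L"
          then consider k where "k < l" "e = {(False, k), (False, Suc k mod l)}" | k where "k < l" "s ! k" "e = {(False, k), (True, k)}"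
            by (auto simp: sun_edges_def l_def)
          then show "e \<in> ?R"
          proof cases
            case (1 k)
            then have "k = i \<or> Suc k mod l = i" using e by (auto simp: Pair False)
            then have "k = i \<or> k = j" using ju 1 by blast
            then show ?thesis using 1 j by blast
          next
            case (2 k)
            then have "k = i" using e by (auto simp: Pair False)
            then show ?thesis using 2 by simp
          qed
        qed
        have "{(False, i), (False, Suc i mod l)} \<in> sun_edges s"
          unfolding sun_edges_def l_def using i l_def by blast
        moreover have "{(False, j), (False, Suc j mod l)} \<in> sun_edges s"
          unfolding sun_edges_def l_def using j(1) l_def by blast
        moreover have "{(False, i), (True, i)} \<in> sun_edges s" if "s ! i"
          unfolding sun_edges_def using i l_def that by blast
        ultimately show "?R \<subseteq> ?L" unfolding j(2) by (simp add: Pair False)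
      qed
      moreover have "{(False, i), (True, i)} \<noteq> {(False, k), (False, k')}"
        "{(False, k), (False, k')} \<noteq> {(False, i), (True, i)}" for k k'
        by (simp_all add: doubleton_eq_iff)
      ultimately show ?thesis using ne by (simp add: Pair False)
    qed
  qed
  finally show ?thesis .
qed

text \<open>Cycle vertices come first and leaves last: the leaves, pairwise nonadjacent and of
  degree 1, then form the scalar corner required by \<open>det_scalar_corner\<close>.\<close>

definition sun_list :: "bool list \<Rightarrow> (bool \<times> nat) list" where
  "sun_list s = map (Pair False) [0..<length s] @ map (Pair True) (filter ((!) s) [0..<length s])"

abbreviation sun_enum :: "bool list \<Rightarrow> nat \<Rightarrow> bool \<times> nat" where
  "sun_enum s i \<equiv> sun_list s ! i"

lemma length_filter_nth: "length (filter ((!) s) [0..<length s]) = ones s"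
proof -
  have "((=) True) = id" by (rule ext) auto
  then have "ones s = length (filter id (map ((!) s) [0..<length s]))"
    by (simp add: map_nth count_list_eq_length_filter)
  then show ?thesis by (simp add: filter_map comp_def)
qed

lemma bij_betw_sun_enum: "bij_betw (sun_enum s) {..<length s + ones s} (sun_verts s)"
  by (rule bij_betw_nth) (auto simp: sun_list_def sun_verts_def length_filter_nth distinct_map inj_on_def)

lemma finite_sun_verts: "finite (sun_verts s)"
  and card_sun_verts: "card (sun_verts s) = length s + ones s"
  using bij_betw_finite[OF bij_betw_sun_enum[of s]] bij_betw_same_card[OF bij_betw_sun_enum[of s]]
  by simp_all

definition sun_value :: "bool list \<Rightarrow> complex \<Rightarrow> complex" where
  "sun_value s x = (x - 1) ^ ones s * (cyclic_sign (length s) *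
     (m2_tr (prod_list (map (\<lambda>t. transfer (pole t x)) s)) - 2))"

text \<open>Eliminating the leaves, whose corner is \<open>x - 1\<close>, subtracts
  \<open>1 / (x - 1)\<close> at each branching vertex and turns its diagonal entry
  \<open>x - 3\<close> into \<open>pole True x\<close>. A periodic tridiagonal matrix
  remains.\<close>

lemma det_sun_block:
  assumes E: "sun_component E s h" and x: "x \<noteq> 1"
  defines "N \<equiv> length s + ones s"
  shows "det (mat N N (\<lambda>(i, j). lap_entry E x (h (sun_enum s i)) (h (sun_enum s j)))) = sun_value s x"
proof -
  define l where "l = length s"
  define b where "b = ones s"
  define ts where "ts = filter ((!) s) [0..<l]"
  have ts: "distinct ts" "set ts = {i. i < l \<and> s ! i}" "length ts = b"
    by (auto simp: ts_def l_def b_def length_filter_nth)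
  have tsn: "ts ! k < l" "s ! (ts ! k)" if "k < b" for k using that ts nth_mem[of k ts] by auto
  have l3: "3 \<le> l" and inj: "inj_on h (sun_verts s)" using E by (auto simp: sun_component_def l_def)
  have F: "(False, i) \<in> sun_verts s" if "i < l" for i using that by (simp add: sun_verts_def l_def)
  have T: "(True, ts ! k) \<in> sun_verts s" if "k < b" for k using tsn[OF that] by (simp add: sun_verts_def l_def)
  have eF: "sun_enum s i = (False, i)" if "i < l" for i using that by (simp add: sun_list_def nth_append l_def)
  have eT: "sun_enum s i = (True, ts ! (i - l))" if "\<not> i < l" "i - l < b" for i
    using that ts(3) by (simp add: sun_list_def nth_append l_def ts_def)
  have heq: "h a = h b \<longleftrightarrow> a = b" if "a \<in> sun_verts s" "b \<in> sun_verts s" for a b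
    using inj that by (auto simp: inj_on_def)
  have ent: "lap_entry E x (h a) (h b) = (if a = b then x - of_nat (if fst a then 1 else 2 + of_bool (s ! snd a))
      else if {a, b} \<in> sun_edges s then - 1 else 0)" if "a \<in> sun_verts s" "b \<in> sun_verts s" for a b
    using that by (simp add: lap_entry_def heq sun_component_edge[OF E] sun_component_degree[OF E])
  define A where "A = mat l l (\<lambda>(i, j). if i = j then x - 2 - of_bool (s ! i)
      else if j = Suc i mod l \<or> i = Suc j mod l then - 1 else 0)"
  define B :: "complex mat" where "B = mat l b (\<lambda>(i, j). if i = ts ! j then - 1 else 0)"
  define C :: "complex mat" where "C = mat b l (\<lambda>(i, j). if j = ts ! i then - 1 else 0)"
  have "mat N N (\<lambda>(i, j). lap_entry E x (h (sun_enum s i)) (h (sun_enum s j)))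
    = four_block_mat A B C ((x - 1) \<cdot>\<^sub>m 1\<^sub>m b)" (is "?M = ?B")
  proof (rule eq_matI)
    fix i j assume "i < dim_row ?B" "j < dim_col ?B"
    then have ij: "i < l + b" "j < l + b" by (auto simp: A_def)
    have N: "N = l + b" by (simp add: N_def l_def b_def)
    note iff = sun_edges_iff[of s, folded l_def]
    consider "i < l" "j < l" | "i < l" "\<not> j < l" | "\<not> i < l" "j < l" | "\<not> i < l" "\<not> j < l" by blast
    then show "?M $$ (i, j) = ?B $$ (i, j)"
    proof cases
      case 1
      then show ?thesis using ij l3 by (simp add: N eF ent F iff A_def)
    next
      case 2
      then have k: "j - l < b" using ij by auto
      show ?thesis using ij 2 l3 k tsn[OF k] by (auto simp: N eF eT ent F T iff A_def B_def)
    next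
      case 3
      then have k: "i - l < b" using ij by auto
      show ?thesis using ij 3 l3 k tsn[OF k] by (auto simp: N eF eT ent F T iff A_def C_def)
    next
      case 4
      then have k: "i - l < b" "j - l < b" using ij by auto
      show ?thesis using ij 4 l3 k tsn[OF k(1)] tsn[OF k(2)] ts
        by (auto simp: N eT ent T iff A_def nth_eq_iff_index_eq)
    qed
  qed (auto simp: N_def A_def l_def b_def)
  moreover have "det (four_block_mat A B C ((x - 1) \<cdot>\<^sub>m 1\<^sub>m b)) = (x - 1) ^ b * det (A - (1 / (x - 1)) \<cdot>\<^sub>m (B * C))"
    using x by (intro det_scalar_corner) (auto simp: A_def B_def C_def)
  moreover have "A - (1 / (x - 1)) \<cdot>\<^sub>m (B * C) = cyclic_mat (map (\<lambda>t. pole t x) s)" (is "?L = ?R")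
  proof (rule eq_matI)
    fix i j assume "i < dim_row ?R" "j < dim_col ?R"
    then have ij: "i < l" "j < l" by (auto simp: cyclic_mat_def Let_def l_def)
    have "(B * C) $$ (i, j) = (\<Sum>k<b. (if i = ts ! k \<and> j = ts ! k then 1 else 0))"
      using ij by (auto simp: B_def C_def scalar_prod_def atLeast0LessThan intro!: sum.cong)
    also have "\<dots> = (\<Sum>t\<leftarrow>ts. if i = t \<and> j = t then 1 else 0)"
      by (simp add: sum_list_sum_nth ts atLeast0LessThan)
    also have "\<dots> = (\<Sum>t\<in>set ts. if i = t \<and> j = t then 1 else 0)"
      by (rule sum_list_distinct_conv_sum_set[OF ts(1)])
    also have "\<dots> = (\<Sum>t\<in>set ts. if i = t then (if j = i then 1 else 0) else 0)"
      by (rule sum.cong) auto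
    also have "\<dots> = (if i = j \<and> s ! i then 1 else 0)"
      using ij ts by (simp add: sum.delta')
    finally have BC: "(B * C) $$ (i, j) = (if i = j \<and> s ! i then 1 else 0)" .
    have d: "dim_row (B * C) = l" "dim_col (B * C) = l" by (auto simp: B_def C_def)
    have "?L $$ (i, j) = A $$ (i, j) - (1 / (x - 1)) * (B * C) $$ (i, j)" using ij d by simp
    also have "\<dots> = ?R $$ (i, j)"
      unfolding BC using ij by (auto simp: A_def cyclic_mat_def Let_def l_def pole_def)
    finally show "?L $$ (i, j) = ?R $$ (i, j)" .
  qed (auto simp: B_def C_def cyclic_mat_def Let_def l_def)
  ultimately show ?thesis using det_cyclic_mat[of "map (\<lambda>t. pole t x) s"] l3
    by (simp add: sun_value_def l_def b_def comp_def)
qed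

section \<open>Splitting a sun component off the determinant\<close>

definition rest_det :: "nat set set \<Rightarrow> (nat \<Rightarrow> nat) \<Rightarrow> nat \<Rightarrow> complex \<Rightarrow> complex" where
  "rest_det E g m x = det (mat m m (\<lambda>(i, j). lap_entry E x (g i) (g j)))"

lemma char_poly_sun_component:
  assumes E: "E \<in> simple_graphs n" and sun: "sun_component E s h" and V: "h ` sun_verts s \<subseteq> {..<n}"
  defines "m \<equiv> n - (length s + ones s)"
  obtains g where "bij_betw g {..<m} ({..<n} - h ` sun_verts s)"
    and "\<And>x. x \<noteq> 1 \<Longrightarrow> poly (cpoly n E) x
       = sun_value s x * rest_det E g m x"
    and "length s + ones s \<le> n"
proof -
  define N where "N = length s + ones s"
  have inj: "inj_on h (sun_verts s)" using sun by (simp add: sun_component_def)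
  have cV: "card (h ` sun_verts s) = N" by (simp add: card_image[OF inj] card_sun_verts N_def)
  have Nn: "N \<le> n" using card_mono[OF _ V] cV by simp
  have "card ({..<n} - h ` sun_verts s) = m"
    using V cV finite_subset[OF V] by (simp add: card_Diff_subset m_def N_def)
  then obtain g where g: "bij_betw g {..<m} ({..<n} - h ` sun_verts s)"
    using ex_bij_betw_nat_finite[of "{..<n} - h ` sun_verts s"] by (auto simp: atLeast0LessThan)
  define f where "f i = (if i < N then h (sun_enum s i) else g (i - N))" for i
  have bh: "bij_betw (\<lambda>i. h (sun_enum s i)) {..<N} (h ` sun_verts s)"
    using bij_betw_trans[OF bij_betw_sun_enum[of s] bij_betw_imageI[OF inj refl]]
    by (simp add: comp_def N_def)
  have n: "n = N + m" using Nn by (simp add: m_def N_def)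
  have "bij_betw (\<lambda>i. i - N) {N..<n} {..<m}"
    by (rule bij_betw_byWitness[where f' = "\<lambda>i. i + N"]) (auto simp: n)
  from bij_betw_trans[OF this g] have bg: "bij_betw (\<lambda>i. g (i - N)) {N..<n} ({..<n} - h ` sun_verts s)"
    by (simp add: comp_def)
  have "bij_betw f ({..<N} \<union> {N..<n}) (h ` sun_verts s \<union> ({..<n} - h ` sun_verts s))"
  proof (rule bij_betw_combine)
    show "bij_betw f {..<N} (h ` sun_verts s)"
      using bh by (rule bij_betw_cong[THEN iffD1, rotated]) (simp add: f_def)
    show "bij_betw f {N..<n} ({..<n} - h ` sun_verts s)"
      using bg by (rule bij_betw_cong[THEN iffD1, rotated]) (simp add: f_def)
  qed auto
  moreover have "{..<N} \<union> {N..<n} = {..<n}" "h ` sun_verts s \<union> ({..<n} - h ` sun_verts s) = {..<n}"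
    using Nn V by auto
  ultimately have f: "bij_betw f {..<n} {..<n}" by simp
  have gout: "g i \<notin> h ` sun_verts s" "g i < n" if "i < m" for i
    using bij_betwE[OF g] that by auto
  have vin: "sun_enum s i \<in> sun_verts s" if "i < N" for i
    using bij_betwE[OF bij_betw_sun_enum[of s]] that by (auto simp: N_def)
  show thesis
  proof (rule that[OF g])
    show "length s + ones s \<le> n" using Nn by (simp add: N_def)
  next
    fix x :: complex assume x: "x \<noteq> 1"
    let ?S = "mat N N (\<lambda>(i, j). lap_entry E x (h (sun_enum s i)) (h (sun_enum s j)))"
    let ?R = "mat m m (\<lambda>(i, j). lap_entry E x (g i) (g j))"
    have "poly (cpoly n E) x = det (mat n n (\<lambda>(i, j). lap_entry E x (f i) (f j)))"
      unfolding poly_char_poly_signless_laplacian[OF E] by (rule det_relabel[OF f, symmetric])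
    also have "mat n n (\<lambda>(i, j). lap_entry E x (f i) (f j)) = four_block_mat ?S (0\<^sub>m N m) (0\<^sub>m m N) ?R"
    proof (rule eq_matI)
      fix i j assume "i < dim_row (four_block_mat ?S (0\<^sub>m N m) (0\<^sub>m m N) ?R)"
        "j < dim_col (four_block_mat ?S (0\<^sub>m N m) (0\<^sub>m m N) ?R)"
      then have ij: "i < N + m" "j < N + m" by auto
      have z: "lap_entry E x (h a) (g k) = 0" "lap_entry E x (g k) (h a) = 0"
        if "a \<in> sun_verts s" "k < m" for a k
      proof -
        have "h a \<noteq> g k" using gout(1)[OF that(2)] that(1) by (metis imageI)
        then show "lap_entry E x (h a) (g k) = 0" "lap_entry E x (g k) (h a) = 0"
          using sun_component_outside[OF sun that(1), of "g k"] gout[OF that(2)]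
          by (auto simp: lap_entry_def insert_commute)
      qed
      show "mat n n (\<lambda>(i, j). lap_entry E x (f i) (f j)) $$ (i, j)
        = four_block_mat ?S (0\<^sub>m N m) (0\<^sub>m m N) ?R $$ (i, j)"
        using ij n by (auto simp: f_def z vin)
    qed (auto simp: n)
    also have "det \<dots> = det ?S * det ?R" by (rule det_four_block_mat_upper_right_zero) auto
    also have "det ?S = sun_value s x" unfolding N_def by (rule det_sun_block[OF sun x])
    finally show "poly (cpoly n E) x = sun_value s x * rest_det E g m x" by (simp add: rest_det_def)
  qed
qed

text \<open>
  Modulo 2 the all-ones vector is in the kernel, because every row sum is twice a degree.
\<close>

lemma det_closed_part_even:
  assumes E: "E \<in> simple_graphs n" and g: "bij_betw g {..<m} V" and V: "V \<subseteq> {..<n}" and m: "m > 0"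
    and closed: "\<And>u v. u \<in> V \<Longrightarrow> {u, v} \<in> E \<Longrightarrow> v \<in> V"
  obtains k :: int where "rest_det E g m 0 = 2 * of_int k"
proof -
  define R where "R = mat m m (\<lambda>(i, j). lap_entry E (0::int) (g i) (g j))"
  have R: "R \<in> carrier_mat m m" by (simp add: R_def)
  have gV: "g i \<in> V" if "i < m" for i using bij_betwE[OF g] that by auto
  have ginj: "g i = g j \<longleftrightarrow> i = j" if "i < m" "j < m" for i j
    using g that by (auto simp: bij_betw_def inj_on_def)
  have row: "(\<Sum>j<m. R $$ (i, j)) = - 2 * int (vertex_degree E (g i))" if i: "i < m" for i
  proof -
    have fin: "finite V" using V finite_subset by blast
    have "(\<Sum>j<m. R $$ (i, j)) = (\<Sum>j<m. lap_entry E (0::int) (g i) (g j))"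
      using i by (simp add: R_def)
    also have "\<dots> = (\<Sum>v\<in>V. lap_entry E (0::int) (g i) v)"
      by (rule sum.reindex_bij_betw[OF g])
    also have "\<dots> = lap_entry E 0 (g i) (g i) + (\<Sum>v\<in>V - {g i}. lap_entry E (0::int) (g i) v)"
      by (rule sum.remove[OF fin gV[OF i]])
    also have "(\<Sum>v\<in>V - {g i}. lap_entry E (0::int) (g i) v) = (\<Sum>v\<in>V. if {g i, v} \<in> E then - 1 else 0)"
      using simple_graphs_doubleton(3)[OF E, of "g i" "g i"] fin
      by (intro sum.mono_neutral_cong_left) (auto simp: lap_entry_def)
    also have "\<dots> = - int (card {v \<in> V. {g i, v} \<in> E})"
      using fin by (simp add: sum.If_cases Int_def)
    also have "{v \<in> V. {g i, v} \<in> E} = {v. v < n \<and> {g i, v} \<in> E}"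
      using V closed[OF gV[OF i]] by auto
    finally show ?thesis by (simp add: lap_entry_def vertex_degree_neighbours[OF E])
  qed
  \<comment> \<open>The adjugate times \<open>R\<close>, applied to the all-ones vector, has the
    determinant in every coordinate; \<open>m > 0\<close> provides coordinate 0.\<close>
  have "det R = (adj_mat R * R *\<^sub>v vec m (\<lambda>_. 1)) $ 0"
    unfolding adj_mat(3)[OF R] using m
    by (simp add: scalar_prod_def) (simp add: sum_distrib_left[symmetric])
  also have "adj_mat R * R *\<^sub>v vec m (\<lambda>_. 1) = adj_mat R *\<^sub>v (R *\<^sub>v vec m (\<lambda>_. 1))"
    using adj_mat(1)[OF R] R by (intro assoc_mult_mat_vec) auto
  also have "\<dots> $ 0 = (\<Sum>i<m. adj_mat R $$ (0, i) * (\<Sum>j<m. R $$ (i, j)))"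
    using adj_mat(1)[OF R] R m by (simp add: scalar_prod_def atLeast0LessThan)
  also have "even \<dots>" by (rule dvd_sum) (simp add: row)
  finally obtain k where k: "det R = 2 * k" by auto
  have "mat m m (\<lambda>(i, j). lap_entry E (0::complex) (g i) (g j)) = map_mat of_int R"
    by (rule eq_matI) (auto simp: R_def lap_entry_def)
  then have "rest_det E g m 0 = of_int (det R)" by (simp add: rest_det_def of_int_hom.hom_det)
  then show thesis using k by (intro that[of k]) simp
qed

text \<open>The factor \<open>2 * (- 1) ^ length s - 2\<close> is 0 for an even cycle and -4 for an
  odd one.\<close>

lemma sun_value_0: "sun_value s 0 = (- 1) ^ ones s * (cyclic_sign (length s) * (2 * (- 1) ^ length s - 2))"
  by (simp add: sun_value_def m2_tr_transfers_0)

lemma sun_spanning: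
  assumes E: "E \<in> simple_graphs n" and sun: "sun_component E s h" and V: "h ` sun_verts s \<subseteq> {..<n}"
    and P: "cmod (poly (cpoly n E) 0) = 4"
  shows "h ` sun_verts s = {..<n}" "n = length s + ones s"
proof -
  obtain g where g: "bij_betw g {..<n - (length s + ones s)} ({..<n} - h ` sun_verts s)"
    and p: "\<And>x. x \<noteq> 1 \<Longrightarrow> poly (cpoly n E) x
       = sun_value s x * rest_det E g (n - (length s + ones s)) x"
    and N: "length s + ones s \<le> n"
    using char_poly_sun_component[OF E sun V] by blast
  define m where "m = n - (length s + ones s)"
  have "m = 0"
  proof (rule ccontr)
    assume "m \<noteq> 0"
    then have m: "m > 0" by simp
    have cl: "v \<in> {..<n} - h ` sun_verts s" if "u \<in> {..<n} - h ` sun_verts s" "{u, v} \<in> E" for u v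
      using that sun_component_outside[OF sun, of _ u] simple_graphs_doubleton[OF E that(2)]
      by (auto simp: insert_commute)
    obtain k where k: "rest_det E g m 0 = 2 * of_int k"
      by (rule det_closed_part_even[OF E g[folded m_def] _ m]) (use cl in blast)+
    have cs: "cmod (cyclic_sign (length s)) = 1" using cyclic_sign[of "length s"] by auto
    have *: "4 = cmod (2 * (- 1) ^ length s - 2) * (2 * \<bar>real_of_int k\<bar>)"
      using P unfolding p[OF zero_neq_one] m_def[symmetric] k sun_value_0
      by (simp add: norm_mult norm_power cs)
    have "cmod (2 * (- 1) ^ length s - 2) = 0 \<or> cmod (2 * (- 1) ^ length s - 2) = 4"
      by (cases "even (length s)") auto
    then have "2 * \<bar>real_of_int k\<bar> = 1" using * by auto
    then have "\<bar>2 * k\<bar> = 1" by linarith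
    then show False by presburger
  qed
  then have n: "n = length s + ones s" using N by (simp add: m_def)
  then show "n = length s + ones s" .
  have "card (h ` sun_verts s) = n" using sun n by (simp add: sun_component_def card_image card_sun_verts)
  then show "h ` sun_verts s = {..<n}" using V by (simp add: card_subset_eq)
qed

lemma char_poly_sun:
  assumes E: "E \<in> simple_graphs n" and sun: "sun_component E s h" and V: "h ` sun_verts s = {..<n}" and x: "x \<noteq> 1"
  shows "poly (cpoly n E) x = sun_value s x"
proof -
  have V': "h ` sun_verts s \<subseteq> {..<n}" using V by simp
  obtain g where "bij_betw g {..<n - (length s + ones s)} ({..<n} - h ` sun_verts s)"
    and p: "\<And>x. x \<noteq> 1 \<Longrightarrow> poly (cpoly n E) x
       = sun_value s x * rest_det E g (n - (length s + ones s)) x"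
    and "length s + ones s \<le> n"
    using char_poly_sun_component[OF E sun V'] by blast
  have "n = length s + ones s"
    using arg_cong[OF V, of card] sun by (simp add: sun_component_def card_image card_sun_verts)
  \<comment> \<open>Nothing is left outside the sun, and the empty determinant is 1.\<close>
  then show ?thesis using p[OF x] by (simp add: rest_det_def)
qed

text \<open>As \<open>rden z = (x - 1) * z * (1 - z)\<close>, the extra powers of \<open>z\<close>
  and \<open>1 - z\<close> complete the Schur factor \<open>(x - 1) ^ ones s\<close> to the scaling
  of \<open>m2_tr_transfers\<close>.\<close>

lemma sun_value_param:
  fixes z :: complex
  assumes z: "z \<noteq> 0" "z ^ 2 \<noteq> 1" "1 + z + z ^ 2 \<noteq> 0"
  shows "sun_value s ((1 + z) ^ 2 / z) * z ^ (length s + ones s) * (1 - z) ^ ones s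
    = cyclic_sign (length s) * (m2_tr (sun_prod z s) - 2 * z ^ length s * rden z ^ ones s)"
proof -
  define x where "x = (1 + z) ^ 2 / z"
  have x1: "x - 1 = (1 + z + z ^ 2) / z" using z by (simp add: x_def field_simps power2_eq_square)
  have c: "rden z = (x - 1) * z * (1 - z)"
  proof -
    have "(x - 1) * z = 1 + z + z ^ 2" unfolding x1 using z(1) by simp
    then show ?thesis by (simp add: rden_def ring_normal)
  qed
  have "sun_value s x * z ^ (length s + ones s) * (1 - z) ^ ones s
    = cyclic_sign (length s) * (z ^ length s * rden z ^ ones s * m2_tr (prod_list (map (\<lambda>t. transfer (pole t x)) s))
        - 2 * z ^ length s * rden z ^ ones s)"
    unfolding sun_value_def c power_mult_distrib power_add
    by (simp add: right_diff_distrib left_diff_distrib ac_simps)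
  also have "z ^ length s * rden z ^ ones s * m2_tr (prod_list (map (\<lambda>t. transfer (pole t x)) s)) = m2_tr (sun_prod z s)"
    unfolding x_def by (rule m2_tr_transfers[OF z])
  finally show ?thesis by (simp add: x_def)
qed

section \<open>Spectral moments\<close>

lemma proots_prod_list_linear: "proots (\<Prod>a\<leftarrow>as. [:- a, 1 :: complex:]) = mset as"
proof (induction as)
  case (Cons a as)
  have nz: "(\<Prod>a\<leftarrow>as. [:- a, 1 :: complex:]) \<noteq> 0" by (auto simp: prod_list_zero_iff)
  have "proots ([:- a, 1:] * (\<Prod>a\<leftarrow>as. [:- a, 1:])) = proots [:- a, 1:] + proots (\<Prod>a\<leftarrow>as. [:- a, 1:])"
    by (rule proots_mult) (use nz in auto)
  then show ?case using Cons by (simp del: mult_pCons_left)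
qed simp

lemma spectrum_eq_imp_char_poly_eq:
  assumes "signless_laplacian_spectrum m F = signless_laplacian_spectrum n E"
  shows "m = n" "cpoly m F = cpoly n E"
proof -
  obtain as where as: "cpoly m F = (\<Prod>a\<leftarrow>as. [:- a, 1:])" "length as = m"
    using char_poly_factorized[OF signless_laplacian_carrier] by blast
  obtain bs where bs: "cpoly n E = (\<Prod>a\<leftarrow>bs. [:- a, 1:])" "length bs = n"
    using char_poly_factorized[OF signless_laplacian_carrier] by blast
  have eq: "mset as = mset bs"
    using assms by (simp add: signless_laplacian_spectrum_def as bs proots_prod_list_linear)
  then show "m = n" using as(2) bs(2) by (metis size_mset)
  have "prod_mset (image_mset (\<lambda>a. [:- a, 1:]) (mset as)) = prod_mset (image_mset (\<lambda>a. [:- a, 1:]) (mset bs))"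
    unfolding eq ..
  then show "cpoly m F = cpoly n E" by (simp add: as bs prod_mset_prod_list[symmetric])
qed

section \<open>Traces of powers and closed walks\<close>

definition mat_trace :: "'a::comm_monoid_add mat \<Rightarrow> 'a" where
  "mat_trace A = (\<Sum>i<dim_row A. A $$ (i, i))"

lemma mat_trace_commute:
  fixes A :: "'a::comm_semiring_0 mat"
  assumes "A \<in> carrier_mat n m" "B \<in> carrier_mat m n"
  shows "mat_trace (A * B) = mat_trace (B * A)"
proof -
  have "mat_trace (A * B) = (\<Sum>i<n. \<Sum>j<m. A $$ (i, j) * B $$ (j, i))"
    using assms by (auto simp: mat_trace_def scalar_prod_def atLeast0LessThan intro!: sum.cong)
  also have "\<dots> = (\<Sum>j<m. \<Sum>i<n. A $$ (i, j) * B $$ (j, i))" by (rule sum.swap)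
  also have "\<dots> = mat_trace (B * A)"
    using assms by (auto simp: mat_trace_def scalar_prod_def atLeast0LessThan mult.commute intro!: sum.cong)
  finally show ?thesis .
qed

lemma upper_triangular_power:
  fixes B :: "complex mat"
  assumes "B \<in> carrier_mat n n" "upper_triangular B"
  shows "upper_triangular (B ^\<^sub>m k) \<and> (\<forall>i<n. (B ^\<^sub>m k) $$ (i, i) = B $$ (i, i) ^ k)"
proof (induction k)
  case 0
  then show ?case using assms by (auto simp: upper_triangular_def)
next
  case (Suc k)
  have C: "B ^\<^sub>m k \<in> carrier_mat n n" using assms by simp
  have z: "B $$ (i, j) = 0" "(B ^\<^sub>m k) $$ (i, j) = 0" if "j < i" "i < n" for i j
    using that assms Suc C by (auto simp: upper_triangular_def)
  have ent: "(B ^\<^sub>m Suc k) $$ (i, j) = (\<Sum>l<n. (B ^\<^sub>m k) $$ (i, l) * B $$ (l, j))" if "i < n" "j < n" for i j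
    using that assms C by (simp add: scalar_prod_def atLeast0LessThan)
  have "(B ^\<^sub>m Suc k) $$ (i, j) = 0" if "j < i" "i < n" for i j
    unfolding ent[OF that(2) less_trans[OF that]]
    by (rule sum.neutral) (use that z in \<open>metis lessThan_iff linorder_neqE_nat mult_eq_0_iff less_trans\<close>)
  moreover have "(B ^\<^sub>m Suc k) $$ (i, i) = B $$ (i, i) ^ Suc k" if "i < n" for i
  proof -
    have "(\<Sum>l<n. (B ^\<^sub>m k) $$ (i, l) * B $$ (l, i)) = (\<Sum>l\<in>{i}. (B ^\<^sub>m k) $$ (i, l) * B $$ (l, i))"
      by (rule sum.mono_neutral_right) (use that z in \<open>auto, metis linorder_neqE_nat\<close>)
    then show ?thesis using ent[OF that that] Suc that by simp
  qed
  ultimately show ?case using assms by (auto simp: upper_triangular_def)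
qed

lemma mat_trace_power:
  fixes A :: "complex mat"
  assumes A: "A \<in> carrier_mat n n" and as: "char_poly A = (\<Prod>a\<leftarrow>as. [:- a, 1:])"
  shows "mat_trace (A ^\<^sub>m k) = (\<Sum>a\<leftarrow>as. a ^ k)"
proof -
  obtain B P Q where sd: "schur_decomposition A as = (B, P, Q)" by (metis prod_cases3)
  note sd = schur_decomposition[OF A as sd]
  have wit: "similar_mat_wit A B P Q" and ut: "upper_triangular B" and diag: "diag_mat B = as"
    using sd by auto
  have C: "B \<in> carrier_mat n n" "P \<in> carrier_mat n n" "Q \<in> carrier_mat n n" "Q * P = 1\<^sub>m n"
    using similar_mat_witD2[OF A wit] by auto
  have Bk: "B ^\<^sub>m k \<in> carrier_mat n n" using C by simp
  have "mat_trace (A ^\<^sub>m k) = mat_trace (P * (B ^\<^sub>m k * Q))"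
    unfolding similar_mat_wit_pow_id[OF wit] using C Bk by (simp add: assoc_mult_mat[of _ n n _ n _ n])
  also have "\<dots> = mat_trace (B ^\<^sub>m k * Q * P)"
    using C Bk by (intro mat_trace_commute[of _ n n]) auto
  also have "B ^\<^sub>m k * Q * P = B ^\<^sub>m k"
    using C Bk by (simp add: assoc_mult_mat[of _ n n _ n _ n])
  also have "mat_trace (B ^\<^sub>m k) = (\<Sum>i<n. B $$ (i, i) ^ k)"
    using upper_triangular_power[OF C(1) ut, of k] C(1) by (simp add: mat_trace_def)
  also have "\<dots> = (\<Sum>a\<leftarrow>as. a ^ k)"
    using C unfolding diag[symmetric] diag_mat_def
    by (simp add: comp_def atLeast0LessThan interv_sum_list_conv_sum_set_nat)
  finally show ?thesis .
qed

lemma mat_trace_power_cong: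
  fixes A B :: "complex mat"
  assumes "A \<in> carrier_mat n n" "B \<in> carrier_mat n n" "char_poly A = char_poly B"
  shows "mat_trace (A ^\<^sub>m k) = mat_trace (B ^\<^sub>m k)"
proof -
  obtain as where "char_poly A = (\<Prod>a\<leftarrow>as. [:- a, 1:])"
    using char_poly_factorized[OF assms(1)] by blast
  then show ?thesis using mat_trace_power assms by metis
qed

definition adj :: "nat set set \<Rightarrow> nat \<Rightarrow> nat \<Rightarrow> int" where
  "adj E i j = (if {i, j} \<in> E then 1 else 0)"
definition deg :: "nat set set \<Rightarrow> nat \<Rightarrow> int" where
  "deg E i = int (vertex_degree E i)"
text \<open>The number of common neighbours, an entry of the square of the adjacency matrix.\<close>

definition codeg :: "nat \<Rightarrow> nat set set \<Rightarrow> nat \<Rightarrow> nat \<Rightarrow> int" where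
  "codeg n E i j = (\<Sum>k<n. adj E i k * adj E k j)"
definition degsum :: "nat \<Rightarrow> nat set set \<Rightarrow> nat \<Rightarrow> int" where
  "degsum n E k = (\<Sum>i<n. deg E i ^ k)"

lemma adj_sym: "adj E i j = adj E j i" by (simp add: adj_def insert_commute)

lemma adj_sq: "adj E i j * adj E i j = adj E i j" by (simp add: adj_def)

lemma adj_self: "E \<in> simple_graphs n \<Longrightarrow> adj E i i = 0"
  using simple_graphs_doubleton(3)[of E n i i] by (auto simp: adj_def)

lemma sum_adj: "E \<in> simple_graphs n \<Longrightarrow> (\<Sum>j<n. adj E i j) = deg E i"
  by (simp add: adj_def deg_def vertex_degree_neighbours sum.If_cases Int_def)

lemma codeg_sym: "codeg n E i j = codeg n E j i"
  unfolding codeg_def by (rule sum.cong) (auto simp: adj_sym mult.commute)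

lemma codeg_self: "E \<in> simple_graphs n \<Longrightarrow> codeg n E i i = deg E i"
  unfolding codeg_def by (subst adj_sym) (simp add: adj_sq adj_sym[of E _ i] sum_adj)

lemma codeg_nonneg: "codeg n E i j \<ge> 0"
  unfolding codeg_def by (rule sum_nonneg) (simp add: adj_def)

lemma sum_codeg:
  assumes E: "E \<in> simple_graphs n"
  shows "(\<Sum>i<n. \<Sum>j<n. codeg n E i j) = degsum n E 2"
proof -
  have "(\<Sum>i<n. \<Sum>j<n. codeg n E i j) = (\<Sum>i<n. \<Sum>k<n. \<Sum>j<n. adj E i k * adj E k j)"
    unfolding codeg_def by (rule sum.cong[OF refl]) (rule sum.swap)
  also have "\<dots> = (\<Sum>k<n. \<Sum>i<n. adj E i k * deg E k)"
    by (subst sum.swap) (simp add: sum_distrib_left[symmetric] sum_adj[OF E])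
  also have "\<dots> = (\<Sum>k<n. (\<Sum>i<n. adj E k i) * deg E k)"
    by (simp add: sum_distrib_right adj_sym)
  finally show ?thesis by (simp add: sum_adj[OF E] degsum_def power2_eq_square)
qed

definition lap :: "nat set set \<Rightarrow> nat \<Rightarrow> nat \<Rightarrow> int" where
  "lap E i j = (if i = j then deg E i else 0) + adj E i j"

lemma signless_laplacian_lap:
  "signless_laplacian n E = mat n n (\<lambda>(i, j). of_int (lap E i j))"
  by (rule eq_matI) (auto simp: signless_laplacian_def degree_matrix_def adjacency_matrix_def lap_def adj_def deg_def)

definition lap2 :: "nat \<Rightarrow> nat set set \<Rightarrow> nat \<Rightarrow> nat \<Rightarrow> int" where
  "lap2 n E i j = (\<Sum>k<n. lap E i k * lap E k j)"

lemma lap2: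
  assumes E: "E \<in> simple_graphs n" and ij: "i < n" "j < n"
  shows "lap2 n E i j = (if i = j then deg E i ^ 2 + deg E i else (deg E i + deg E j) * adj E i j + codeg n E i j)"
proof -
  have "lap2 n E i j = (\<Sum>k<n. (if i = k then deg E i * (if k = j then deg E k else 0) else 0)
      + (if i = k then deg E i * adj E k j else 0) + (if k = j then adj E i k * deg E k else 0) + adj E i k * adj E k j)"
    unfolding lap2_def lap_def by (rule sum.cong) (auto simp: algebra_simps)
  also have "\<dots> = deg E i * (if i = j then deg E i else 0) + deg E i * adj E i j + adj E i j * deg E j + codeg n E i j"
    using ij by (simp add: sum.distrib codeg_def)
  finally show ?thesis
    by (auto simp: codeg_self[OF E] adj_self[OF E] power2_eq_square algebra_simps)
qed

lemma traces:
  fixes n E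
  defines "Q \<equiv> signless_laplacian n E"
  shows "mat_trace (Q ^\<^sub>m 1) = of_int (\<Sum>i<n. lap E i i)"
    "mat_trace (Q ^\<^sub>m 2) = of_int (\<Sum>i<n. lap2 n E i i)"
    "mat_trace (Q ^\<^sub>m 3) = of_int (\<Sum>i<n. \<Sum>j<n. lap2 n E i j * lap E j i)"
    "mat_trace (Q ^\<^sub>m 4) = of_int (\<Sum>i<n. \<Sum>j<n. lap2 n E i j * lap2 n E j i)"
proof -
  have Q0: "Q \<in> carrier_mat n n" by (simp add: Q_def)
  note Q = Q0 mult_carrier_mat[OF Q0 Q0]
  have Q1: "Q $$ (i, j) = of_int (lap E i j)" if "i < n" "j < n" for i j
    using that by (simp add: Q_def signless_laplacian_lap)
  have Q2: "(Q * Q) $$ (i, j) = of_int (lap2 n E i j)" if "i < n" "j < n" for i j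
    using that Q by (simp add: scalar_prod_def Q1 lap2_def atLeast0LessThan)
  have me: "(A * B) $$ (i, j) = (\<Sum>k<n. A $$ (i, k) * B $$ (k, j))"
    if "A \<in> carrier_mat n n" "B \<in> carrier_mat n n" "i < n" "j < n" for A B :: "complex mat" and i j
    using that by (simp add: scalar_prod_def atLeast0LessThan)
  have p: "Q ^\<^sub>m 1 = Q" "Q ^\<^sub>m 2 = Q * Q" "Q ^\<^sub>m 3 = Q * Q * Q" "Q ^\<^sub>m 4 = (Q * Q) * (Q * Q)"
    using Q by (simp_all add: numeral_eq_Suc left_mult_one_mat[of _ n n] assoc_mult_mat[of _ n n _ n _ n])
  show "mat_trace (Q ^\<^sub>m 1) = of_int (\<Sum>i<n. lap E i i)"
    unfolding p using Q by (simp add: mat_trace_def Q1)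
  show "mat_trace (Q ^\<^sub>m 2) = of_int (\<Sum>i<n. lap2 n E i i)"
    unfolding p mat_trace_def using Q by (simp add: Q2 del: index_mult_mat(1))
  show "mat_trace (Q ^\<^sub>m 3) = of_int (\<Sum>i<n. \<Sum>j<n. lap2 n E i j * lap E j i)"
  proof -
    have d: "dim_row (Q * Q * Q) = n" using Q by simp
    have "(Q * Q * Q) $$ (i, i) = of_int (\<Sum>j<n. lap2 n E i j * lap E j i)" if "i < n" for i
      unfolding me[OF Q(2) Q(1) that that] using that by (simp add: Q1 Q2 del: index_mult_mat(1))
    then show ?thesis
      unfolding p mat_trace_def d by (subst of_int_sum) (rule sum.cong, auto simp del: of_int_sum assoc_mult_mat index_mult_mat(1))
  qed
  show "mat_trace (Q ^\<^sub>m 4) = of_int (\<Sum>i<n. \<Sum>j<n. lap2 n E i j * lap2 n E j i)"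
    unfolding p mat_trace_def index_mult_mat(2) using Q
    by (simp add: me[OF Q(2) Q(2)] Q2 del: index_mult_mat(1))
qed

text \<open>
  Being a product of consecutive integers, the weight in \<open>edge_defect\<close> is nonnegative, and it vanishes
  exactly when the degrees along the edge sum to 4 or 5.
\<close>

definition edge_defect :: "nat \<Rightarrow> nat set set \<Rightarrow> int" where
  "edge_defect n E = (\<Sum>i<n. \<Sum>j<n. adj E i j * ((deg E i + deg E j - 4) * (deg E i + deg E j - 5)))"
text \<open>The trace of the cube of the adjacency matrix, six times the number of
  triangles.\<close>

definition triangle_count :: "nat \<Rightarrow> nat set set \<Rightarrow> int" where
  "triangle_count n E = (\<Sum>i<n. \<Sum>j<n. adj E i j * codeg n E i j)"
definition triangle_defect :: "nat \<Rightarrow> nat set set \<Rightarrow> int" where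
  "triangle_defect n E = (\<Sum>i<n. \<Sum>j<n. (deg E i + deg E j) * adj E i j * codeg n E i j)"
text \<open>Eight times the number of 4-cycles: ordered pairs of distinct vertices together with an
  ordered pair of distinct common neighbours.\<close>

definition square_defect :: "nat \<Rightarrow> nat set set \<Rightarrow> int" where
  "square_defect n E = (\<Sum>i<n. \<Sum>j<n. if i = j then 0 else codeg n E i j ^ 2 - codeg n E i j)"

lemma sum_adj_deg:
  assumes E: "E \<in> simple_graphs n"
  shows "(\<Sum>i<n. \<Sum>j<n. adj E i j * f i) = (\<Sum>i<n. deg E i * f i)"
    "(\<Sum>i<n. \<Sum>j<n. adj E i j * f j) = (\<Sum>i<n. deg E i * f i)"
proof -
  show 1: "(\<Sum>i<n. \<Sum>j<n. adj E i j * f i) = (\<Sum>i<n. deg E i * f i)"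
    by (simp add: sum_distrib_right[symmetric] sum_adj[OF E])
  have "(\<Sum>i<n. \<Sum>j<n. adj E i j * f j) = (\<Sum>i<n. \<Sum>j<n. adj E i j * f i)"
    by (subst sum.swap) (simp add: adj_sym)
  then show "(\<Sum>i<n. \<Sum>j<n. adj E i j * f j) = (\<Sum>i<n. deg E i * f i)" using 1 by simp
qed

text \<open>The traces are arranged so that, besides power sums of the degrees, only nonnegative
  terms with simple conditions for vanishing occur.\<close>

lemma trace_formulas:
  assumes E: "E \<in> simple_graphs n"
  defines "p \<equiv> degsum n E"
  shows "(\<Sum>i<n. lap E i i) = p 1"
    "(\<Sum>i<n. lap2 n E i i) = p 2 + p 1"
    "(\<Sum>i<n. \<Sum>j<n. lap2 n E i j * lap E j i) = p 3 + 3 * p 2 + triangle_count n E"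
    "(\<Sum>i<n. \<Sum>j<n. lap2 n E i j * lap2 n E j i) = p 4 + 2 * p 3 + 20 * p 2 - 21 * p 1
       + edge_defect n E + 2 * triangle_defect n E + square_defect n E"
proof -
  let ?d = "deg E" and ?a = "adj E" and ?c = "codeg n E"
  have loop: "{i} \<notin> E" for i using simple_graphs_doubleton(3)[OF E, of i i] by auto
  show "(\<Sum>i<n. lap E i i) = p 1" by (simp add: lap_def adj_self[OF E] p_def degsum_def)
  show "(\<Sum>i<n. lap2 n E i i) = p 2 + p 1"
    by (simp add: lap2[OF E] p_def degsum_def sum.distrib)
  have "(\<Sum>i<n. \<Sum>j<n. lap2 n E i j * lap E j i)
      = (\<Sum>i<n. \<Sum>j<n. (if i = j then (?d i ^ 2 + ?d i) * ?d i else 0) + ?a i j * ?d i + ?a i j * ?d j + ?a i j * ?c i j)"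
    by (intro sum.cong refl)
       (auto simp: lap2[OF E] lap_def loop adj_def insert_commute algebra_simps)
  also have "\<dots> = p 3 + 3 * p 2 + triangle_count n E"
    unfolding sum.distrib sum_adj_deg[OF E] triangle_count_def p_def degsum_def
    by (simp add: sum.distrib ring_normal)
  finally show "(\<Sum>i<n. \<Sum>j<n. lap2 n E i j * lap E j i) = p 3 + 3 * p 2 + triangle_count n E" .
  \<comment> \<open>For the sum \<open>s\<close> of two degrees,
    \<open>s^2 = (s - 4) * (s - 5) + 9 * s - 20\<close> isolates the edge defect, and the square of
    \<open>?c i j\<close> is split as \<open>?c i j ^ 2 - ?c i j\<close> plus \<open>?c i j\<close>.
    The \<open>- ?d i\<close> on the diagonal compensates for \<open>?c i i\<close>.\<close>
  have e: "lap2 n E i j * lap2 n E j i = (if i = j then (?d i ^ 2 + ?d i) ^ 2 - ?d i else 0)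
     + ?a i j * ((?d i + ?d j - 4) * (?d i + ?d j - 5)) + 9 * (?a i j * ?d i) + 9 * (?a i j * ?d j) - 20 * (?a i j * 1)
     + 2 * ((?d i + ?d j) * ?a i j * ?c i j) + (if i = j then 0 else ?c i j ^ 2 - ?c i j) + ?c i j"
    if "i < n" "j < n" for i j
  proof (cases "i = j")
    case True
    then show ?thesis using that
      by (simp add: lap2[OF E] adj_self[OF E] codeg_self[OF E] power2_eq_square)
  next
    case False
    then have "lap2 n E i j * lap2 n E j i = ((?d i + ?d j) * ?a i j + ?c i j) ^ 2"
      using that by (simp add: lap2[OF E] adj_sym[of E j i] codeg_sym[of n E j i] power2_eq_square add.commute)
    then show ?thesis using False by (auto simp: adj_def algebra_simps power2_eq_square)
  qed
  have q: "(\<Sum>i<n. \<Sum>j<n. if i = j then (?d i ^ 2 + ?d i) ^ 2 - ?d i else 0) = p 4 + 2 * p 3 + p 2 - p 1"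
    by (simp add: p_def degsum_def sum.distrib sum_subtractf sum_distrib_left
        ring_normal)
  have r: "(\<Sum>i<n. \<Sum>j<n. ?a i j * ?d i) = p 2" "(\<Sum>i<n. \<Sum>j<n. ?a i j * ?d j) = p 2"
    "(\<Sum>i<n. \<Sum>j<n. ?a i j * 1) = p 1"
    unfolding sum_adj_deg[OF E] by (simp_all add: p_def degsum_def power2_eq_square sum_adj[OF E])
  have "(\<Sum>i<n. \<Sum>j<n. lap2 n E i j * lap2 n E j i) = (\<Sum>i<n. \<Sum>j<n. (if i = j then (?d i ^ 2 + ?d i) ^ 2 - ?d i else 0)
     + ?a i j * ((?d i + ?d j - 4) * (?d i + ?d j - 5)) + 9 * (?a i j * ?d i) + 9 * (?a i j * ?d j) - 20 * (?a i j * 1)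
     + 2 * ((?d i + ?d j) * ?a i j * ?c i j) + (if i = j then 0 else ?c i j ^ 2 - ?c i j) + ?c i j)"
    by (intro sum.cong refl e) auto
  also have "\<dots> = (\<Sum>i<n. \<Sum>j<n. if i = j then (?d i ^ 2 + ?d i) ^ 2 - ?d i else 0) + edge_defect n E
      + 9 * (\<Sum>i<n. \<Sum>j<n. ?a i j * ?d i) + 9 * (\<Sum>i<n. \<Sum>j<n. ?a i j * ?d j) - 20 * (\<Sum>i<n. \<Sum>j<n. ?a i j * 1)
      + 2 * triangle_defect n E + square_defect n E + (\<Sum>i<n. \<Sum>j<n. ?c i j)"
    unfolding edge_defect_def triangle_defect_def square_defect_def sum_distrib_left
    by (simp only: sum.distrib sum_subtractf)
  also have "\<dots> = (p 4 + 2 * p 3 + p 2 - p 1) + edge_defect n E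
      + 9 * p 2 + 9 * p 2 - 20 * p 1 + 2 * triangle_defect n E + square_defect n E + p 2"
    unfolding q r sum_codeg[OF E] by (simp add: p_def)
  finally have "(\<Sum>i<n. \<Sum>j<n. lap2 n E i j * lap2 n E j i) = (p 4 + 2 * p 3 + p 2 - p 1) + edge_defect n E
      + 9 * p 2 + 9 * p 2 - 20 * p 1 + 2 * triangle_defect n E + square_defect n E + p 2" .
  then show "(\<Sum>i<n. \<Sum>j<n. lap2 n E i j * lap2 n E j i) = p 4 + 2 * p 3 + 20 * p 2 - 21 * p 1
       + edge_defect n E + 2 * triangle_defect n E + square_defect n E" by simp
qed

lemma defects_nonneg:
  "edge_defect n E \<ge> 0" "triangle_count n E \<ge> 0" "triangle_defect n E \<ge> 0" "square_defect n E \<ge> 0"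
proof -
  have prod: "(x - 4) * (x - 5) \<ge> 0" for x :: int
    by (cases "x \<le> 4") (auto intro: mult_nonpos_nonpos mult_nonneg_nonneg)
  have sq: "x \<le> x ^ 2" if "x \<ge> 0" for x :: int
    using that by (cases "x = 0") (auto simp: power2_eq_square)
  show "edge_defect n E \<ge> 0" unfolding edge_defect_def
    by (intro sum_nonneg mult_nonneg_nonneg prod) (simp add: adj_def)
  show "triangle_count n E \<ge> 0" unfolding triangle_count_def
    by (intro sum_nonneg mult_nonneg_nonneg codeg_nonneg) (simp add: adj_def)
  show "triangle_defect n E \<ge> 0" unfolding triangle_defect_def
    by (intro sum_nonneg mult_nonneg_nonneg codeg_nonneg add_nonneg_nonneg) (simp_all add: adj_def deg_def)
  show "square_defect n E \<ge> 0" unfolding square_defect_def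
    by (intro sum_nonneg) (simp add: sq codeg_nonneg)
qed

lemma edge_defect_eq_0:
  assumes E: "E \<in> simple_graphs n" and z: "edge_defect n E = 0" and e: "{i, j} \<in> E"
  shows "deg E i + deg E j \<in> {4, 5}"
proof -
  have prod: "(x - 4) * (x - 5) \<ge> 0" for x :: int
    by (cases "x \<le> 4") (auto intro: mult_nonpos_nonpos mult_nonneg_nonneg)
  have nn: "adj E i j * ((deg E i + deg E j - 4) * (deg E i + deg E j - 5)) \<ge> 0" for i j
    by (intro mult_nonneg_nonneg prod) (simp add: adj_def)
  have ij: "i < n" "j < n" using simple_graphs_doubleton[OF E e] by auto
  have "(\<Sum>j<n. adj E i j * ((deg E i + deg E j - 4) * (deg E i + deg E j - 5))) = 0"
    using z ij unfolding edge_defect_def by (subst (asm) sum_nonneg_eq_0_iff) (auto intro!: sum_nonneg nn)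
  then have "adj E i j * ((deg E i + deg E j - 4) * (deg E i + deg E j - 5)) = 0"
    using ij by (subst (asm) sum_nonneg_eq_0_iff) (auto intro!: nn)
  then show ?thesis using e by (auto simp: adj_def)
qed

text \<open>The case of equality in all the estimates behind
  \<open>cospectral_extremal\<close>.\<close>

definition extremal_graph :: "nat \<Rightarrow> nat set set \<Rightarrow> bool" where
  "extremal_graph n E \<longleftrightarrow> (\<forall>i<n. deg E i \<in> {1, 2, 3}) \<and> edge_defect n E = 0 \<and> triangle_count n E = 0 \<and>
     triangle_defect n E = 0 \<and> square_defect n E = 0"

text \<open>On integers \<open>d \<ge> 1\<close> the product
  \<open>(d - 1) * (d - 2) * (d - 3)\<close> is nonnegative and vanishes only at 1, 2 and 3, so this
  combination of power sums detects such degrees.\<close>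

lemma cubic_sum: "(\<Sum>i<n. (deg E i - 1) * (deg E i - 2) * (deg E i - 3))
    = degsum n E 3 - 6 * degsum n E 2 + 11 * degsum n E 1 - 6 * int n"
proof -
  have "(\<Sum>i<n. (deg E i - 1) * (deg E i - 2) * (deg E i - 3)) = (\<Sum>i<n. deg E i ^ 3 - 6 * deg E i ^ 2 + 11 * deg E i ^ 1 - 6)"
    by (rule sum.cong) (auto simp: ring_normal)
  then show ?thesis by (simp add: degsum_def sum.distrib sum_subtractf sum_distrib_left)
qed

text \<open>\<open>d * (d - 1) * (d - 2) * (d - 3) = 0\<close> expresses the fourth power of such a
  degree by lower ones.\<close>

lemma quartic_sum:
  assumes "\<forall>i<n. deg E i \<in> {1, 2, 3}"
  shows "degsum n E 4 = 6 * degsum n E 3 - 11 * degsum n E 2 + 6 * degsum n E 1"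
proof -
  have "degsum n E 4 = (\<Sum>i<n. 6 * deg E i ^ 3 - 11 * deg E i ^ 2 + 6 * deg E i ^ 1)"
    unfolding degsum_def by (rule sum.cong) (use assms in auto)
  then show ?thesis by (simp add: degsum_def sum.distrib sum_subtractf sum_distrib_left)
qed

text \<open>The first two traces fix the power sums 1 and 2. The third then says that the cubic sum
  of \<open>F\<close> plus its triangle count is 0, as for \<open>E\<close>; both are nonnegative,
  so both vanish, and the degrees follow. Now the power sums 3 and 4 agree as well, and in the same
  way the fourth trace makes the edge defect of \<open>F\<close> vanish.\<close>

lemma cospectral_extremal:
  assumes E: "E \<in> simple_graphs n" and F: "F \<in> simple_graphs n"
    and cp: "cpoly n F = cpoly n E"
    and ext: "extremal_graph n E" and pos: "\<And>i. i < n \<Longrightarrow> deg F i \<ge> 1"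
  shows "\<forall>i<n. deg F i \<in> {1, 2, 3}" "\<And>i j. {i, j} \<in> F \<Longrightarrow> deg F i + deg F j \<in> {4, 5}"
    "degsum n F 1 = degsum n E 1" "degsum n F 2 = degsum n E 2"
proof -
  have tr: "mat_trace (signless_laplacian n F ^\<^sub>m k) = mat_trace (signless_laplacian n E ^\<^sub>m k)" for k
    by (rule mat_trace_power_cong[where n = n]) (use cp in auto)
  note T = tr[of 1, unfolded traces of_int_eq_iff trace_formulas[OF E] trace_formulas[OF F]]
    tr[of 2, unfolded traces of_int_eq_iff trace_formulas[OF E] trace_formulas[OF F]]
    tr[of 3, unfolded traces of_int_eq_iff trace_formulas[OF E] trace_formulas[OF F]]
    tr[of 4, unfolded traces of_int_eq_iff trace_formulas[OF E] trace_formulas[OF F]]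
  show p1: "degsum n F 1 = degsum n E 1" and p2: "degsum n F 2 = degsum n E 2" using T by auto
  have dE: "\<forall>i<n. deg E i \<in> {1, 2, 3}" using ext by (simp add: extremal_graph_def)
  then have cE: "(\<Sum>i<n. (deg E i - 1) * (deg E i - 2) * (deg E i - 3)) = 0"
    by (intro sum.neutral) auto
  have nn: "(deg F i - 1) * (deg F i - 2) * (deg F i - 3) \<ge> 0" if i: "i < n" for i
  proof -
    consider "deg F i = 1" | "deg F i = 2" | "deg F i \<ge> 3" using pos[OF i] by linarith
    then show ?thesis by cases simp_all
  qed
  have "(\<Sum>i<n. (deg F i - 1) * (deg F i - 2) * (deg F i - 3)) + triangle_count n F = 0"
    using T(3) p1 p2 cE ext unfolding cubic_sum extremal_graph_def by simp
  moreover have "(\<Sum>i<n. (deg F i - 1) * (deg F i - 2) * (deg F i - 3)) \<ge> 0"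
    by (rule sum_nonneg) (use nn in auto)
  ultimately have cF: "(\<Sum>i<n. (deg F i - 1) * (deg F i - 2) * (deg F i - 3)) = 0" and "triangle_count n F = 0"
    using defects_nonneg(2)[of n F] by linarith+
  then have "\<forall>i\<in>{..<n}. (deg F i - 1) * (deg F i - 2) * (deg F i - 3) = 0"
    using nn by (subst (asm) sum_nonneg_eq_0_iff) auto
  then show dF: "\<forall>i<n. deg F i \<in> {1, 2, 3}" by auto
  have p3: "degsum n F 3 = degsum n E 3" using cE cF p1 p2 unfolding cubic_sum by simp
  have "edge_defect n F + 2 * triangle_defect n F + square_defect n F = 0"
    using T(4) p1 p2 p3 ext unfolding quartic_sum[OF dE] quartic_sum[OF dF] extremal_graph_def by simp
  then have "edge_defect n F = 0" using defects_nonneg[of n F] by linarith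
  then show "\<And>i j. {i, j} \<in> F \<Longrightarrow> deg F i + deg F j \<in> {4, 5}"
    using edge_defect_eq_0[OF F] by blast
qed

text \<open>At \<open>x = 0\<close> an isolated vertex has a zero row.\<close>

lemma no_isolated_vertex:
  assumes E: "E \<in> simple_graphs n" and P: "poly (cpoly n E) 0 \<noteq> 0" and i: "i < n"
  shows "deg E i \<ge> 1"
proof (rule ccontr)
  assume "\<not> deg E i \<ge> 1"
  then have d: "vertex_degree E i = 0" by (simp add: deg_def)
  have "finite {u. u < n \<and> {i, u} \<in> E}" by simp
  then have nb: "{i, u} \<notin> E" for u
    using d simple_graphs_doubleton(2)[OF E] unfolding vertex_degree_neighbours[OF E] by auto
  let ?M = "mat n n (\<lambda>(i, j). lap_entry E (0::complex) i j)"
  have "det ?M = (\<Sum>j<n. ?M $$ (i, j) * cofactor ?M i j)"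
    by (rule laplace_expansion_row) (use i in auto)
  also have "\<dots> = 0"
    by (rule sum.neutral) (use i d nb in \<open>auto simp: lap_entry_def\<close>)
  finally show False using P poly_char_poly_signless_laplacian[OF E] by simp
qed

text \<open>At \<open>x = 1\<close> the diagonal entry of a leaf is 0 and its row is nonzero only at
  its neighbour, so two leaves at the same vertex have equal rows.\<close>

lemma no_twin_leaves:
  assumes E: "E \<in> simple_graphs n" and P: "poly (cpoly n E) 1 \<noteq> 0"
    and leaf: "deg E u = 1" "deg E v = 1" and e: "{u, x} \<in> E" "{v, x} \<in> E"
  shows "u = v"
proof (rule ccontr)
  assume ne: "u \<noteq> v"
  have lt: "u < n" "v < n" "x < n" "u \<noteq> x" "v \<noteq> x"
    using simple_graphs_doubleton[OF E e(1)] simple_graphs_doubleton[OF E e(2)] by auto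
  have nb: "{w, y} \<in> E \<longleftrightarrow> y = x" if "deg E w = 1" "{w, x} \<in> E" for w y
  proof -
    have "card {u. u < n \<and> {w, u} \<in> E} = 1"
      using that by (simp add: deg_def vertex_degree_neighbours[OF E])
    moreover have "x \<in> {u. u < n \<and> {w, u} \<in> E}" using that lt by simp
    ultimately have "{u. u < n \<and> {w, u} \<in> E} = {x}" by (metis card_1_singletonE singletonD)
    then show ?thesis using simple_graphs_doubleton(2)[OF E, of w y] by auto
  qed
  let ?M = "mat n n (\<lambda>(i, j). lap_entry E (1::complex) i j)"
  have "vertex_degree E u = 1" "vertex_degree E v = 1" using leaf by (auto simp: deg_def)
  then have "row ?M u = row ?M v" using lt nb[OF leaf(1) e(1)] nb[OF leaf(2) e(2)]
    by (intro eq_vecI) (auto simp: lap_entry_def)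
  then have "det ?M = 0" by (intro det_identical_rows[of _ n u v]) (use ne lt in auto)
  then show False using P poly_char_poly_signless_laplacian[OF E] by simp
qed

section \<open>The structure of a cospectral mate\<close>

text \<open>
  Removing the leaves leaves a graph all of whose degrees are 2. Walking along it from any of its
  edges, never turning back, traces out the cycle of a sun.
\<close>

locale sunlike =
  fixes n :: nat and E :: "nat set set"
  assumes E: "E \<in> simple_graphs n"
    and deg_cases: "\<And>i. i < n \<Longrightarrow> deg E i \<in> {1, 2, 3}"
    and deg_edge: "\<And>i j. {i, j} \<in> E \<Longrightarrow> deg E i + deg E j \<in> {4, 5}"
    and deg_sum: "degsum n E 1 = 2 * int n"
    and no_twins: "\<And>u v x. deg E u = 1 \<Longrightarrow> deg E v = 1 \<Longrightarrow> {u, x} \<in> E \<Longrightarrow> {v, x} \<in> E \<Longrightarrow> u = v"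
    and nonempty: "n > 0"
begin

definition nbrs :: "nat \<Rightarrow> nat set" where "nbrs v = {u. u < n \<and> {v, u} \<in> E}"

lemma card_nbrs: "int (card (nbrs v)) = deg E v"
  by (simp add: nbrs_def deg_def vertex_degree_neighbours[OF E])

lemma finite_nbrs: "finite (nbrs v)" by (simp add: nbrs_def)

lemma nbrs_sym: "u \<in> nbrs v \<longleftrightarrow> v \<in> nbrs u"
  using simple_graphs_doubleton[OF E] by (auto simp: nbrs_def insert_commute)

lemma nbrs_edge: "u \<in> nbrs v \<longleftrightarrow> {v, u} \<in> E"
  using simple_graphs_doubleton[OF E] by (auto simp: nbrs_def)

lemma nbrs_less: "u \<in> nbrs v \<Longrightarrow> u < n \<and> v < n \<and> u \<noteq> v"
  using simple_graphs_doubleton[OF E, of v u] unfolding nbrs_def by blast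

lemma deg_nbrs: "u \<in> nbrs v \<Longrightarrow> deg E v + deg E u \<in> {4, 5}"
  using deg_edge by (auto simp: nbrs_def)

section \<open>Leaves and branching vertices\<close>

definition leaves :: "nat set" where "leaves = {v. v < n \<and> deg E v = 1}"
definition branching :: "nat set" where "branching = {v. v < n \<and> deg E v = 3}"
definition support :: "nat \<Rightarrow> nat" where "support v = (THE u. u \<in> nbrs v)"

text \<open>Degrees along an edge sum to at least 4, so the neighbour of a leaf has degree
  3.\<close>

lemma support:
  assumes "v \<in> leaves"
  shows "nbrs v = {support v}" "support v \<in> branching"
proof -
  have "card (nbrs v) = 1" using assms card_nbrs[of v] by (simp add: leaves_def)
  then obtain u where u: "nbrs v = {u}" by (rule card_1_singletonE)
  then show s: "nbrs v = {support v}" by (simp add: support_def)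
  have "support v \<in> nbrs v" using s by simp
  then show "support v \<in> branching"
    using deg_nbrs[of "support v" v] nbrs_less[of "support v" v] deg_cases[of "support v"] assms
    by (auto simp: branching_def leaves_def)
qed

text \<open>Without twins \<open>support\<close> is injective, and the mean degree 2 forces as many
  vertices of degree 3 as of degree 1, so it is onto.\<close>

lemma bij_support: "bij_betw support leaves branching"
proof -
  have inj: "inj_on support leaves"
  proof (rule inj_onI)
    fix u v assume uv: "u \<in> leaves" "v \<in> leaves" "support u = support v"
    then have "support u \<in> nbrs u" "support u \<in> nbrs v" using support by auto
    then show "u = v" using no_twins[of u v "support u"] uv by (auto simp: nbrs_edge leaves_def)
  qed
  have sub: "support ` leaves \<subseteq> branching" using support by blast
  have "(\<Sum>i<n. deg E i - 2) = 0" using deg_sum by (simp add: sum_subtractf degsum_def)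
  also have "(\<Sum>i<n. deg E i - 2) = (\<Sum>i<n. (if i \<in> branching then 1 else 0) - (if i \<in> leaves then 1 else 0))"
    by (rule sum.cong) (use deg_cases in \<open>force simp: branching_def leaves_def\<close>)+
  also have "\<dots> = int (card ({..<n} \<inter> branching)) - int (card ({..<n} \<inter> leaves))"
    by (simp add: sum_subtractf sum.If_cases Int_def)
  also have "{..<n} \<inter> branching = branching" by (auto simp: branching_def)
  also have "{..<n} \<inter> leaves = leaves" by (auto simp: leaves_def)
  finally have "card branching = card leaves" by simp
  moreover have "finite branching" by (simp add: branching_def)
  ultimately have "support ` leaves = branching"
    using card_image[OF inj] card_subset_eq[OF _ sub] by simp
  then show ?thesis using inj by (simp add: bij_betw_def)
qed

section \<open>The core and the walk around one of its cycles\<close>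

definition core :: "nat set" where "core = {v. v < n \<and> deg E v \<noteq> 1}"
definition core_nbrs :: "nat \<Rightarrow> nat set" where "core_nbrs v = nbrs v \<inter> core"
definition leaf_at :: "nat \<Rightarrow> nat" where "leaf_at = inv_into leaves support"

lemma leaf_at:
  assumes "v \<in> branching"
  shows "leaf_at v \<in> leaves" "support (leaf_at v) = v"
  using assms bij_support unfolding leaf_at_def
  by (auto simp: bij_betw_def inv_into_into f_inv_into_f)

lemma leaf_nbr:
  assumes "u \<in> nbrs v" "u \<in> leaves"
  shows "v \<in> branching" "u = leaf_at v"
proof -
  have v: "v = support u" using assms support(1)[OF assms(2)] nbrs_sym by blast
  then show "v \<in> branching" using support(2)[OF assms(2)] by simp
  then show "u = leaf_at v"
    using v assms(2) bij_support unfolding leaf_at_def by (simp add: bij_betw_def inv_into_f_f)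
qed

text \<open>A core vertex of degree 3 has exactly one leaf, by \<open>bij_support\<close>; one of
  degree 2 has none, since supports have degree 3.\<close>

lemma card_core_nbrs:
  assumes v: "v \<in> core"
  shows "card (core_nbrs v) = 2"
proof -
  have nb: "nbrs v - core = nbrs v \<inter> leaves" using nbrs_less by (auto simp: core_def leaves_def)
  have split: "card (nbrs v) = card (core_nbrs v) + card (nbrs v \<inter> leaves)"
  proof -
    have "nbrs v = (nbrs v \<inter> core) \<union> (nbrs v - core)" by blast
    then have "card (nbrs v) = card (nbrs v \<inter> core) + card (nbrs v - core)"
      using card_Un_disjoint[of "nbrs v \<inter> core" "nbrs v - core"] finite_nbrs[of v] by auto
    then show ?thesis unfolding nb core_nbrs_def .
  qed
  consider "deg E v = 2" | "v \<in> branching" using v deg_cases[of v] by (auto simp: core_def branching_def)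
  then show ?thesis
  proof cases
    case 1
    then have "nbrs v \<inter> leaves = {}" using leaf_nbr(1) by (auto simp: branching_def)
    then show ?thesis using split card_nbrs[of v] 1 by simp
  next
    case 2
    have "nbrs v \<inter> leaves = {leaf_at v}"
      using leaf_nbr(2) leaf_at[OF 2] support(1)[OF leaf_at(1)[OF 2]] nbrs_sym by auto
    moreover have "deg E v = 3" using 2 by (simp add: branching_def)
    ultimately show ?thesis using split card_nbrs[of v] by simp
  qed
qed

lemma core_nbrs_core: "u \<in> core_nbrs v \<Longrightarrow> u \<in> core"
  by (simp add: core_nbrs_def)

lemma core_nbrs_sym: "v \<in> core \<Longrightarrow> u \<in> core_nbrs v \<Longrightarrow> v \<in> core_nbrs u"
  using nbrs_sym by (auto simp: core_nbrs_def)

lemma core_nbrs_ne: "u \<in> core_nbrs v \<Longrightarrow> u \<noteq> v"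
  using nbrs_less by (auto simp: core_nbrs_def)

lemma core_nonempty: "core \<noteq> {}"
proof -
  have "0 < n" by (rule nonempty)
  show ?thesis
  proof (cases "0 \<in> leaves")
    case True
    then have "support 0 \<in> branching" by (rule support(2))
    then show ?thesis by (auto simp: branching_def core_def)
  next
    case False
    then have "0 \<in> core" using nonempty by (simp add: leaves_def core_def)
    then show ?thesis by blast
  qed
qed

definition other :: "nat \<Rightarrow> nat \<Rightarrow> nat" where "other v u = (THE w. w \<in> core_nbrs v \<and> w \<noteq> u)"

lemma other:
  assumes "v \<in> core" "u \<in> core_nbrs v"
  shows "core_nbrs v = {u, other v u}" "other v u \<noteq> u"
proof -
  obtain a b where ab: "core_nbrs v = {a, b}" "a \<noteq> b"
    using card_core_nbrs[OF assms(1)] by (auto simp: card_2_iff)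
  have "other v u = (if u = a then b else a)"
    unfolding other_def ab(1) using ab assms(2) by (intro the_equality) auto
  then show "core_nbrs v = {u, other v u}" "other v u \<noteq> u" using ab assms(2) by auto
qed

definition start :: nat where "start = (SOME v. v \<in> core)"
definition second :: nat where "second = (SOME u. u \<in> core_nbrs start)"

fun walk :: "nat \<Rightarrow> nat" where
  "walk 0 = start"
| "walk (Suc 0) = second"
| "walk (Suc (Suc k)) = other (walk (Suc k)) (walk k)"

lemma start: "start \<in> core" "second \<in> core_nbrs start"
proof -
  show s: "start \<in> core" unfolding start_def using core_nonempty some_in_eq by blast
  have "core_nbrs start \<noteq> {}" using card_core_nbrs[OF s] by auto
  then show "second \<in> core_nbrs start" unfolding second_def using some_in_eq by blast
qed

lemma walk_step: "walk k \<in> core \<and> walk (Suc k) \<in> core_nbrs (walk k)"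
proof (induction k)
  case 0
  then show ?case using start by simp
next
  case (Suc k)
  then have c: "walk (Suc k) \<in> core" using core_nbrs_core by blast
  moreover have "walk k \<in> core_nbrs (walk (Suc k))" using Suc core_nbrs_sym by blast
  ultimately show ?case using other by auto
qed

lemma walk_nbrs: "core_nbrs (walk (Suc k)) = {walk k, walk (Suc (Suc k))}" "walk (Suc (Suc k)) \<noteq> walk k"
proof -
  have "walk (Suc k) \<in> core" "walk k \<in> core_nbrs (walk (Suc k))"
    using walk_step[of k] walk_step[of "Suc k"] core_nbrs_sym by auto
  then show "core_nbrs (walk (Suc k)) = {walk k, walk (Suc (Suc k))}" "walk (Suc (Suc k)) \<noteq> walk k"
    using other by auto
qed

lemma walk_Suc_ne: "walk (Suc k) \<noteq> walk k"
  using walk_step core_nbrs_ne by blast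

definition period :: nat where "period = (LEAST l. \<exists>j<l. walk l = walk j)"

lemma period_exists: "\<exists>l. \<exists>j<l. walk l = walk j"
proof -
  have "finite core" by (simp add: core_def)
  then have "\<not> inj walk"
    using walk_step by (metis finite_subset image_subsetI infinite_UNIV_nat finite_imageD)
  then obtain i j where "i \<noteq> j" "walk i = walk j" by (auto simp: inj_on_def)
  then show ?thesis by (metis linorder_neqE_nat)
qed

lemma walk_inj: "inj_on walk {..<period}"
proof (rule inj_onI)
  fix i j assume ij: "i \<in> {..<period}" "j \<in> {..<period}" "walk i = walk j"
  have "\<not> (\<exists>j<l. walk l = walk j)" if "l < period" for l
    using not_less_Least[of l] that unfolding period_def by blast
  then show "i = j" using ij by (metis lessThan_iff linorder_neqE_nat)
qed

lemma period_ge: "period \<ge> 3"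
proof -
  obtain j where j: "j < period" "walk period = walk j"
    using LeastI_ex[OF period_exists] unfolding period_def[symmetric] by blast
  show ?thesis
  proof (rule ccontr)
    assume "\<not> period \<ge> 3"
    then consider "period = 0" | "period = 1" | "period = 2" by linarith
    then show False
    proof cases
      case 2
      then show ?thesis using j walk_Suc_ne[of 0] by simp
    next
      case 3
      then have "j = 0 \<or> j = 1" "walk (Suc (Suc 0)) = walk j" using j by (auto simp: numeral_2_eq_2)
      then show ?thesis using walk_Suc_ne[of "Suc 0"] walk_nbrs(2)[of 0] by auto
    qed (use j in simp)
  qed
qed

text \<open>If the first repetition hit a later vertex than the start, its last step would come from
  one of the two core neighbours of that vertex, both already reached by the walk. Then a vertex
  would repeat earlier, or the walk would stand still or turn back.\<close>

lemma walk_period: "walk period = walk 0"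
proof -
  obtain j where j: "j < period" "walk period = walk j"
    using LeastI_ex[OF period_exists] unfolding period_def[symmetric] by blast
  obtain l where l: "period = Suc l" using period_ge by (cases period) auto
  have inj: "a = b" if "a < period" "b < period" "walk a = walk b" for a b
    using walk_inj that by (auto simp: inj_on_def)
  show ?thesis
  proof (cases j)
    case (Suc i)
    have "walk l \<in> core_nbrs (walk j)"
      using walk_step[of l] core_nbrs_sym[of "walk l" "walk period"] j unfolding l by simp
    then have "walk l = walk i \<or> walk l = walk (Suc j)" unfolding Suc walk_nbrs(1) by simp
    then show ?thesis
    proof
      assume "walk l = walk i"
      then have "l = i" using inj[of l i] l Suc j by simp
      then show ?thesis using Suc j l by simp
    next
      assume w: "walk l = walk (Suc j)"
      show ?thesis
      proof (cases "Suc j = period")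
        case True
        then show ?thesis using w walk_Suc_ne[of l] l by simp
      next
        case False
        then have "l = Suc j" using inj[of l "Suc j"] w l j by simp
        then show ?thesis using j l walk_nbrs(2)[of j] by simp
      qed
    qed
  qed (use j in simp)
qed

lemma walk_mod: "walk (Suc i mod period) = walk (Suc i)" if "i < period"
  using that walk_period by (auto simp: mod_Suc)

lemma core_nbrs_walk:
  assumes "i < period" "b \<in> core_nbrs (walk i)"
  obtains j where "j < period" "{walk i, b} = {walk j, walk (Suc j mod period)}"
proof (cases i)
  case 0
  obtain l where l: "period = Suc l" using period_ge by (cases period) auto
  have c0: "walk 0 \<in> core" using walk_step by blast
  have 1: "walk 1 \<in> core_nbrs (walk 0)" using walk_step[of 0] by simp
  have 2: "walk l \<in> core_nbrs (walk 0)"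
    using walk_step[of l] core_nbrs_sym[of "walk l" "walk period"] walk_period unfolding l by simp
  have "walk l \<noteq> walk 1"
  proof
    assume "walk l = walk 1"
    then have "l = 1" using walk_inj period_ge l by (auto simp: inj_on_def)
    then show False using period_ge l by simp
  qed
  then have "b = walk 1 \<or> b = walk l" using other[OF c0 1] 2 assms(2) 0 by auto
  then show thesis
  proof
    assume "b = walk 1"
    then show thesis using 0 assms(1) walk_mod[of 0] by (intro that[of 0]) auto
  next
    assume "b = walk l"
    then show thesis using 0 l walk_mod[of l] walk_period by (intro that[of l]) (auto simp: insert_commute)
  qed
next
  case (Suc k)
  then have "b = walk k \<or> b = walk (Suc i)" using assms(2) walk_nbrs(1)[of k] by auto
  then show thesis
  proof
    assume "b = walk k"
    then show thesis using Suc assms(1) walk_mod[of k] by (intro that[of k]) (auto simp: insert_commute)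
  next
    assume "b = walk (Suc i)"
    then show thesis using assms(1) walk_mod[of i] by (intro that[of i]) auto
  qed
qed

section \<open>The closed walk with its leaves as a sun component\<close>

definition cycle_word :: "bool list" where "cycle_word = map (\<lambda>i. walk i \<in> branching) [0..<period]"
definition labelling :: "bool \<times> nat \<Rightarrow> nat" where
  "labelling a = (if fst a then leaf_at (walk (snd a)) else walk (snd a))"

lemma length_cycle_word [simp]: "length cycle_word = period"
  by (simp add: cycle_word_def)

lemma nth_cycle_word: "i < period \<Longrightarrow> cycle_word ! i \<longleftrightarrow> walk i \<in> branching"
  by (simp add: cycle_word_def)

lemma labelling_simps [simp]: "labelling (False, i) = walk i" "labelling (True, i) = leaf_at (walk i)"
  by (simp_all add: labelling_def)

lemma sun_verts_cycle_word: "(t, i) \<in> sun_verts cycle_word \<longleftrightarrow> i < period \<and> (t \<longrightarrow> walk i \<in> branching)"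
  by (cases t) (auto simp: sun_verts_def nth_cycle_word)

lemma inj_labelling: "inj_on labelling (sun_verts cycle_word)"
proof (rule inj_onI)
  fix a b assume ab: "a \<in> sun_verts cycle_word" "b \<in> sun_verts cycle_word" "labelling a = labelling b"
  have nl: "walk i \<notin> leaves" for i using walk_step[of i] by (auto simp: leaves_def core_def)
  have wi: "i = j" if "walk i = walk j" "i < period" "j < period" for i j
    using walk_inj that by (auto simp: inj_on_def)
  have li: "walk i = walk j" if "leaf_at (walk i) = leaf_at (walk j)" "walk i \<in> branching" "walk j \<in> branching" for i j
    using leaf_at(2)[OF that(2)] leaf_at(2)[OF that(3)] that(1) by metis
  obtain t i where ai: "a = (t, i)" by (cases a)
  obtain t' j where bj: "b = (t', j)" by (cases b)
  have a: "a = (t, i)" "i < period" "t \<Longrightarrow> walk i \<in> branching"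
    using ab(1) unfolding ai sun_verts_cycle_word by auto
  have b: "b = (t', j)" "j < period" "t' \<Longrightarrow> walk j \<in> branching"
    using ab(2) unfolding bj sun_verts_cycle_word by auto
  show "a = b"
  proof (cases t)
    case True
    then have la: "leaf_at (walk i) \<in> leaves" using a leaf_at by blast
    have t'
    proof (rule ccontr)
      assume "\<not> t'"
      then have "leaf_at (walk i) = walk j" using ab(3) a(1) b(1) True by simp
      then show False using la nl[of j] by simp
    qed
    then have "walk i = walk j" using ab(3) a b True li by simp
    then show ?thesis using wi a b True \<open>t'\<close> by simp
  next
    case False
    have "\<not> t'"
    proof
      assume t'
      then have "leaf_at (walk j) \<in> leaves" "leaf_at (walk j) = walk i"
        using b leaf_at(1) ab(3) a(1) False by auto
      then show False using nl[of i] by simp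
    qed
    then show ?thesis using ab(3) a b False wi by simp
  qed
qed

lemma labelling_verts: "labelling ` sun_verts cycle_word \<subseteq> {..<n}"
proof
  fix v assume "v \<in> labelling ` sun_verts cycle_word"
  then obtain a where a: "v = labelling a" "a \<in> sun_verts cycle_word" by blast
  obtain t i where ai: "a = (t, i)" by (cases a)
  have ti: "a = (t, i)" "t \<Longrightarrow> walk i \<in> branching"
    using a(2) unfolding ai sun_verts_cycle_word by auto
  have "v = walk i \<or> v = leaf_at (walk i) \<and> walk i \<in> branching"
    using a(1) ti by (cases t) simp_all
  then show "v \<in> {..<n}"
    using walk_step[of i] leaf_at(1)[of "walk i"] by (auto simp: core_def leaves_def)
qed

theorem sun_component_walk: "sun_component E cycle_word labelling"
  unfolding sun_component_def
proof (intro conjI)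
  show "3 \<le> length cycle_word" using period_ge by simp
  show "inj_on labelling (sun_verts cycle_word)" by (rule inj_labelling)
  let ?V = "labelling ` sun_verts cycle_word"
  let ?L = "{e \<in> E. e \<inter> ?V \<noteq> {}}" and ?R = "(`) labelling ` sun_edges cycle_word"
  have cyc: "{walk i, walk (Suc i mod period)} \<in> ?R" if "i < period" for i
  proof -
    have "labelling ` {(False, i), (False, Suc i mod period)} = {walk i, walk (Suc i mod period)}" by simp
    moreover have "{(False, i), (False, Suc i mod period)} \<in> sun_edges cycle_word"
      using that by (auto simp: sun_edges_def)
    ultimately show ?thesis by (metis imageI)
  qed
  have pend: "{walk i, leaf_at (walk i)} \<in> ?R" if "i < period" "walk i \<in> branching" for i
  proof -
    have "labelling ` {(False, i), (True, i)} = {walk i, leaf_at (walk i)}" by simp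
    moreover have "{(False, i), (True, i)} \<in> sun_edges cycle_word"
      using that by (auto simp: sun_edges_def nth_cycle_word)
    ultimately show ?thesis by (metis imageI)
  qed
  have at_walk: "{walk i, b} \<in> ?R" if i: "i < period" and b: "b \<in> nbrs (walk i)" for i b
  proof (cases "b \<in> leaves")
    case True
    then show ?thesis using leaf_nbr[OF b True] pend[OF i] by simp
  next
    case False
    then have "b \<in> core_nbrs (walk i)"
      using b nbrs_less[OF b] by (auto simp: core_nbrs_def core_def leaves_def)
    then show ?thesis using core_nbrs_walk[OF i] cyc by metis
  qed
  show "?L = ?R"
  proof
    show "?L \<subseteq> ?R"
    proof
      fix e assume e: "e \<in> ?L"
      then obtain a where a: "a \<in> sun_verts cycle_word" "labelling a \<in> e" "e \<in> E" by blast
      obtain u v where "e = {u, v}" using simple_graphs_edge[OF E a(3)] by metis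
      then obtain b where b: "e = {labelling a, b}" using a(2) by auto
      have nb: "b \<in> nbrs (labelling a)" using a(3) b by (simp add: nbrs_edge)
      consider i where "a = (False, i)" "i < period" | i where "a = (True, i)" "i < period" "walk i \<in> branching"
        using a(1) by (auto simp: sun_verts_def nth_cycle_word)
      then show "e \<in> ?R"
      proof cases
        case (1 i)
        then show ?thesis using at_walk[of i b] nb b by simp
      next
        case (2 i)
        have "b = walk i"
          using nb support(1)[OF leaf_at(1)[OF 2(3)]] leaf_at(2)[OF 2(3)] 2(1) by simp
        then show ?thesis using pend[OF 2(2,3)] b 2(1) by (simp add: insert_commute)
      qed
    qed
    show "?R \<subseteq> ?L"
    proof
      fix e assume "e \<in> ?R"
      then obtain d where d: "d \<in> sun_edges cycle_word" "e = labelling ` d" by blast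
      have "d \<noteq> {}" using d(1) by (auto simp: sun_edges_def)
      then have "e \<inter> ?V \<noteq> {}" using sun_edges_subset[OF d(1)] d(2) by blast
      moreover have "e \<in> E"
      proof -
        consider i where "i < period" "d = {(False, i), (False, Suc i mod period)}"
          | i where "i < period" "walk i \<in> branching" "d = {(False, i), (True, i)}"
          using d(1) by (auto simp: sun_edges_def nth_cycle_word)
        then show ?thesis
        proof cases
          case (1 i)
          then have "walk (Suc i mod period) \<in> nbrs (walk i)"
            using walk_step[of i] walk_mod[of i] by (simp add: core_nbrs_def)
          then show ?thesis using 1 d(2) by (simp add: nbrs_edge)
        next
          case (2 i)
          have "walk i \<in> nbrs (leaf_at (walk i))"
            using support(1)[OF leaf_at(1)[OF 2(2)]] leaf_at(2)[OF 2(2)] by simp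
          then show ?thesis using 2 d(2) by (simp add: nbrs_edge insert_commute)
        qed
      qed
      ultimately show "e \<in> ?L" by blast
    qed
  qed
qed

end

section \<open>Suns up to isomorphism\<close>

lemma sum_sun_verts:
  "(\<Sum>a\<in>sun_verts s. f a) = (\<Sum>i<length s. f (False, i)) + (\<Sum>i | i < length s \<and> s ! i. f (True, i))"
proof -
  have V: "sun_verts s = Pair False ` {..<length s} \<union> Pair True ` {i. i < length s \<and> s ! i}"
    by (auto simp: sun_verts_def)
  show ?thesis unfolding V by (subst sum.union_disjoint) (auto simp: sum.reindex inj_on_def)
qed

lemma card_True_positions: "card {i. i < length s \<and> s ! i} = ones s"
  using distinct_card[of "filter ((!) s) [0..<length s]"] length_filter_nth[of s] by simp

lemma sum_nth_bool:
  "(\<Sum>i<length s. (g (s ! i) :: int)) = int (length s - ones s) * g False + int (ones s) * g True"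
proof (induction s)
  case (Cons t s)
  have "ones s \<le> length s" by (rule count_le_length)
  with Cons show ?case
    by (cases t) (auto simp: sum.lessThan_Suc_shift Suc_diff_le algebra_simps simp del: sum.lessThan_Suc)
qed simp

text \<open>A leaf and its branching vertex have degree sum 4, like two ordinary cycle vertices, but
  their squares sum to 10 instead of 8. So the second power sum reveals the number of leaves, and
  with it the cycle length.\<close>

lemma sun_degsum:
  assumes sun: "sun_component E s h" and V: "h ` sun_verts s = {..<n}"
  shows "n = length s + ones s"
    "degsum n E 1 = 2 * int n" "degsum n E 2 = 4 * int n + 2 * int (ones s)"
proof -
  have inj: "inj_on h (sun_verts s)" using sun by (simp add: sun_component_def)
  show n: "n = length s + ones s"
    using arg_cong[OF V, of card] inj by (simp add: card_image card_sun_verts)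
  have "degsum n E k = int (length s - ones s) * 2 ^ k + int (ones s) * 3 ^ k + int (ones s)" for k
  proof -
    have "degsum n E k = (\<Sum>a\<in>sun_verts s. deg E (h a) ^ k)"
      unfolding degsum_def V[symmetric] by (rule sum.reindex[OF inj, unfolded comp_def])
    also have "\<dots> = (\<Sum>a\<in>sun_verts s. (if fst a then 1 else 2 + of_bool (s ! snd a)) ^ k)"
      by (rule sum.cong) (auto simp: deg_def sun_component_degree[OF sun])
    also have "\<dots> = (\<Sum>i<length s. (2 + of_bool (s ! i)) ^ k) + int (ones s)"
      unfolding sum_sun_verts by (simp add: card_True_positions)
    finally show ?thesis using sum_nth_bool[of "\<lambda>t. (2 + of_bool t) ^ k" s] by simp
  qed
  moreover have "ones s \<le> length s" by (rule count_le_length)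
  ultimately show "degsum n E 1 = 2 * int n" "degsum n E 2 = 4 * int n + 2 * int (ones s)"
    by (simp_all add: n of_nat_diff)
qed

text \<open>The only cycle of the sun has length at least 5, which excludes triangles and 4-cycles;
  \<open>sun_extremal\<close> draws the vanishing defects from this.\<close>

lemma sun_edges_adjacent:
  assumes l: "5 \<le> length s" and V: "a \<in> sun_verts s" "b \<in> sun_verts s" "c \<in> sun_verts s" "d \<in> sun_verts s"
    and ac: "{a, c} \<in> sun_edges s" and cb: "{c, b} \<in> sun_edges s"
  shows "{a, b} \<notin> sun_edges s"
    "a \<noteq> b \<Longrightarrow> {a, d} \<in> sun_edges s \<Longrightarrow> {d, b} \<in> sun_edges s \<Longrightarrow> c = d"
proof -
  define l where "l = length s"
  have mem: "i < l" if "(t, i) \<in> sun_verts s" for t i using that by (auto simp: sun_verts_def l_def)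
  have sing: "{x} \<notin> sun_edges s" for x
  proof
    assume "{x} \<in> sun_edges s"
    then obtain i where "i < length s" "i = Suc i mod length s" by (auto simp: sun_edges_def)
    then show False using Suc_mod_neq[of i "length s"] l by simp
  qed
  note iff = sun_edges_iff[of s, folded l_def] sing
  obtain t1 i1 t2 i2 t3 i3 t4 i4 where p: "a = (t1, i1)" "b = (t2, i2)" "c = (t3, i3)" "d = (t4, i4)"
    by (metis surj_pair)
  have i: "i1 < l" "i2 < l" "i3 < l" "i4 < l" and l5: "5 \<le> l" "3 \<le> l"
    using V mem l unfolding p l_def by auto
  show "{a, b} \<notin> sun_edges s" using ac cb i l5 unfolding p
    by (cases t1; cases t2; cases t3) (auto simp: iff mod_Suc split: if_splits)
  assume "a \<noteq> b" "{a, d} \<in> sun_edges s" "{d, b} \<in> sun_edges s"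
  then show "c = d" using ac cb i l5 unfolding p
    by (cases t1; cases t2; cases t3; cases t4) (auto simp: iff mod_Suc split: if_splits)
qed

lemma codeg_card: "codeg n E u v = int (card {k. k < n \<and> {u, k} \<in> E \<and> {k, v} \<in> E})"
proof -
  have "codeg n E u v = (\<Sum>k<n. if {u, k} \<in> E \<and> {k, v} \<in> E then 1 else 0)"
    unfolding codeg_def by (rule sum.cong) (auto simp: adj_def)
  then show ?thesis by (simp add: sum.If_cases Int_def)
qed

lemma sun_extremal:
  assumes sun: "sun_component E s h" and V: "h ` sun_verts s = {..<n}"
    and l: "5 \<le> length s" and sep: "\<And>i. i < length s \<Longrightarrow> \<not> (s ! i \<and> s ! (Suc i mod length s))"
  shows "extremal_graph n E"
proof -
  have edge: "{h a, h b} \<in> E \<longleftrightarrow> {a, b} \<in> sun_edges s" if "a \<in> sun_verts s" "b \<in> sun_verts s" for a b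
    using sun_component_edge[OF sun] that .
  have ver: "\<exists>a\<in>sun_verts s. u = h a" if "u < n" for u using V that by blast
  have dg: "deg E (h a) = (if fst a then 1 else 2 + of_bool (s ! snd a))" if "a \<in> sun_verts s" for a
    using sun_component_degree[OF sun that] by (simp add: deg_def)
  have cod0: "codeg n E u v = 0" if uv: "u < n" "v < n" "{u, v} \<in> E" for u v
  proof -
    have "{k. k < n \<and> {u, k} \<in> E \<and> {k, v} \<in> E} = {}"
    proof (rule ccontr)
      assume "{k. k < n \<and> {u, k} \<in> E \<and> {k, v} \<in> E} \<noteq> {}"
      then obtain k where "k < n" "{u, k} \<in> E" "{k, v} \<in> E" by blast
      moreover obtain a b c where "a \<in> sun_verts s" "b \<in> sun_verts s" "c \<in> sun_verts s" "u = h a" "v = h b" "k = h c"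
        using ver uv \<open>k < n\<close> by metis
      ultimately show False using sun_edges_adjacent(1)[OF l, of a b c a] uv(3) edge by blast
    qed
    then show ?thesis unfolding codeg_card by simp
  qed
  have cod1: "codeg n E u v \<in> {0, 1}" if uv: "u < n" "v < n" "u \<noteq> v" for u v
  proof -
    have "k = k'" if k: "k < n" "{u, k} \<in> E" "{k, v} \<in> E" "k' < n" "{u, k'} \<in> E" "{k', v} \<in> E" for k k'
    proof -
      obtain a b c d where "a \<in> sun_verts s" "b \<in> sun_verts s" "c \<in> sun_verts s" "d \<in> sun_verts s"
        "u = h a" "v = h b" "k = h c" "k' = h d" using ver uv k(1,4) by metis
      then show ?thesis using sun_edges_adjacent(2)[OF l, of a b c d] uv(3) k edge by blast
    qed
    then have "card {k. k < n \<and> {u, k} \<in> E \<and> {k, v} \<in> E} \<le> Suc 0"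
      by (intro card_le_Suc0_iff_eq[THEN iffD2]) auto
    then consider "card {k. k < n \<and> {u, k} \<in> E \<and> {k, v} \<in> E} = 0" | "card {k. k < n \<and> {u, k} \<in> E \<and> {k, v} \<in> E} = 1"
      by linarith
    then show ?thesis unfolding codeg_card by cases (simp_all only: of_nat_0 of_nat_1 insert_iff simp_thms)
  qed
  have edg: "(deg E u + deg E v - 4) * (deg E u + deg E v - 5) = 0" if uv: "u < n" "v < n" "{u, v} \<in> E" for u v
  proof -
    obtain a b where ab: "a \<in> sun_verts s" "b \<in> sun_verts s" "u = h a" "v = h b"
      using ver[OF uv(1)] ver[OF uv(2)] by blast
    then have "{a, b} \<in> sun_edges s" using edge uv(3) by blast
    then consider i where "i < length s" "{a, b} = {(False, i), (False, Suc i mod length s)}"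
      | i where "i < length s" "s ! i" "{a, b} = {(False, i), (True, i)}"
      by (auto simp: sun_edges_def)
    then have "deg E u + deg E v = 4 \<or> deg E u + deg E v = 5"
    proof cases
      case (1 i)
      then have "{deg E u, deg E v} = {2 + of_bool (s ! i), 2 + of_bool (s ! (Suc i mod length s))} \<and>
         deg E u + deg E v = 2 + of_bool (s ! i) + (2 + of_bool (s ! (Suc i mod length s)))"
        using ab dg by (auto simp: doubleton_eq_iff)
      then show ?thesis using sep[OF 1(1)] by (auto split: if_splits)
    next
      case (2 i)
      then show ?thesis using ab dg by (auto simp: doubleton_eq_iff)
    qed
    then show ?thesis by auto
  qed
  show ?thesis
    unfolding extremal_graph_def edge_defect_def triangle_count_def triangle_defect_def square_defect_def
  proof (intro conjI allI impI sum.neutral ballI)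
    fix u assume "u < n"
    then show "deg E u \<in> {1, 2, 3}" using ver[of u] dg by auto
  next
    fix u v assume uv: "u \<in> {..<n}" "v \<in> {..<n}"
    then show "adj E u v * ((deg E u + deg E v - 4) * (deg E u + deg E v - 5)) = 0"
      "adj E u v * codeg n E u v = 0" "(deg E u + deg E v) * adj E u v * codeg n E u v = 0"
      using edg[of u v] cod0[of u v] by (auto simp: adj_def)
    show "(if u = v then 0 else (codeg n E u v)\<^sup>2 - codeg n E u v) = 0"
      using cod1[of u v] uv by auto
  qed
qed

lemma sun_component_relabel:
  assumes sun: "sun_component E s h" and r: "bij_betw r (sun_verts s') (sun_verts s)"
    and e: "(`) r ` sun_edges s' = sun_edges s" and l: "length s' = length s"
  shows "sun_component E s' (h \<circ> r)" "(h \<circ> r) ` sun_verts s' = h ` sun_verts s"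
proof -
  have img: "r ` sun_verts s' = sun_verts s" using r by (simp add: bij_betw_def)
  show i: "(h \<circ> r) ` sun_verts s' = h ` sun_verts s" by (simp only: image_comp[symmetric] img)
  have "inj_on (h \<circ> r) (sun_verts s')"
    using sun r by (intro comp_inj_on) (auto simp: sun_component_def bij_betw_def)
  moreover have "(`) (h \<circ> r) ` sun_edges s' = (`) h ` sun_edges s"
    unfolding e[symmetric] by (auto simp: image_comp)
  ultimately show "sun_component E s' (h \<circ> r)"
    using sun unfolding sun_component_def i by (simp add: l)
qed

definition has_sun :: "nat \<Rightarrow> nat set set \<Rightarrow> bool list \<Rightarrow> bool" where
  "has_sun n E s \<longleftrightarrow> (\<exists>h. sun_component E s h \<and> h ` sun_verts s = {..<n})"

lemma Suc_mod_image: "(\<lambda>i. Suc i mod l) ` {..<l} = {..<l}"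
proof -
  have "inj_on (\<lambda>i. Suc i mod l) {..<l}" by (auto simp: inj_on_def mod_Suc split: if_splits)
  moreover have "(\<lambda>i. Suc i mod l) ` {..<l} \<subseteq> {..<l}" by (auto intro: mod_less_divisor)
  ultimately show ?thesis by (simp add: endo_inj_surj)
qed

text \<open>Cycle edges are compared as a set rather than successor by successor, so that rotations
  and reflections are both covered.\<close>

lemma has_sun_relabel_index:
  assumes sun: "has_sun n E s" and l: "length s' = length s"
    and r: "r ` {..<length s} = {..<length s}" and s: "\<And>i. i < length s \<Longrightarrow> s' ! i = s ! r i"
    and cyc: "(\<lambda>i. {r i, r (Suc i mod length s)}) ` {..<length s} = (\<lambda>i. {i, Suc i mod length s}) ` {..<length s}"
  shows "has_sun n E s'"
proof -
  obtain h where h: "sun_component E s h" "h ` sun_verts s = {..<n}" using sun by (auto simp: has_sun_def)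
  define R :: "bool \<times> nat \<Rightarrow> bool \<times> nat" where "R = map_prod id r"
  let ?T = "\<lambda>s. {i. i < length s \<and> s ! i}"
  have T: "r ` ?T s' = ?T s"
  proof -
    have "?T s' = {i \<in> {..<length s}. s ! r i}" using s l by auto
    moreover have "r ` {i \<in> A. P (r i)} = {j \<in> r ` A. P j}" for A P by auto
    ultimately show ?thesis using r by auto
  qed
  have verts: "sun_verts s = Pair False ` {..<length s} \<union> Pair True ` ?T s" for s
    by (auto simp: sun_verts_def)
  have edges: "sun_edges s = (`) (Pair False) ` (\<lambda>i. {i, Suc i mod length s}) ` {..<length s}
      \<union> (\<lambda>i. {(False, i), (True, i)}) ` ?T s" for s
    unfolding image_image by (auto simp: sun_edges_def)
  have "inj_on r {..<length s}" using r by (intro eq_card_imp_inj_on) auto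
  then have "inj_on R (sun_verts s')" by (auto simp: inj_on_def R_def sun_verts_def l)
  moreover have "R ` sun_verts s' = Pair False ` r ` {..<length s} \<union> Pair True ` r ` ?T s'"
    unfolding verts by (simp add: R_def image_Un image_image l)
  then have "R ` sun_verts s' = sun_verts s" unfolding r T verts .
  moreover have "(`) R ` sun_edges s' = (`) (Pair False) ` (\<lambda>i. {r i, r (Suc i mod length s)}) ` {..<length s}
      \<union> (\<lambda>i. {(False, i), (True, i)}) ` r ` ?T s'"
    unfolding edges by (simp add: R_def image_Un image_image l)
  then have "(`) R ` sun_edges s' = sun_edges s" unfolding cyc T edges .
  ultimately show ?thesis
    using sun_component_relabel[OF h(1) bij_betw_imageI _ l] h(2) unfolding has_sun_def by metis
qed

lemma has_sun_rotate1:
  assumes "has_sun n E s"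
  shows "has_sun n E (rotate1 s)"
proof (rule has_sun_relabel_index[OF assms, where r = "\<lambda>i. Suc i mod length s"])
  fix i assume "i < length s"
  then show "rotate1 s ! i = s ! (Suc i mod length s)" by (rule nth_rotate1)
next
  have "(\<lambda>i. {i, Suc i mod length s}) ` {..<length s}
      = (\<lambda>i. {i, Suc i mod length s}) ` (\<lambda>i. Suc i mod length s) ` {..<length s}"
    by (simp only: Suc_mod_image)
  then show "(\<lambda>i. {Suc i mod length s, Suc (Suc i mod length s) mod length s}) ` {..<length s}
      = (\<lambda>i. {i, Suc i mod length s}) ` {..<length s}"
    by (simp add: image_image)
qed (simp_all add: Suc_mod_image)

lemma has_sun_rotate: "has_sun n E s \<Longrightarrow> has_sun n E (rotate k s)"
  by (induction k) (auto simp: has_sun_rotate1)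

lemma has_sun_rev:
  assumes "has_sun n E s"
  shows "has_sun n E (rev s)"
proof (rule has_sun_relabel_index[OF assms, where r = "\<lambda>i. length s - 1 - i"])
  let ?l = "length s"
  show "(\<lambda>i. ?l - 1 - i) ` {..<?l} = {..<?l}"
    by (rule endo_inj_surj) (auto simp: inj_on_def)
  \<comment> \<open>Edge number \<open>i\<close> of the cycle is reflected to edge number
    \<open>j i\<close>: with \<open>l\<close> the length, \<open>{i, i + 1}\<close> becomes
    \<open>{l - 2 - i, l - 1 - i}\<close>, while the closing edge stays in place.\<close>
  define j where "j i = (if Suc i = ?l then i else ?l - 2 - i)" for i
  have "j ` {..<?l} = {..<?l}"
    by (rule endo_inj_surj) (auto simp: inj_on_def j_def split: if_splits)
  then have "(\<lambda>i. {i, Suc i mod ?l}) ` {..<?l} = (\<lambda>i. {i, Suc i mod ?l}) ` j ` {..<?l}" by simp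
  then have "(\<lambda>i. {i, Suc i mod ?l}) ` {..<?l} = (\<lambda>i. {j i, Suc (j i) mod ?l}) ` {..<?l}"
    unfolding image_image .
  moreover have "{?l - 1 - i, ?l - 1 - Suc i mod ?l} = {j i, Suc (j i) mod ?l}" if "i < ?l" for i
    using that by (auto simp: mod_Suc j_def)
  then have "(\<lambda>i. {?l - 1 - i, ?l - 1 - Suc i mod ?l}) ` {..<?l} = (\<lambda>i. {j i, Suc (j i) mod ?l}) ` {..<?l}"
    by (intro image_cong refl) (simp only: lessThan_iff)
  ultimately show "(\<lambda>i. {?l - 1 - i, ?l - 1 - Suc i mod ?l}) ` {..<?l} = (\<lambda>i. {i, Suc i mod ?l}) ` {..<?l}"
    by (simp only:)
qed (auto simp: rev_nth)

lemma has_sun_isomorphic: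
  assumes "has_sun n F s" "has_sun n E s"
  shows "graph_isomorphic n F n E"
proof -
  obtain h g where h: "sun_component F s h" "h ` sun_verts s = {..<n}"
    and g: "sun_component E s g" "g ` sun_verts s = {..<n}" using assms by (auto simp: has_sun_def)
  have bh: "bij_betw h (sun_verts s) {..<n}" and bg: "bij_betw g (sun_verts s) {..<n}"
    using h g by (auto simp: sun_component_def bij_betw_def)
  define f where "f = g \<circ> inv_into (sun_verts s) h"
  have f: "bij_betw f {..<n} {..<n}"
    unfolding f_def by (rule bij_betw_trans[OF bij_betw_inv_into[OF bh] bg])
  have fh: "f (h a) = g a" if "a \<in> sun_verts s" for a
    using that bh by (simp add: f_def bij_betw_def inv_into_f_f)
  have "{u, v} \<in> F \<longleftrightarrow> {f u, f v} \<in> E" if uv: "u < n" "v < n" for u v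
  proof -
    obtain a b where "a \<in> sun_verts s" "b \<in> sun_verts s" "u = h a" "v = h b"
      using h(2) uv by (metis imageE lessThan_iff)
    then show ?thesis using sun_component_edge[OF h(1)] sun_component_edge[OF g(1)] fh by simp
  qed
  then show ?thesis using f unfolding graph_isomorphic_def by blast
qed

lemma has_sun_transport:
  assumes E: "E \<in> simple_graphs n" and F: "F \<in> simple_graphs n" and sun: "has_sun n E s"
    and iso: "graph_isomorphic n E n F"
  shows "has_sun n F s"
proof -
  obtain h where h: "sun_component E s h" "h ` sun_verts s = {..<n}" using sun by (auto simp: has_sun_def)
  obtain f where f: "bij_betw f {..<n} {..<n}" and e: "\<And>u v. u < n \<Longrightarrow> v < n \<Longrightarrow> {u, v} \<in> E \<longleftrightarrow> {f u, f v} \<in> F"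
    using iso by (auto simp: graph_isomorphic_def)
  have im: "(f \<circ> h) ` sun_verts s = {..<n}"
    unfolding image_comp[symmetric] h(2) using f by (simp add: bij_betw_def)
  have "inj_on (f \<circ> h) (sun_verts s)"
    using h f by (intro comp_inj_on) (auto simp: sun_component_def bij_betw_def)
  moreover have full: "{e \<in> G. e \<inter> {..<n} \<noteq> {}} = G" if "G \<in> simple_graphs n" for G
  proof -
    have "e \<inter> {..<n} \<noteq> {}" if e: "e \<in> G" for e
    proof -
      obtain u v where "e = {u, v}" "u < n" by (metis simple_graphs_edge[OF \<open>G \<in> simple_graphs n\<close> e])
      then show ?thesis by blast
    qed
    then show ?thesis by blast
  qed
  have hE: "E = (`) h ` sun_edges s" using h full[OF E] by (simp add: sun_component_def)
  have "F = (`) f ` E"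
  proof
    show "F \<subseteq> (`) f ` E"
    proof
      fix d assume d: "d \<in> F"
      then obtain u v where uv: "d = {u, v}" "u < n" "v < n" by (rule simple_graphs_edge[OF F])
      then obtain u' v' where "u' < n" "v' < n" "u = f u'" "v = f v'"
        using f unfolding bij_betw_def by (metis imageE lessThan_iff)
      then have "{u', v'} \<in> E" "d = f ` {u', v'}" using e d uv by auto
      then show "d \<in> (`) f ` E" by blast
    qed
    show "(`) f ` E \<subseteq> F"
    proof
      fix d assume "d \<in> (`) f ` E"
      then obtain d' where d': "d' \<in> E" "d = f ` d'" by blast
      then obtain u v where "d' = {u, v}" "u < n" "v < n" by (metis simple_graphs_edge[OF E])
      then show "d \<in> F" using e d' by auto
    qed
  qed
  then have "F = (`) (f \<circ> h) ` sun_edges s" unfolding hE by (auto simp: image_comp)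
  then have "{e \<in> F. e \<inter> (f \<circ> h) ` sun_verts s \<noteq> {}} = (`) (f \<circ> h) ` sun_edges s"
    unfolding im using full[OF F] by simp
  ultimately have "sun_component F s (f \<circ> h)" using h(1) by (simp add: sun_component_def)
  then show ?thesis using im unfolding has_sun_def by blast
qed

lemma has_sun_exists:
  assumes l: "3 \<le> length s" and n: "n = length s + ones s"
  shows "\<exists>E\<in>simple_graphs n. has_sun n E s"
proof -
  obtain h where h: "bij_betw h (sun_verts s) {..<n}"
    using ex_bij_betw_finite_nat[OF finite_sun_verts[of s]] by (auto simp: card_sun_verts n atLeast0LessThan)
  define E where "E = (`) h ` sun_edges s"
  have im: "h ` sun_verts s = {..<n}" and inj: "inj_on h (sun_verts s)" using h by (auto simp: bij_betw_def)
  have Suc: "Suc i mod length s < length s" if "i < length s" for i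
    using that by (intro mod_less_divisor) auto
  have "E \<in> simple_graphs n" unfolding simple_graphs_def
  proof (rule CollectI, rule subsetI)
    fix e assume "e \<in> E"
    then obtain d where d: "d \<in> sun_edges s" "e = h ` d" by (auto simp: E_def)
    have "\<exists>a b. d = {a, b} \<and> a \<noteq> b"
    proof -
      consider i where "i < length s" "d = {(False, i), (False, Suc i mod length s)}"
        | i where "d = {(False, i), (True, i)}" using d(1) by (auto simp: sun_edges_def)
      then show ?thesis
      proof cases
        case (1 i)
        then show ?thesis using Suc_mod_neq[OF 1(1) l]
          by (intro exI[of _ "(False, i)"] exI[of _ "(False, Suc i mod length s)"]) simp
      qed blast
    qed
    then obtain a b where ab: "d = {a, b}" "a \<noteq> b" by blast
    then have V: "a \<in> sun_verts s" "b \<in> sun_verts s" using sun_edges_subset[OF d(1)] by auto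
    then have "h a < n" "h b < n" "h a \<noteq> h b" using im inj ab by (auto simp: inj_on_def)
    then show "e \<in> {{u, v} |u v. u < n \<and> v < n \<and> u \<noteq> v}" using d ab by auto
  qed
  moreover have "{e \<in> E. e \<inter> h ` sun_verts s \<noteq> {}} = E"
  proof -
    have "e \<inter> h ` sun_verts s \<noteq> {}" if e: "e \<in> E" for e
    proof -
      obtain d where d: "d \<in> sun_edges s" "e = h ` d" using e by (auto simp: E_def)
      have "d \<noteq> {}" using d(1) by (auto simp: sun_edges_def)
      then show ?thesis using d sun_edges_subset[OF d(1)] by blast
    qed
    then show ?thesis by blast
  qed
  then have "sun_component E s h" using l inj by (simp add: sun_component_def E_def)
  then have "has_sun n E s" using im by (auto simp: has_sun_def)
  ultimately show ?thesis by blast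
qed

section \<open>Words of distances and cyclic words of branching marks\<close>

lemma word_of_append: "word_of (xs @ ys) = word_of xs @ word_of ys"
  by (simp add: word_of_def)

lemma word_of_rotate: "\<exists>k. word_of (rotate i ds) = rotate k (word_of ds)"
proof -
  have "word_of (ys @ xs) = rotate (length (word_of xs)) (word_of (xs @ ys))" for xs ys
    by (simp add: word_of_append rotate_append)
  then show ?thesis by (metis append_take_drop_id rotate_drop_take)
qed

text \<open>Reversal puts the \<open>True\<close> of each block in front; moving the first
  \<open>True\<close> to the end restores blocks that end in \<open>True\<close>.\<close>

lemma rotate1_rev_word_of: "rotate1 (rev (word_of ds)) = word_of (rev ds)"
proof -
  define rb where "rb d = True # replicate (d - 1) False" for d
  have rv: "rev (word_of ds) = concat (map rb (rev ds))"
    by (induction ds) (auto simp: word_of_def rb_def)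
  have sh: "concat (map rb xs) @ [True] = True # word_of xs" for xs
    by (induction xs) (auto simp: word_of_def rb_def)
  show ?thesis
  proof (cases "rev ds")
    case Nil
    then show ?thesis by (simp add: word_of_def)
  next
    case (Cons x xs)
    then obtain Y where Y: "concat (map rb (rev ds)) = True # Y" by (simp add: rb_def)
    then have "Y @ [True] = word_of (rev ds)" using sh[of "rev ds"] by simp
    then show ?thesis by (simp add: rv Y)
  qed
qed

lemma length_word_of: "\<forall>d\<in>set ds. d \<ge> 1 \<Longrightarrow> length (word_of ds) = sum_list ds"
  by (induction ds) (auto simp: word_of_def)

lemma count_word_of: "ones (word_of ds) = length ds"
proof -
  have "count_list (replicate n False) True = 0" for n by (induction n) auto
  then show ?thesis by (induction ds) (auto simp: word_of_def count_list_append)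
qed

lemma word_of_surj:
  assumes "s = [] \<or> last s"
  shows "\<exists>ds. s = word_of ds \<and> (\<forall>d\<in>set ds. d \<ge> 1)"
  using assms
proof (induction "length s" arbitrary: s rule: less_induct)
  case less
  show ?case
  proof (cases "s = []")
    case True
    then show ?thesis by (intro exI[of _ "[]"]) (simp add: word_of_def)
  next
    case False
    then have "True \<in> set s" using less.prems last_in_set by metis
    then obtain xs ys where s: "s = xs @ True # ys" "True \<notin> set xs" by (metis split_list_first)
    have xs: "xs = replicate (length xs) False" using s(2) by (metis (full_types) replicate_eqI)
    have "ys = [] \<or> last ys" using less.prems s by (auto split: if_splits)
    then obtain ds where ds: "ys = word_of ds" "\<forall>d\<in>set ds. d \<ge> 1" using less.hyps[of ys] s by auto
    have "s = word_of (Suc (length xs) # ds)" using s(1) xs ds(1) by (simp add: word_of_def)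
    then show ?thesis using ds(2) by (intro exI[of _ "Suc (length xs) # ds"]) simp
  qed
qed

lemma rotate_to_word_of:
  assumes "ones s > 0"
  obtains k ds where "rotate k s = word_of ds" "\<forall>d\<in>set ds. d \<ge> 1"
proof -
  have "True \<in> set s" using assms count_list_0_iff by force
  then obtain xs ys where "s = (xs @ [True]) @ ys" by (metis split_list append.assoc append_Cons append_Nil)
  then have "rotate (length (xs @ [True])) s = ys @ xs @ [True]" using rotate_append by blast
  moreover obtain ds where "ys @ xs @ [True] = word_of ds" "\<forall>d\<in>set ds. d \<ge> 1"
    using word_of_surj[of "ys @ xs @ [True]"] by auto
  ultimately show thesis using that by metis
qed

lemma word_of_separated:
  assumes ds: "\<forall>d\<in>set ds. d \<ge> 2" and i: "i < length (word_of ds)"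
  shows "\<not> (word_of ds ! i \<and> word_of ds ! (Suc i mod length (word_of ds)))"
proof -
  \<comment> \<open>The claim on the first letter carries the induction across the joint of two
    blocks and later settles the wrap-around.\<close>
  have "successively (\<lambda>x y. \<not> (x \<and> y)) (word_of ds) \<and> (ds \<noteq> [] \<longrightarrow> \<not> hd (word_of ds) \<and> word_of ds \<noteq> [])"
    using ds
  proof (induction ds)
    case (Cons d ds)
    obtain m where m: "d - 1 = Suc m" using Cons.prems by (cases "d - 1") auto
    have rep: "successively (\<lambda>x y. \<not> (x \<and> y)) (replicate k False @ [True])" for k
      by (induction k) (auto simp: successively_Cons hd_append split: if_splits)
    have "word_of (d # ds) = (replicate (Suc m) False @ [True]) @ word_of ds"
      unfolding word_of_def by (simp only: list.map concat.simps m)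
    then show ?case using Cons rep[of "Suc m"]
      by (auto simp: successively_append_iff simp del: replicate_Suc append_assoc) (auto simp: word_of_def)
  qed (simp add: word_of_def)
  then have succ: "successively (\<lambda>x y. \<not> (x \<and> y)) (word_of ds)" and h: "ds \<noteq> [] \<longrightarrow> \<not> hd (word_of ds)" by auto
  have "ds \<noteq> []" using i by (auto simp: word_of_def)
  moreover have ne: "word_of ds \<noteq> []" using i by auto
  ultimately have h0: "\<not> word_of ds ! 0" using h hd_conv_nth[OF ne] by simp
  show ?thesis
  proof (cases "Suc i = length (word_of ds)")
    case True
    then have "Suc i mod length (word_of ds) = 0" by (metis mod_self)
    then show ?thesis using h0 by metis
  next
    case False
    then have "Suc i < length (word_of ds)" using i by linarith
    moreover from this have "Suc i mod length (word_of ds) = Suc i" by (rule mod_less)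
    ultimately show ?thesis using succ unfolding successively_conv_nth by metis
  qed
qed

section \<open>Suns determined by their spectrum\<close>

definition param_ok :: "complex \<Rightarrow> bool" where
  "param_ok z \<longleftrightarrow> z \<noteq> 0 \<and> z ^ 2 \<noteq> 1 \<and> 1 + z + z ^ 2 \<noteq> 0"

text \<open>Its roots are the inadmissible parameters; multiplying by it turns an identity at the
  admissible ones into one of polynomials.\<close>

definition param_poly :: "complex poly" where
  "param_poly = Z * (Z ^ 2 - 1) * (1 + Z + Z ^ 2)"

lemma param_ok_iff: "param_ok z \<longleftrightarrow> poly param_poly z \<noteq> 0"
  by (auto simp: param_ok_def param_poly_def poly_Z)

lemma param_poly_nonzero: "param_poly \<noteq> 0"
proof -
  have "poly param_poly 2 \<noteq> 0" by (simp add: param_poly_def poly_Z)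
  then show ?thesis by auto
qed

lemma char_poly_param:
  assumes E: "E \<in> simple_graphs n" and sun: "has_sun n E s" and z: "param_ok z"
  shows "poly (cpoly n E) ((1 + z) ^ 2 / z) * z ^ (length s + ones s) * (1 - z) ^ ones s
    = cyclic_sign (length s) * (m2_tr (sun_prod z s) - 2 * z ^ length s * rden z ^ ones s)"
proof -
  obtain h where h: "sun_component E s h" "h ` sun_verts s = {..<n}" using sun by (auto simp: has_sun_def)
  have z': "z \<noteq> 0" "z ^ 2 \<noteq> 1" "1 + z + z ^ 2 \<noteq> 0" using z by (auto simp: param_ok_def)
  have "(1 + z) ^ 2 / z \<noteq> 1" using z' by (auto simp: field_simps power2_eq_square)
  then have "poly (cpoly n E) ((1 + z) ^ 2 / z) = sun_value s ((1 + z) ^ 2 / z)"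
    by (rule char_poly_sun[OF E h])
  then show ?thesis using sun_value_param[OF z'] by simp
qed

text \<open>In \<open>char_poly_param\<close> everything but the trace depends only on the graph
  polynomial, the length and the number of leaves.\<close>

lemma cospectral_suns:
  assumes E: "E \<in> simple_graphs n" and F: "F \<in> simple_graphs n" and sE: "has_sun n E s" and sF: "has_sun n F s'"
    and l: "length s' = length s" "ones s' = ones s"
    and cp: "cpoly n F = cpoly n E"
  shows "m2_tr (sun_prod Z s') = m2_tr (sun_prod Z s)"
proof -
  have "m2_tr (sun_prod z s') = m2_tr (sun_prod z s)" if z: "param_ok z" for z
  proof -
    have "cyclic_sign (length s) * (m2_tr (sun_prod z s') - 2 * z ^ length s * rden z ^ ones s)
      = cyclic_sign (length s) * (m2_tr (sun_prod z s) - 2 * z ^ length s * rden z ^ ones s)"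
      using char_poly_param[OF E sE z] char_poly_param[OF F sF z] unfolding l cp by simp
    moreover have "cyclic_sign (length s) \<noteq> 0" using cyclic_sign[of "length s"] by auto
    ultimately show ?thesis by simp
  qed
  then have "poly ((m2_tr (sun_prod Z s') - m2_tr (sun_prod Z s)) * param_poly) z = 0" for z
    by (auto simp: param_ok_iff poly_m2_tr_sun_prod)
  then have "(m2_tr (sun_prod Z s') - m2_tr (sun_prod Z s)) * param_poly = 0"
    using poly_all_0_iff_0 by blast
  then show ?thesis using param_poly_nonzero by simp
qed

lemma cube_root_of_unity:
  obtains \<omega> :: complex where "1 + \<omega> + \<omega> ^ 2 = 0" "\<omega> \<noteq> 0" "\<omega> ^ 3 = 1" "\<And>d. \<not> 3 dvd d \<Longrightarrow> \<omega> ^ (2 * d) \<noteq> 1"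
proof
  define \<omega> where "\<omega> = Complex (- 1 / 2) (sqrt 3 / 2)"
  show q: "1 + \<omega> + \<omega> ^ 2 = 0"
    by (simp add: \<omega>_def complex_eq_iff power2_eq_square)
  then show "\<omega> \<noteq> 0" by auto
  have "\<omega> ^ 3 - 1 = (\<omega> - 1) * (1 + \<omega> + \<omega> ^ 2)" by (simp add: ring_normal)
  then show c: "\<omega> ^ 3 = 1" using q by simp
  fix d :: nat assume d: "\<not> 3 dvd d"
  have "2 * d = 3 * (2 * d div 3) + 2 * d mod 3" by simp
  then have "\<omega> ^ (2 * d) = (\<omega> ^ 3) ^ (2 * d div 3) * \<omega> ^ (2 * d mod 3)"
    by (metis power_add power_mult)
  then have p: "\<omega> ^ (2 * d) = \<omega> ^ (2 * d mod 3)" by (simp add: c)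
  have "2 * d mod 3 = 1 \<or> 2 * d mod 3 = 2" using d by presburger
  then show "\<omega> ^ (2 * d) \<noteq> 1"
  proof
    assume m: "2 * d mod 3 = 1"
    have "\<omega> \<noteq> 1" using q by auto
    then show ?thesis unfolding p m by simp
  next
    assume m: "2 * d mod 3 = 2"
    have "\<omega> ^ 2 \<noteq> 1"
    proof
      assume o: "\<omega> ^ 2 = 1"
      then have "\<omega> = - 2" using q by (simp add: add_eq_0_iff)
      then show False using o by simp
    qed
    then show ?thesis unfolding p m .
  qed
qed

text \<open>Here \<open>rden \<omega> = 0\<close> and \<open>rnum \<omega> = - 1\<close>, so
  \<open>defect\<close> is the column (1, -1) times the row (1, 1). The product collapses, and
  \<open>p\<close> is the product of \<open>1 - \<omega> ^ (2 * d)\<close> over all distances but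
  the last.\<close>

lemma ring_prod_at_cube_root:
  fixes \<omega> :: complex
  assumes q: "1 + \<omega> + \<omega> ^ 2 = 0" "\<omega> ^ 3 = 1" and ds: "ds \<noteq> []" "\<forall>d\<in>set ds. \<omega> ^ (2 * d) \<noteq> 1"
  shows "\<exists>p. p \<noteq> 0 \<and> ring_prod \<omega> ds = M2 p (p * \<omega> ^ (2 * last ds)) (- p) (- p * \<omega> ^ (2 * last ds))"
  using ds
proof (induction ds rule: list_nonempty_induct)
  have c: "rden \<omega> = 0" and k: "rnum \<omega> = - 1"
    using q by (auto simp: rden_def rnum_def add_eq_0_iff)
  {
    case (single d)
    show ?case by (rule exI[of _ 1]) (simp add: m2.expand c k)
  next
    case (cons d ds)
    then obtain p where p: "p \<noteq> 0" "ring_prod \<omega> ds = M2 p (p * \<omega> ^ (2 * last ds)) (- p) (- p * \<omega> ^ (2 * last ds))"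
      by auto
    show ?case using p cons
      by (intro exI[of _ "p * (1 - \<omega> ^ (2 * d))"]) (auto simp: m2.expand c k algebra_simps)
  }
qed

text \<open>
  The substitution takes \<open>x = 1\<close> to the primitive cube roots of unity, where \<open>defect\<close> has rank one and the
  trace factors over the distances. Since \<open>char_poly_param\<close> excludes these points, they are reached by
  continuity.
\<close>

lemma char_poly_sun_at_1:
  assumes E: "E \<in> simple_graphs n" and sun: "has_sun n E (word_of ds)"
    and ds: "ds \<noteq> []" "\<forall>d\<in>set ds. d \<ge> 1 \<and> \<not> 3 dvd d"
  shows "poly (cpoly n E) 1 \<noteq> 0"
proof
  assume P1: "poly (cpoly n E) 1 = 0"
  obtain \<omega> :: complex where w: "1 + \<omega> + \<omega> ^ 2 = 0" "\<omega> \<noteq> 0" "\<omega> ^ 3 = 1" "\<And>d. \<not> 3 dvd d \<Longrightarrow> \<omega> ^ (2 * d) \<noteq> 1"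
    using cube_root_of_unity by blast
  define s where "s = word_of ds"
  define f where "f z = poly (cpoly n E) ((1 + z) ^ 2 / z) * z ^ (length s + ones s)
      * (1 - z) ^ ones s
    - cyclic_sign (length s) * (poly (m2_tr (sun_prod Z s)) z - 2 * z ^ length s * (1 - z ^ 3) ^ ones s)" for z
  \<comment> \<open>Only finitely many parameters are inadmissible, so near \<omega> all others are
    admissible.\<close>
  have "eventually (\<lambda>z. z \<in> - ({z. poly param_poly z = 0} - {\<omega>})) (nhds \<omega>)"
  proof (rule eventually_nhds_in_open)
    show "open (- ({z. poly param_poly z = 0} - {\<omega>}))"
      by (intro open_Compl finite_imp_closed finite_Diff poly_roots_finite param_poly_nonzero)
  qed simp
  then have "eventually (\<lambda>z. f z = 0) (at \<omega>)" unfolding eventually_at_filter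
  proof (rule eventually_mono, intro impI)
    fix z assume "z \<in> - ({z. poly param_poly z = 0} - {\<omega>})" "z \<noteq> \<omega>"
    then have "param_ok z" by (simp add: param_ok_iff)
    then show "f z = 0"
      using char_poly_param[OF E sun] by (simp add: f_def s_def poly_m2_tr_sun_prod rden_def)
  qed
  then have "(f \<longlongrightarrow> 0) (at \<omega>)" by (rule tendsto_eventually)
  moreover have "isCont f \<omega>" unfolding f_def using w(2) by (intro continuous_intros) auto
  then have "(f \<longlongrightarrow> f \<omega>) (at \<omega>)" by (simp add: isCont_def)
  ultimately have "f \<omega> = 0" using tendsto_unique[OF at_neq_bot] by blast
  moreover have "(1 + \<omega>) ^ 2 / \<omega> = 1"
    using w(1,2) by (simp add: field_simps power2_eq_square add_eq_0_iff)
  \<comment> \<open>There is at least one branching vertex, so the term with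
    \<open>1 - z ^ 3\<close> disappears at \<omega> and only the trace is left.\<close>
  moreover have "(0::complex) ^ ones s = 0" using ds(1) by (simp add: s_def count_word_of)
  ultimately have "cyclic_sign (length s) * m2_tr (sun_prod \<omega> s) = 0"
    using P1 w(3) by (simp add: f_def poly_m2_tr_sun_prod)
  moreover have "cyclic_sign (length s) \<noteq> 0" using cyclic_sign[of "length s"] by auto
  moreover have "m2_tr (sun_prod \<omega> s) = m2_tr (ring_prod \<omega> ds)"
    unfolding s_def using ds(2) by (intro m2_tr_sun_prod_word_of) auto
  moreover obtain p where p: "p \<noteq> 0" "ring_prod \<omega> ds = M2 p (p * \<omega> ^ (2 * last ds)) (- p) (- p * \<omega> ^ (2 * last ds))"
    using ring_prod_at_cube_root[OF w(1,3) ds(1)] ds(2) w(4) by blast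
  moreover have "\<omega> ^ (2 * last ds) \<noteq> 1" using w(4) ds last_in_set by blast
  ultimately show False by (simp add: m2_tr_def)
qed

text \<open>Odd parity serves the modulus 4 at 0, and the conditions modulo 3 serve the nonvanishing
  at 1; the letters 4 and 5 are prime to 3 themselves.\<close>

lemma sun_determined:
  assumes G: "separated L1 L2 w" and odd: "odd (L1 + L2 + sum_list w)" and L: "\<not> 3 dvd L1" "\<not> 3 dvd L2"
    and E: "E \<in> simple_graphs n" and sun: "has_sun n E (word_of (L1 # L2 # w))"
  shows "determined_by_signless_laplacian_spectrum n E"
proof -
  define ds where "ds = L1 # L2 # w"
  define s where "s = word_of ds"
  have w: "set w \<subseteq> {4, 5}" and L7: "L1 \<ge> 7" "L2 \<ge> 7" using G by (auto simp: separated_def)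
  have ds: "\<forall>d\<in>set ds. d \<ge> 2" "\<forall>d\<in>set ds. d \<ge> 1" "\<forall>d\<in>set ds. d \<ge> 1 \<and> \<not> 3 dvd d" "ds \<noteq> []"
    using w L7 L by (auto simp: ds_def)
  have len: "length s = L1 + L2 + sum_list w" "ones s = length w + 2"
    using length_word_of[OF ds(2)] count_word_of[of ds] by (simp_all add: s_def ds_def)
  have sE: "has_sun n E s" using sun by (simp add: s_def ds_def)
  then obtain h where h: "sun_component E s h" "h ` sun_verts s = {..<n}" by (auto simp: has_sun_def)
  note degs = sun_degsum[OF h]
  have ext: "extremal_graph n E"
    by (rule sun_extremal[OF h]) (use len L7 word_of_separated[OF ds(1)] in \<open>auto simp: s_def\<close>)
  have P0: "cmod (poly (cpoly n E) 0) = 4"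
  proof -
    have "(- 1) ^ length s = (- 1 :: complex)" using odd len by simp
    then have "cmod (sun_value s 0) = 4"
      using cyclic_sign[of "length s"] unfolding sun_value_0 by (auto simp: norm_mult norm_power)
    then show ?thesis using char_poly_sun[OF E h] by simp
  qed
  have P1: "poly (cpoly n E) 1 \<noteq> 0"
    using char_poly_sun_at_1[OF E _ ds(4,3)] sE by (simp add: s_def)
  show ?thesis unfolding determined_by_signless_laplacian_spectrum_def
  proof (intro allI ballI impI)
    fix m F assume F: "F \<in> simple_graphs m"
      and spec: "signless_laplacian_spectrum m F = signless_laplacian_spectrum n E"
    note m = spectrum_eq_imp_char_poly_eq(1)[OF spec]
    note F = F[unfolded m] and cp = spectrum_eq_imp_char_poly_eq(2)[OF spec, unfolded m]
    have PF0: "cmod (poly (cpoly n F) 0) = 4" using P0 cp by simp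
    have "poly (cpoly n F) 0 \<noteq> 0" using PF0 by auto
    note pos = no_isolated_vertex[OF F this]
    have cn: "\<forall>i<n. deg F i \<in> {1, 2, 3}" "\<And>i j. {i, j} \<in> F \<Longrightarrow> deg F i + deg F j \<in> {4, 5}"
      "degsum n F 1 = degsum n E 1" "degsum n F 2 = degsum n E 2"
      by (rule cospectral_extremal[OF E F cp ext pos], assumption+)+
    interpret F: sunlike n F
    proof
      show "F \<in> simple_graphs n" by (rule F)
      show "deg F i \<in> {1, 2, 3}" if "i < n" for i using cn(1) that by blast
      show "deg F i + deg F j \<in> {4, 5}" if "{i, j} \<in> F" for i j using cn(2)[OF that] .
      show "degsum n F 1 = 2 * int n" using cn(3) degs(2) by simp
      show "u = v" if "deg F u = 1" "deg F v = 1" "{u, x} \<in> F" "{v, x} \<in> F" for u v x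
        using no_twin_leaves[OF F _ that] P1 cp by simp
      show "n > 0" using degs(1) len L7 by simp
    qed
    define t where "t = F.cycle_word"
    have spanF: "F.labelling ` sun_verts t = {..<n}"
      unfolding t_def by (rule sun_spanning(1)[OF F F.sun_component_walk F.labelling_verts PF0])
    have sF: "has_sun n F t" using F.sun_component_walk spanF unfolding t_def has_sun_def by blast
    note degsF = sun_degsum[OF F.sun_component_walk[folded t_def] spanF]
    have cnt: "ones t = ones s" using degsF(3) degs(3) cn(4) by simp
    have lent: "length t = length s" using degsF(1) degs(1) cnt by simp
    obtain k es where k: "rotate k t = word_of es" "\<forall>d\<in>set es. d \<ge> 1"
      using rotate_to_word_of[of t] cnt len by auto
    have sF': "has_sun n F (word_of es)" using has_sun_rotate[OF sF, of k] k by simp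
    have les: "length es = length w + 2"
    proof -
      have "mset (rotate k t) = mset t" by (rule mset_rotate)
      then have "ones (rotate k t) = ones t" by (metis count_mset)
      then show ?thesis using k cnt len count_word_of[of es] by simp
    qed
    have ses: "sum_list es = L1 + L2 + sum_list w"
      using length_word_of[OF k(2)] arg_cong[OF k(1), of length] lent len by simp
    have "m2_tr (sun_prod Z (word_of es)) = m2_tr (sun_prod Z s)"
      by (rule cospectral_suns[OF E F sE sF' _ _ cp])
         (use les ses len length_word_of[OF k(2)] in \<open>simp_all add: count_word_of\<close>)
    then have "m2_tr (ring_prod Z es) = m2_tr (ring_prod Z (L1 # L2 # w))"
      unfolding s_def m2_tr_sun_prod_word_of[OF k(2)] m2_tr_sun_prod_word_of[OF ds(2)] by (simp add: ds_def)
    from ring_prod_determines_word[OF G les k(2) ses this]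
    consider i where "rotate i es = L1 # L2 # w" | i where "rotate i es = L1 # rev w @ [L2]" by blast
    then have "has_sun n F s"
    proof cases
      case (1 i)
      then show ?thesis using has_sun_rotate[OF sF'] word_of_rotate[of i es] by (metis s_def ds_def)
    next
      \<comment> \<open>Read backwards, \<open>L1 # rev w @ [L2]\<close> is
        \<open>L2 # w @ [L1]\<close>, a rotation of \<open>ds\<close>.\<close>
      case (2 i)
      have "has_sun n F (word_of (L1 # rev w @ [L2]))"
        using 2 has_sun_rotate[OF sF'] word_of_rotate[of i es] by metis
      then have "has_sun n F (word_of (rev (L1 # rev w @ [L2])))"
        using rotate1_rev_word_of has_sun_rev has_sun_rotate1 by metis
      then have *: "has_sun n F (word_of ((L2 # w) @ [L1]))" by simp
      have "rotate (length (L2 # w)) ((L2 # w) @ [L1]) = ds" unfolding ds_def by (simp only: rotate_append) simp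
      then show ?thesis using has_sun_rotate[OF *] word_of_rotate s_def by metis
    qed
    then show "graph_isomorphic m F n E" unfolding m using has_sun_isomorphic sE by blast
  qed
qed

text \<open>A graph carrying both words has one trace, and \<open>chains_unique\<close> applies with
  an empty first chain. The reversed alternative then leaves only empty words.\<close>

lemma isomorphic_suns_eq:
  assumes G: "separated L1 L2 w" and w': "set w' \<subseteq> {4, 5}" "length w' = length w" "sum_list w' = sum_list w"
    and E: "E \<in> simple_graphs n" "has_sun n E (word_of (L1 # L2 # w))"
    and E': "E' \<in> simple_graphs n" "has_sun n E' (word_of (L1 # L2 # w'))"
    and iso: "graph_isomorphic n E' n E"
  shows "w' = w"
proof -
  have ws: "set w \<subseteq> {4, 5}" and L7: "L1 \<ge> 7" "L2 \<ge> 7" using G by (auto simp: separated_def)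
  have d: "\<forall>d\<in>set (L1 # L2 # w). d \<ge> 1" "\<forall>d\<in>set (L1 # L2 # w'). d \<ge> 1" using ws w' L7 by auto
  have "has_sun n E (word_of (L1 # L2 # w'))" by (rule has_sun_transport[OF E'(1) E(1) E'(2) iso])
  then have "m2_tr (sun_prod Z (word_of (L1 # L2 # w'))) = m2_tr (sun_prod Z (word_of (L1 # L2 # w)))"
    using w' length_word_of[OF d(1)] length_word_of[OF d(2)]
    by (intro cospectral_suns[OF E(1) E(1) E(2)]) (simp_all add: count_word_of)
  then have "m2_tr (ring_prod Z (L1 # [] @ L2 # w')) = m2_tr (ring_prod Z (L1 # [] @ L2 # w))"
    unfolding m2_tr_sun_prod_word_of[OF d(1)] m2_tr_sun_prod_word_of[OF d(2)] by simp
  then have "[] = ([] :: nat list) \<and> w' = w \<or> w' = [] \<and> [] = rev w"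
    using w' by (intro chains_unique[OF G]) auto
  then show ?thesis by auto
qed

section \<open>Counting\<close>

text \<open>
  Both blocks have sum 9, so that all words of the same length yield suns with the same number of vertices.
\<close>

definition pair_word :: "bool list \<Rightarrow> nat list" where
  "pair_word bs = concat (map (\<lambda>b. if b then [4, 5] else [5, 4]) bs)"

lemma pair_word: "set (pair_word bs) \<subseteq> {4, 5}" "length (pair_word bs) = 2 * length bs"
  "sum_list (pair_word bs) = 9 * length bs" by (induction bs) (auto simp: pair_word_def)

lemma pair_word_inject: "length bs = length cs \<Longrightarrow> pair_word bs = pair_word cs \<Longrightarrow> bs = cs"
  by (induction bs cs rule: list_induct2) (auto simp: pair_word_def split: if_splits)

abbreviation determined_classes :: "nat \<Rightarrow> nat set set set set" where
  "determined_classes n \<equiv> {E \<in> simple_graphs n. determined_by_signless_laplacian_spectrum n E} // isomorphism_relation n"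

lemma finite_determined_classes: "finite (determined_classes n)"
  by (auto simp: quotient_def intro: finite_subset[OF _ finite_simple_graphs[of n]])

lemma card_determined_classes_ge:
  assumes A: "finite A" and f: "\<And>a. a \<in> A \<Longrightarrow> f a \<in> simple_graphs n \<and> determined_by_signless_laplacian_spectrum n (f a)"
    and inj: "\<And>a b. a \<in> A \<Longrightarrow> b \<in> A \<Longrightarrow> graph_isomorphic n (f a) n (f b) \<Longrightarrow> a = b"
  shows "card A \<le> card (determined_classes n)"
proof (rule card_inj_on_le[OF _ _ finite_determined_classes])
  let ?c = "\<lambda>a. isomorphism_relation n `` {f a}"
  show "inj_on ?c A"
  proof (rule inj_onI)
    fix a b assume ab: "a \<in> A" "b \<in> A" "?c a = ?c b"
    have "(f b, f b) \<in> isomorphism_relation n"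
      using equiv_isomorphism_relation f ab(2) by (auto simp: equiv_def refl_on_def)
    then have "(f a, f b) \<in> isomorphism_relation n" using ab(3) by blast
    then show "a = b" using inj[OF ab(1,2)] by (simp add: isomorphism_relation_def)
  qed
  show "?c ` A \<subseteq> determined_classes n" using f by (auto intro: quotientI)
qed

lemma sum_deg_card:
  assumes E: "E \<in> simple_graphs n"
  shows "(\<Sum>i<n. deg E i) = 2 * int (card E)"
proof -
  have "card {v \<in> {..<n}. v \<in> e} = 2" if e: "e \<in> E" for e
  proof -
    obtain u v where uv: "e = {u, v}" "u < n" "v < n" "u \<noteq> v" by (metis simple_graphs_edge[OF E e])
    then have "{w \<in> {..<n}. w \<in> e} = {u, v}" by auto
    then show ?thesis using uv by simp
  qed
  moreover have "finite E"
    using E finite_subset[of E "Pow {..<n}"] by (auto simp: simple_graphs_def)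
  ultimately have "(\<Sum>i\<in>{..<n}. card {e \<in> E. i \<in> e}) = 2 * card E"
    by (intro sum_multicount) auto
  then show ?thesis unfolding deg_def vertex_degree_def by (simp flip: of_nat_sum)
qed

text \<open>The first trace gives the number of edges, and the empty and the complete graph are the
  only graphs with theirs. This covers small \<open>n\<close>.\<close>

lemma two_determined_classes:
  assumes n: "n \<ge> 2"
  shows "2 \<le> card (determined_classes n)"
proof -
  define K where "K = {{u, v} |u v. u < n \<and> v < n \<and> u \<noteq> v}"
  define f where "f b = (if b then K else {})" for b :: bool
  have simple: "f b \<in> simple_graphs n" for b by (auto simp: f_def simple_graphs_def K_def)
  have K: "finite K" "F \<in> simple_graphs n \<longleftrightarrow> F \<subseteq> K" for F
    using finite_subset[of K "Pow {..<n}"] by (auto simp: K_def simple_graphs_def)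
  have refl: "graph_isomorphic n E n E" for E
    unfolding graph_isomorphic_def by (intro exI[of _ id]) auto
  have det: "determined_by_signless_laplacian_spectrum n (f b)" for b
    unfolding determined_by_signless_laplacian_spectrum_def
  proof (intro allI ballI impI)
    fix m F assume F: "F \<in> simple_graphs m"
      and spec: "signless_laplacian_spectrum m F = signless_laplacian_spectrum n (f b)"
    note m = spectrum_eq_imp_char_poly_eq(1)[OF spec] and cp = spectrum_eq_imp_char_poly_eq(2)[OF spec]
    note F = F[unfolded m]
    have "mat_trace (signless_laplacian n F ^\<^sub>m 1) = mat_trace (signless_laplacian n (f b) ^\<^sub>m 1)"
      by (rule mat_trace_power_cong[where n = n]) (use cp m in auto)
    then have "(\<Sum>i<n. deg F i) = (\<Sum>i<n. deg (f b) i)"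
      unfolding traces of_int_eq_iff trace_formulas[OF F] trace_formulas[OF simple] by (simp add: degsum_def)
    then have "card F = card (f b)" by (simp add: sum_deg_card[OF F] sum_deg_card[OF simple])
    moreover have "F \<subseteq> K" "finite F" using F K finite_subset by auto
    ultimately have "F = f b" using card_subset_eq[OF K(1)] by (auto simp: f_def split: if_splits)
    then show "graph_isomorphic m F n (f b)" using refl m by simp
  qed
  have "{g 0, g 1} \<in> K" if "bij_betw g {..<n} {..<n}" for g
  proof -
    have "g 0 < n" "g 1 < n" using bij_betwE[OF that] n by auto
    moreover have "g 0 \<noteq> g 1" using inj_onD[OF bij_betw_imp_inj_on[OF that], of 0 1] n by auto
    ultimately show ?thesis by (auto simp: K_def)
  qed
  moreover from this[of id] have "{0, 1} \<in> K" by simp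
  moreover have "0 < n" "1 < n" using n by auto
  ultimately have "\<not> graph_isomorphic n K n {}" "\<not> graph_isomorphic n {} n K"
    unfolding graph_isomorphic_def by blast+
  then have "card (UNIV :: bool set) \<le> card (determined_classes n)"
    using simple det by (intro card_determined_classes_ge[where f = f]) (auto simp: f_def split: if_splits)
  then show ?thesis by simp
qed

text \<open>Separation asks for \<open>L2\<close> of at least \<open>26*q + 20\<close> when
  \<open>e = 1\<close>, and for \<open>L1\<close> another \<open>26*q + 20\<close> above it. Leaving
  room up to \<open>26*q + 22\<close> for \<open>L2\<close>, this takes \<open>78*q + 64\<close> for
  the sum \<open>S\<close>; the remaining \<open>11*q + 5*e + 2\<close> vertices bring it to
  \<open>89*q + 71\<close>.\<close>

lemma many_determined_classes:
  assumes q: "q \<ge> 1" and n: "n \<ge> 89 * q + 71"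
  shows "2 ^ q \<le> card (determined_classes n)"
proof -
  \<comment> \<open>For even \<open>n\<close> an extra letter 4 makes the cycle length
    \<open>n - 2*q - e - 2\<close> odd.\<close>
  define e where "e = (if even n then 1 else 0 :: nat)"
  define word where "word bs = pair_word bs @ replicate e 4" for bs
  define S where "S = n - 11 * q - 5 * e - 2"
  define A where "A = {bs :: bool list. length bs = q}"
  have e1: "e \<le> 1" by (simp add: e_def)
  have S: "S + 11 * q + 5 * e + 2 = n" using n e1 by (simp add: S_def)
  \<comment> \<open>Of three consecutive values at most two are excluded, those congruent to 0 and
    to \<open>S\<close> modulo 3.\<close>
  obtain L2 where L2: "26 * q + 20 \<le> L2" "L2 \<le> 26 * q + 22" "\<not> 3 dvd L2" "\<not> 3 dvd (S - L2)"
  proof -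
    have "\<exists>L2. 26 * q + 20 \<le> L2 \<and> L2 \<le> 26 * q + 22 \<and> \<not> 3 dvd L2 \<and> \<not> 3 dvd (S - L2)"
    proof (rule ccontr)
      assume *: "\<not> ?thesis"
      have "S \<ge> 26 * q + 22" using S n e1 by linarith
      then show False
        using *[simplified, rule_format, of "26 * q + 20"] *[simplified, rule_format, of "26 * q + 21"]
          *[simplified, rule_format, of "26 * q + 22"] by presburger
    qed
    then show thesis using that by blast
  qed
  define L1 where "L1 = S - L2"
  have L: "L1 + L2 = S" using L2 S n e1 by (simp add: L1_def)
  have word: "set (word bs) \<subseteq> {4, 5}" "length (word bs) = 2 * q + e" "sum_list (word bs) = 9 * q + 4 * e" if "bs \<in> A" for bs
    using that pair_word[of bs] by (auto simp: word_def A_def sum_list_replicate)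
  have sep: "separated L1 L2 (word bs)" if "bs \<in> A" for bs
    using word[OF that] L2 L S n e1 q by (auto simp: separated_def)
  have od: "odd (L1 + L2 + sum_list (word bs))" if "bs \<in> A" for bs
    using L S word(3)[OF that] by (auto simp: e_def split: if_splits)
  have ex: "\<exists>E\<in>simple_graphs n. has_sun n E (word_of (L1 # L2 # word bs))" if "bs \<in> A" for bs
  proof (rule has_sun_exists)
    have "\<forall>d\<in>set (L1 # L2 # word bs). d \<ge> 1" using sep[OF that] by (auto simp: separated_def)
    then have "length (word_of (L1 # L2 # word bs)) = S + 9 * q + 4 * e"
      using length_word_of L word(3)[OF that] by simp
    moreover have "ones (word_of (L1 # L2 # word bs)) = 2 * q + e + 2"
      using count_word_of word(2)[OF that] by simp
    ultimately show "3 \<le> length (word_of (L1 # L2 # word bs))"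
      "n = length (word_of (L1 # L2 # word bs)) + ones (word_of (L1 # L2 # word bs))"
      using S q by simp_all
  qed
  then obtain f where f: "\<And>bs. bs \<in> A \<Longrightarrow> f bs \<in> simple_graphs n \<and> has_sun n (f bs) (word_of (L1 # L2 # word bs))"
    by metis
  have "card A \<le> card (determined_classes n)"
  proof (rule card_determined_classes_ge[where f = f])
    show "finite A" unfolding A_def using finite_lists_length_eq[of "UNIV :: bool set" q] by simp
    show "f bs \<in> simple_graphs n \<and> determined_by_signless_laplacian_spectrum n (f bs)" if "bs \<in> A" for bs
      using f[OF that] sun_determined[OF sep[OF that] od[OF that]] L2 unfolding L1_def by blast
    show "bs = cs" if "bs \<in> A" "cs \<in> A" "graph_isomorphic n (f bs) n (f cs)" for bs cs
    proof -
      have "word bs = word cs"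
        by (rule isomorphic_suns_eq[OF sep[OF that(2)] _ _ _ _ _ _ _ that(3)])
           (use f that word in auto)
      then show ?thesis using that pair_word_inject by (auto simp: word_def A_def)
    qed
  qed
  moreover have "card A = 2 ^ q"
    unfolding A_def using card_lists_length_eq[of "UNIV :: bool set" q] by simp
  ultimately show ?thesis by simp
qed

text \<open>For \<open>n = 1\<close> there is a single class while \<open>exp c > 1\<close>, so the
  bound starts at 2.\<close>

theorem theorem2p8:
  shows "\<exists>c::real. c > 0 \<and>
    (\<forall>n::nat. n \<ge> 2 \<longrightarrow>
       exp (c * real n) \<le>
       real (card ({E \<in> simple_graphs n. determined_by_signless_laplacian_spectrum n E}
                     // isomorphism_relation n)))"
proof (intro exI[of _ "1 / 1000"] conjI allI impI)
  fix n :: nat assume n: "n \<ge> 2"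
  show "exp (1 / 1000 * real n) \<le> real (card (determined_classes n))"
  \<comment> \<open>Up to 500 the exponent is at most 1/2, and two classes suffice as
    \<open>exp (1 / 2) \<le> 2\<close>.\<close>
  proof (cases "n \<le> 500")
    case True
    then have "exp (1 / 1000 * real n) \<le> exp (1 / 2)" by simp
    also have "\<dots> \<le> 2" by (rule exp_half_le2)
    also have "2 \<le> real (card (determined_classes n))" using two_determined_classes[OF n] by simp
    finally show ?thesis .
  next
    case False
    define q where "q = (n - 71) div 89"
    have q: "q \<ge> 1" "n \<ge> 89 * q + 71" "n < 89 * q + 160"
      using False unfolding q_def by linarith+
    \<comment> \<open>That is \<open>n \<le> 500 * q\<close>, which follows from
      \<open>n < 89 * q + 160\<close> and \<open>q \<ge> 1\<close>.\<close>
    have "1 / 1000 * real n \<le> real q * (1 / 2)" using q False by linarith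
    then have "exp (1 / 1000 * real n) \<le> exp (real q * (1 / 2))" by simp
    also have "\<dots> = exp (1 / 2) ^ q" by (rule exp_of_nat_mult)
    also have "\<dots> \<le> 2 ^ q" by (intro power_mono exp_half_le2) simp
    also have "\<dots> \<le> real (card (determined_classes n))" using many_determined_classes[OF q(1,2)] by (metis of_nat_le_iff of_nat_numeral of_nat_power)
    finally show ?thesis .
  qed
qed simp

end
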